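(* Let $\mathcal I=\{1,\dots,m\}$ and $\mathcal O=\{m+1,\dots,m+n\}$ be the incoming and outgoing roads of a junction. For each $k\in\mathcal I\cup\mathcal O$ let the flux $f_k\in\mathcal C^2$ satisfy $f_k(0)=f_k(\rho_k^{jam})=0$ and $f_k''(\rho)<0$ for all $\rho\in[0,\rho_k^{jam}]$. Let $M>0$ and $c_i>0$ ($i\in\mathcal I$) satisfy $c_iM>f_i^{max}$ for all $i\in\mathcal I$. Let constant initial densities $$\rho_k(0,x)=\rho_k^\diamondsuit\in[0,\rho_k^{jam}[\,,\qquad k\in\mathcal I\cup\mathcal O,$$ be assigned along each road, together with constant turning preferences $\theta_{ij}\in[0,1]$ with $\sum_{j\in\mathcal O}\theta_{ij}=1$ for each $i\in\mathcal I$. Then one can choose initial queue sizes $q_j^\diamondsuit\ge 0$, $j\in\mathcal O$, with $\sum_{j\in\mathcal O}q_j^\diamondsuit\le M$, such that the solution $(\rho_k)_{k\in\mathcal I\cup\mathcal O}$ of the Riemann problem with buffer of size $M$, with initial densities $\rho_k^\diamondsuit$ and initial queues $q_j(0)=q_j^\diamondsuit$, coincides with the self-similar solution $(\hat\rho_k)_{k\in\mathcal I\cup\mathcal O}$ determined by the Limit Riemann Solver (LRS) for the data $\rho_k^\diamondsuit,\theta_{ij}$; that is, $\rho_k(t,\cdot)=\hat\rho_k(t,\cdot)$ for all $t>0$ and all $k\in\mathcal I\cup\mathcal O$.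
   Context: Roads and fluxes. On road $k\in\mathcal I\cup\mathcal O$ the car density $\rho_k(t,x)\in[0,\rho_k^{jam}]$ satisfies the scalar conservation law $\rho_t+f_k(\rho)_x=0$ for $t\ge0$, with $x\in\,]-\infty,0]$ if $k\in\mathcal I$ and $x\in[0,+\infty[$ if $k\in\mathcal O$. Set $f_k^{max}=\max_s f_k(s)$ and $\rho_k^{max}=\arg\max_s f_k(s)$. A state $\rho$ is free if $\rho\in[0,\rho_k^{max}]$ and congested if $\rho\in[\rho_k^{max},\rho_k^{jam}]$. Maximum boundary fluxes. For $i\in\mathcal I$: $\omega_i(\rho)=f_i(\rho)$ if $\rho$ is free, $\omega_i(\rho)=f_i^{max}$ if $\rho$ is congested. For $j\in\mathcal O$: $\omega_j(\rho)=f_j(\rho)$ if $\rho$ is congested, $\omega_j(\rho)=f_j^{max}$ if $\rho$ is free. Riemann problem with buffer of size $M$. The buffer state is $(q_j)_{j\in\mathcal O}$ with $q_j(t)\ge0$ the number of cars in the intersection waiting to enter road $j$, and $\sum_j q_j\le M$. A solution consists of entropy weak solutions $\rho_k$ of the conservation laws on each road with initial data $\rho_k(0,x)=\rho_k^\diamondsuit$ (constant), and Lipschitz functions $q_j$ with $q_j(0)=q_j^\diamondsuit$, such that, with the traces $\bar\rho_i(t)=\lim_{x\to0-}\rho_i(t,x)$ ($i\in\mathcal I$), $\bar\rho_j(t)=\lim_{x\to0+}\rho_j(t,x)$ ($j\in\mathcal O$), $\bar f_k(t)=f_k(\bar\rho_k(t))$, $\omega_k=\omega_k(\bar\rho_k(t))$,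 the following hold for a.e. $t\ge 0$: (1) $\dot q_j(t)=\sum_{i\in\mathcal I}\bar f_i(t)\theta_{ij}-\bar f_j(t)$ for all $j\in\mathcal O$; (2) $\bar f_i=\min\{\omega_i,\ c_i(M-\sum_{j\in\mathcal O}q_j)\}$ for all $i\in\mathcal I$; (3) for all $j\in\mathcal O$: if $q_j>0$ then $\bar f_j=\omega_j$; if $q_j=0$ then $\bar f_j=\min\{\omega_j,\ \sum_{i\in\mathcal I}\bar f_i\theta_{ij}\}$. It is known that this problem has a unique solution. Limit Riemann Solver (LRS). Given $\rho_k^\diamondsuit$ and $\theta_{ij}$, let $\omega_k^\diamondsuit=\omega_k(\rho_k^\diamondsuit)$, $\gamma_i(s)=\min\{c_is,\omega_i^\diamondsuit\}$ for $i\in\mathcal I$, and $$\bar s=\max\Big\{s\in[0,M]:\ \sum_{i\in\mathcal I}\gamma_i(s)\theta_{ij}\le\omega_j^\diamondsuit\ \text{ for all } j\in\mathcal O\Big\}.$$ The boundary fluxes for $t>0$ are the constants $\bar f_i=\gamma_i(\bar s)$ ($i\in\mathcal I$) and $\bar f_j=\sum_{i\in\mathcal I}\bar f_i\theta_{ij}$ ($j\in\mathcal O$). These determine the self-similar solution $(\hat\rho_k)$ as follows. For $i\in\mathcal I$: if $\bar f_i=f_i(\rho_i^\diamondsuit)$ then $\hat\rho_i\equiv\rho_i^\diamondsuit$; otherwise there is a unique state $\rho_i^0$ with $f_i(\rho_i^0)=\bar f_i$ such that the entropy solution of $\rho_t+f_i(\rho)_x=0$ on the whole line with initial data $\rho_i^\diamondsuit$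 for $x<0$ and $\rho_i^0$ for $x>0$ contains only waves of negative speed, and $\hat\rho_i$ is the restriction of this solution to $x<0$. For $j\in\mathcal O$: if $\bar f_j=f_j(\rho_j^\diamondsuit)$ then $\hat\rho_j\equiv\rho_j^\diamondsuit$; otherwise there is a unique state $\rho_j^0$ with $f_j(\rho_j^0)=\bar f_j$ such that the entropy solution of $\rho_t+f_j(\rho)_x=0$ on the whole line with initial data $\rho_j^0$ for $x<0$ and $\rho_j^\diamondsuit$ for $x>0$ contains only waves of positive speed, and $\hat\rho_j$ is the restriction of this solution to $x>0$. *)

theory Defs
  imports "HOL-Analysis.Analysis"
begin

(* Fluxes are functions on [0, R], where R is the jam density; nothing is assumed about their
   values outside this interval, so C^2 regularity is expressed with derivatives within {0..R}. *)
definition concave_flux :: "(real \<Rightarrow> real) \<Rightarrow> real \<Rightarrow> bool" where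
  "concave_flux f R \<longleftrightarrow> 0 < R \<and> f 0 = 0 \<and> f R = 0 \<and>
     (\<exists>f' f''. (\<forall>r\<in>{0..R}. (f has_real_derivative f' r) (at r within {0..R}) \<and>
                            (f' has_real_derivative f'' r) (at r within {0..R}) \<and>
                            f'' r < 0) \<and>
               continuous_on {0..R} f'')"

definition flux_max :: "(real \<Rightarrow> real) \<Rightarrow> real \<Rightarrow> real" where
  "flux_max f R = (SUP r\<in>{0..R}. f r)"

definition density_max :: "(real \<Rightarrow> real) \<Rightarrow> real \<Rightarrow> real" where
  "density_max f R = arg_max_on f {0..R}"

(* Free and congested overlap at density_max, where both branches have the same value. *)
definition omega_in :: "(real \<Rightarrow> real) \<Rightarrow> real \<Rightarrow> real \<Rightarrow> real" where
  "omega_in f R r = (if r \<le> density_max f R then f r else flux_max f R)"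

definition omega_out :: "(real \<Rightarrow> real) \<Rightarrow> real \<Rightarrow> real \<Rightarrow> real" where
  "omega_out f R r = (if density_max f R \<le> r then f r else flux_max f R)"

(* p = (t, x); phi_t and phi_x are the partial derivatives of the C^1 function phi. The support
   is compact in the open set {0<..} \<times> D, so it avoids t = 0 and the boundary of D. *)
definition test_function ::
  "real set \<Rightarrow> (real \<times> real \<Rightarrow> real) \<Rightarrow> (real \<times> real \<Rightarrow> real) \<Rightarrow> (real \<times> real \<Rightarrow> real) \<Rightarrow> bool" where
  "test_function D \<phi> \<phi>t \<phi>x \<longleftrightarrow>
     (\<forall>p. (\<phi> has_derivative (\<lambda>h. \<phi>t p * fst h + \<phi>x p * snd h)) (at p)) \<and>
     continuous_on UNIV \<phi>t \<and> continuous_on UNIV \<phi>x \<and>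
     (\<forall>p. 0 \<le> \<phi> p) \<and>
     (\<exists>K. compact K \<and> K \<subseteq> {0<..} \<times> D \<and> (\<forall>p. p \<notin> K \<longrightarrow> \<phi> p = 0))"

(* Entropy weak solution u t x, for t \<ge> 0 and x in the open set D, of u_t + f(u)_x = 0 with
   initial data u0: a bounded function, continuous from time into L^1_loc (including up to the
   boundary of D), satisfying the Kruzkov inequality for every constant k. As u takes values in
   {0..R}, the instances k = 0 and k = R together say that u is a weak solution. *)
definition entropy_solution ::
  "(real \<Rightarrow> real) \<Rightarrow> real \<Rightarrow> real set \<Rightarrow> (real \<Rightarrow> real) \<Rightarrow> (real \<Rightarrow> real \<Rightarrow> real) \<Rightarrow> bool" where
  "entropy_solution f R D u0 u \<longleftrightarrow>
     set_borel_measurable lborel ({0..} \<times> D) (\<lambda>p. u (fst p) (snd p)) \<and>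
     (\<forall>t\<ge>0. \<forall>x\<in>D. u t x \<in> {0..R}) \<and>
     (\<forall>t0\<ge>0. \<forall>L. ((\<lambda>t. LINT x:D \<inter> {-L..L}|lborel. \<bar>u t x - u t0 x\<bar>) \<longlongrightarrow> 0)
                    (at t0 within {0..})) \<and>
     (AE x in lborel. x \<in> D \<longrightarrow> u 0 x = u0 x) \<and>
     (\<forall>k\<in>{0..R}. \<forall>\<phi> \<phi>t \<phi>x. test_function D \<phi> \<phi>t \<phi>x \<longrightarrow>
        0 \<le> (LINT p:{0<..} \<times> D|lborel.
               \<bar>u (fst p) (snd p) - k\<bar> * \<phi>t p +
               sgn (u (fst p) (snd p) - k) * (f (u (fst p) (snd p)) - f k) * \<phi>x p))"

(* Arguments throughout: Inc, Out are the incoming and outgoing roads; f k, R k the flux and jam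
   density of road k; M the buffer size; c, \<theta> the intersection coefficients and turning
   preferences; r0 k, q0 j the initial densities and queues. *)
definition admissible_queues :: "nat set \<Rightarrow> real \<Rightarrow> (nat \<Rightarrow> real) \<Rightarrow> bool" where
  "admissible_queues Out M q \<longleftrightarrow> (\<forall>j\<in>Out. 0 \<le> q j) \<and> (\<Sum>j\<in>Out. q j) \<le> M"

(* b k is the boundary trace of the density on road k at time t. *)
definition buffer_solution ::
  "nat set \<Rightarrow> nat set \<Rightarrow> (nat \<Rightarrow> real \<Rightarrow> real) \<Rightarrow> (nat \<Rightarrow> real) \<Rightarrow> real \<Rightarrow> (nat \<Rightarrow> real) \<Rightarrow>
   (nat \<Rightarrow> nat \<Rightarrow> real) \<Rightarrow> (nat \<Rightarrow> real) \<Rightarrow> (nat \<Rightarrow> real) \<Rightarrow>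
   (nat \<Rightarrow> real \<Rightarrow> real \<Rightarrow> real) \<Rightarrow> (nat \<Rightarrow> real \<Rightarrow> real) \<Rightarrow> bool" where
  "buffer_solution Inc Out f R M c \<theta> r0 q0 \<rho> q \<longleftrightarrow>
     (\<forall>i\<in>Inc. entropy_solution (f i) (R i) {..<0} (\<lambda>x. r0 i) (\<rho> i)) \<and>
     (\<forall>j\<in>Out. entropy_solution (f j) (R j) {0<..} (\<lambda>x. r0 j) (\<rho> j)) \<and>
     (\<forall>j\<in>Out. (\<exists>C. C-lipschitz_on {0..} (q j)) \<and> q j 0 = q0 j) \<and>
     (\<forall>t\<ge>0. admissible_queues Out M (\<lambda>j. q j t)) \<and>
     (AE t in lborel. 0 < t \<longrightarrow> (\<exists>b.
        (\<forall>i\<in>Inc. (\<rho> i t \<longlongrightarrow> b i) (at_left 0)) \<and>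
        (\<forall>j\<in>Out. (\<rho> j t \<longlongrightarrow> b j) (at_right 0)) \<and>
        (\<forall>j\<in>Out. (q j has_real_derivative (\<Sum>i\<in>Inc. f i (b i) * \<theta> i j) - f j (b j)) (at t)) \<and>
        (\<forall>i\<in>Inc. f i (b i) = min (omega_in (f i) (R i) (b i)) (c i * (M - (\<Sum>j\<in>Out. q j t)))) \<and>
        (\<forall>j\<in>Out. (0 < q j t \<longrightarrow> f j (b j) = omega_out (f j) (R j) (b j)) \<and>
                 (q j t = 0 \<longrightarrow> f j (b j) = min (omega_out (f j) (R j) (b j))
                                                 (\<Sum>i\<in>Inc. f i (b i) * \<theta> i j)))))"

definition lrs_gamma ::
  "(nat \<Rightarrow> real \<Rightarrow> real) \<Rightarrow> (nat \<Rightarrow> real) \<Rightarrow> (nat \<Rightarrow> real) \<Rightarrow> (nat \<Rightarrow> real) \<Rightarrow> nat \<Rightarrow> real \<Rightarrow> real" where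
  "lrs_gamma f R c r0 i s = min (c i * s) (omega_in (f i) (R i) (r0 i))"

definition lrs_level ::
  "nat set \<Rightarrow> nat set \<Rightarrow> (nat \<Rightarrow> real \<Rightarrow> real) \<Rightarrow> (nat \<Rightarrow> real) \<Rightarrow> real \<Rightarrow> (nat \<Rightarrow> real) \<Rightarrow>
   (nat \<Rightarrow> nat \<Rightarrow> real) \<Rightarrow> (nat \<Rightarrow> real) \<Rightarrow> real" where
  "lrs_level Inc Out f R M c \<theta> r0 =
     (GREATEST s. s \<in> {0..M} \<and>
        (\<forall>j\<in>Out. (\<Sum>i\<in>Inc. lrs_gamma f R c r0 i s * \<theta> i j) \<le> omega_out (f j) (R j) (r0 j)))"

definition lrs_flux_in ::
  "nat set \<Rightarrow> nat set \<Rightarrow> (nat \<Rightarrow> real \<Rightarrow> real) \<Rightarrow> (nat \<Rightarrow> real) \<Rightarrow> real \<Rightarrow> (nat \<Rightarrow> real) \<Rightarrow>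
   (nat \<Rightarrow> nat \<Rightarrow> real) \<Rightarrow> (nat \<Rightarrow> real) \<Rightarrow> nat \<Rightarrow> real" where
  "lrs_flux_in Inc Out f R M c \<theta> r0 i =
     lrs_gamma f R c r0 i (lrs_level Inc Out f R M c \<theta> r0)"

definition lrs_flux_out ::
  "nat set \<Rightarrow> nat set \<Rightarrow> (nat \<Rightarrow> real \<Rightarrow> real) \<Rightarrow> (nat \<Rightarrow> real) \<Rightarrow> real \<Rightarrow> (nat \<Rightarrow> real) \<Rightarrow>
   (nat \<Rightarrow> nat \<Rightarrow> real) \<Rightarrow> (nat \<Rightarrow> real) \<Rightarrow> nat \<Rightarrow> real" where
  "lrs_flux_out Inc Out f R M c \<theta> r0 j =
     (\<Sum>i\<in>Inc. lrs_flux_in Inc Out f R M c \<theta> r0 i * \<theta> i j)"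

definition riemann_data :: "real \<Rightarrow> real \<Rightarrow> real \<Rightarrow> real" where
  "riemann_data l r x = (if x < 0 then l else r)"

(* The solution of the whole-line Riemann problem (l, r) has only waves of negative speed iff its
   state is r throughout x > 0. A rarefaction fan whose closure reaches speed 0 counts as
   negative: this occurs when the boundary flux is flux_max, and there would otherwise be no
   admissible state r. A stationary shock cannot occur, since it would force f l = f r = F,
   which is the first case. Symmetrically for waves of positive speed. *)
definition lrs_profile_in ::
  "(real \<Rightarrow> real) \<Rightarrow> real \<Rightarrow> real \<Rightarrow> real \<Rightarrow> (real \<Rightarrow> real \<Rightarrow> real) \<Rightarrow> bool" where
  "lrs_profile_in f R l F u \<longleftrightarrow>
     (if F = f l then \<forall>t>0. \<forall>x<0. u t x = l
      else \<exists>r\<in>{0..R}. f r = F \<and>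
             (\<exists>v. entropy_solution f R UNIV (riemann_data l r) v \<and>
                  (\<forall>t>0. AE x in lborel. 0 < x \<longrightarrow> v t x = r) \<and>
                  (\<forall>t>0. \<forall>x<0. u t x = v t x)))"

definition lrs_profile_out ::
  "(real \<Rightarrow> real) \<Rightarrow> real \<Rightarrow> real \<Rightarrow> real \<Rightarrow> (real \<Rightarrow> real \<Rightarrow> real) \<Rightarrow> bool" where
  "lrs_profile_out f R r F u \<longleftrightarrow>
     (if F = f r then \<forall>t>0. \<forall>x>0. u t x = r
      else \<exists>l\<in>{0..R}. f l = F \<and>
             (\<exists>v. entropy_solution f R UNIV (riemann_data l r) v \<and>
                  (\<forall>t>0. AE x in lborel. x < 0 \<longrightarrow> v t x = l) \<and>
                  (\<forall>t>0. \<forall>x>0. u t x = v t x)))"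

definition lrs_solution ::
  "nat set \<Rightarrow> nat set \<Rightarrow> (nat \<Rightarrow> real \<Rightarrow> real) \<Rightarrow> (nat \<Rightarrow> real) \<Rightarrow> real \<Rightarrow> (nat \<Rightarrow> real) \<Rightarrow>
   (nat \<Rightarrow> nat \<Rightarrow> real) \<Rightarrow> (nat \<Rightarrow> real) \<Rightarrow> (nat \<Rightarrow> real \<Rightarrow> real \<Rightarrow> real) \<Rightarrow> bool" where
  "lrs_solution Inc Out f R M c \<theta> r0 \<rho> \<longleftrightarrow>
     (\<forall>i\<in>Inc. lrs_profile_in (f i) (R i) (r0 i) (lrs_flux_in Inc Out f R M c \<theta> r0 i) (\<rho> i)) \<and>
     (\<forall>j\<in>Out. lrs_profile_out (f j) (R j) (r0 j) (lrs_flux_out Inc Out f R M c \<theta> r0 j) (\<rho> j))"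

end

theory Submission
  imports Defs
begin

text \<open>
  The limit Riemann solver assigns to the data a level \<open>s\<close> of free space in the buffer, and
  with it the inflow \<open>min (c\<^sub>i s) \<omega>\<^sub>i\<close> of every incoming road. If \<open>s < M\<close>, the level cannot be raised because the supply of
  some outgoing road is exhausted; put all \<open>M - s\<close> waiting cars in front of that road (\<open>balancing_queues_exist\<close>). If
  \<open>s = M\<close>, start with empty queues. Then the buffer is in equilibrium: inflows computed from the free space
  \<open>s\<close> are those of the limit Riemann solver, and no queue has a reason to change. With constant queues the problem splits into
  one road at a time with a prescribed constant boundary flux, which is solved by a self-similar wave
  (\<open>solutions_exist\<close>). These waves are given by Osher's formula, which picks for each \<open>\<xi> = x / t\<close> an extremum of
  \<open>f u - \<xi> u\<close> between the two states of the Riemann problem.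

  It remains to see that \<^emph>\<open>every\<close> solution with these initial queues is the self-similar one. The arguments on a
  single road use only Kruzkov's inequalities for constants, up to the boundary \<open>x = 0\<close>, where a trace exists by
  assumption (\<open>entropy_trace_solution\<close>). Written as \<open>E\<^sub>t + Q\<^sub>x \<le> 0\<close> with a boundary flux \<open>G\<close>, they
  can be glued along a moving line if the flux through the line does not increase (\<open>balance_across_line\<close>). An energy \<open>E\<close>
  that vanishes initially satisfies the integrated inequality \<open>\<integral> G \<le> 0\<close> (\<open>boundary_flux_nonpos\<close>), and it vanishes identically
  if \<open>G \<ge> 0\<close> (\<open>energy_vanishes\<close>). Three conclusions follow for an incoming road.

  \<^item> Its maximum boundary flux never falls below the initial one (\<open>demand_not_reduced\<close>).

  \<^item> If the initial state is free, the flux through the boundary is on average at most the initial flux (\<open>free_trace_flux\<close>).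

  \<^item> The initial state and the boundary flux, if it is constant, determine the solution (\<open>incoming_unique\<close>): constants, shocks and
  rarefaction waves are each recognised by energies that measure the distance to the expected state on either side of a line.

  The outgoing roads are mirror images of incoming ones: \<open>u(t, x) \<mapsto> R - u(t, - x)\<close> exchanges the two kinds together with
  free and congested states.

  At the junction, these facts bound how far the queues can move. If the free space deviates from the level
  by \<open>g t\<close>, the inflows deviate from the expected ones by a multiple of \<open>g\<close>, from below at almost every time and from above on average;
  integrating the laws for the queues gives \<open>g T \<le> K \<integral>\<^sub>0\<^sup>T g\<close>, so that \<open>g = 0\<close> by Gronwall's inequality
  (\<open>queues_stay_balanced\<close>). Hence the boundary fluxes are those of the limit Riemann solver, and the uniqueness on
  single roads identifies the densities.
\<close>

section \<open>Strictly concave fluxes\<close>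

text \<open>Strict concavity enters the proofs as the strict decrease of a continuous derivative.\<close>

lemma concave_fluxD:
  assumes "concave_flux f R"
  obtains f' where "0 < R" "f 0 = 0" "f R = 0"
    "\<And>x. x \<in> {0..R} \<Longrightarrow> (f has_real_derivative f' x) (at x within {0..R})"
    "\<And>x y. 0 \<le> x \<Longrightarrow> x < y \<Longrightarrow> y \<le> R \<Longrightarrow> f' y < f' x"
    "continuous_on {0..R} f'"
proof -
  obtain f' f'' where f': "\<And>r. r\<in>{0..R} \<Longrightarrow> (f has_real_derivative f' r) (at r within {0..R})"
    and f'': "\<And>r. r\<in>{0..R} \<Longrightarrow> (f' has_real_derivative f'' r) (at r within {0..R})"
    and neg: "\<And>r. r\<in>{0..R} \<Longrightarrow> f'' r < 0" and R: "0 < R" "f 0 = 0" "f R = 0"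
    using assms unfolding concave_flux_def by blast
  have cont: "continuous_on {0..R} f'"
    using f'' by (meson DERIV_continuous continuous_on_eq_continuous_within)
  have "f' y < f' x" if xy: "0 \<le> x" "x < y" "y \<le> R" for x y
  proof -
    have "\<exists>z\<in>{x<..<y}. f' y - f' x = (\<lambda>h. f'' z * h) (y - x)"
    proof (rule mvt_simple)
      fix z assume "x \<le> z" "z \<le> y"
      hence "(f' has_real_derivative f'' z) (at z within {x..y})"
        using xy by (intro DERIV_subset[OF f'']) auto
      thus "(f' has_derivative (*) (f'' z)) (at z within {x..y})"
        by (simp add: has_field_derivative_def)
    qed (use xy in auto)
    then obtain z where z: "z \<in> {x<..<y}" "f' y - f' x = f'' z * (y - x)" by auto
    have "f'' z * (y - x) < 0" using z xy by (intro mult_neg_pos neg) auto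
    thus ?thesis using z by simp
  qed
  thus thesis using that R f' cont by blast
qed

locale concave_road =
  fixes f :: "real \<Rightarrow> real" and R :: real
  assumes concave: "concave_flux f R"
begin

text \<open>Chosen rather than taken as the total derivative, since the flux is arbitrary outside \<open>[0, R]\<close> and at the end points only one-sided derivatives make sense.\<close>

definition speed :: "real \<Rightarrow> real" where
  "speed = (SOME f'. (\<forall>x\<in>{0..R}. (f has_real_derivative f' x) (at x within {0..R})) \<and>
     (\<forall>x y. 0 \<le> x \<longrightarrow> x < y \<longrightarrow> y \<le> R \<longrightarrow> f' y < f' x) \<and> continuous_on {0..R} f')"

lemma speed_ex: "(\<forall>x\<in>{0..R}. (f has_real_derivative speed x) (at x within {0..R})) \<and>
     (\<forall>x y. 0 \<le> x \<longrightarrow> x < y \<longrightarrow> y \<le> R \<longrightarrow> speed y < speed x) \<and> continuous_on {0..R} speed"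
proof (rule concave_fluxD[OF concave], goal_cases)
  case (1 f')
  hence "\<exists>f'. (\<forall>x\<in>{0..R}. (f has_real_derivative f' x) (at x within {0..R})) \<and>
     (\<forall>x y. 0 \<le> x \<longrightarrow> x < y \<longrightarrow> y \<le> R \<longrightarrow> f' y < f' x) \<and> continuous_on {0..R} f'"
    by (intro exI[of _ f']) simp
  from someI_ex[OF this] show ?case unfolding speed_def .
qed

lemma R_pos: "0 < R" and flux_zero: "f 0 = 0" "f R = 0"
  using concave unfolding concave_flux_def by auto

lemma flux_has_derivative:
  "x \<in> {0..R} \<Longrightarrow> (f has_real_derivative speed x) (at x within {0..R})"
  using speed_ex by blast

lemma speed_strict_decreasing: "0 \<le> x \<Longrightarrow> x < y \<Longrightarrow> y \<le> R \<Longrightarrow> speed y < speed x"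
  using speed_ex by blast

lemma continuous_flux: "continuous_on {0..R} f"
  using flux_has_derivative by (meson DERIV_continuous continuous_on_eq_continuous_within)

lemma flux_mvt:
  assumes "0 \<le> x" "x < y" "y \<le> R"
  obtains z where "x < z" "z < y" "f y - f x = speed z * (y - x)"
proof -
  have "\<exists>z\<in>{x<..<y}. f y - f x = (\<lambda>h. speed z * h) (y - x)"
  proof (rule mvt_simple)
    fix z assume "x \<le> z" "z \<le> y"
    hence "(f has_real_derivative speed z) (at z within {x..y})"
      using assms by (intro DERIV_subset[OF flux_has_derivative]) auto
    thus "(f has_derivative (*) (speed z)) (at z within {x..y})"
      by (simp add: has_field_derivative_def)
  qed (use assms in auto)
  thus ?thesis using that by auto
qed

lemma flux_below_tangent:
  assumes "u \<in> {0..R}" "k \<in> {0..R}"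
  shows "f u - f k \<le> speed k * (u - k)"
proof -
  consider "u = k" | "k < u" | "u < k" by linarith
  thus ?thesis
  proof cases
    case 2
    then obtain z where z: "k < z" "z < u" "f u - f k = speed z * (u - k)"
      using flux_mvt[of k u] assms by auto
    have "speed z \<le> speed k" using speed_strict_decreasing[of k z] z assms by auto
    thus ?thesis using z 2 by (simp add: mult_right_mono)
  next
    case 3
    then obtain z where z: "u < z" "z < k" "f k - f u = speed z * (k - u)"
      using flux_mvt[of u k] assms by auto
    have "speed k \<le> speed z" using speed_strict_decreasing[of z k] z assms by auto
    hence "speed k * (k - u) \<le> speed z * (k - u)" using 3 by (simp add: mult_right_mono)
    thus ?thesis using z by (simp add: algebra_simps)
  qed simp
qed

lemma flux_above_chord:
  assumes "0 \<le> l" "l < u" "u < r" "r \<le> R"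
  shows "(f r - f l) / (r - l) * (u - l) < f u - f l"
proof -
  obtain y where y: "l < y" "y < u" "f u - f l = speed y * (u - l)"
    using flux_mvt[of l u] assms by auto
  obtain z where z: "u < z" "z < r" "f r - f u = speed z * (r - u)"
    using flux_mvt[of u r] assms by auto
  have "speed z < speed y" using speed_strict_decreasing[of y z] y z assms by auto
  hence less: "speed z * ((r - u) * (u - l)) < speed y * ((r - u) * (u - l))" using assms by simp
  have "(f r - f l) * (u - l) < (f u - f l) * (r - l)"
  proof -
    have "(f r - f l) * (u - l) = speed z * ((r - u) * (u - l)) + (f u - f l) * (u - l)"
    proof -
      have "f r - f l = speed z * (r - u) + (f u - f l)" using z(3) by simp
      thus ?thesis by (simp only: distrib_right mult.assoc)
    qed
    moreover have "(f u - f l) * (r - l) = speed y * ((r - u) * (u - l)) + (f u - f l) * (u - l)"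
      unfolding y(3) by (simp add: algebra_simps)
    ultimately show ?thesis using less by linarith
  qed
  thus ?thesis using assms by (simp add: divide_simps)
qed

lemma flux_strictly_quasiconcave:
  assumes "0 \<le> l" "l < u" "u < r" "r \<le> R"
  shows "min (f l) (f r) < f u"
proof (cases "f l \<le> f r")
  case True
  have "0 \<le> (f r - f l) / (r - l) * (u - l)" using True assms by simp
  thus ?thesis using flux_above_chord[OF assms] by simp
next
  case False
  have "(f r - f l) / (r - l) * (u - l) = (f r - f l) * ((u - l) / (r - l))" by simp
  also have "\<dots> \<ge> (f r - f l) * 1"
    using False assms by (intro mult_left_mono_neg) (auto simp: divide_simps)
  finally show ?thesis using flux_above_chord[OF assms] by simp
qed

abbreviation peak :: real where "peak \<equiv> density_max f R"

lemma peak: "peak \<in> {0..R}" "u \<in> {0..R} \<Longrightarrow> f u \<le> f peak"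
proof -
  have "\<exists>x\<in>{0..R}. \<forall>y\<in>{0..R}. f y \<le> f x"
    using continuous_attains_sup[of "{0..R}" f] continuous_flux R_pos by auto
  then obtain x where "x\<in>{0..R}" "\<forall>y\<in>{0..R}. f y \<le> f x" by blast
  hence "is_arg_max f (\<lambda>x. x \<in> {0..R}) x"
    unfolding is_arg_max_linorder by blast
  hence "is_arg_max f (\<lambda>x. x \<in> {0..R}) (SOME x. is_arg_max f (\<lambda>x. x \<in> {0..R}) x)"
    by (rule someI)
  hence "is_arg_max f (\<lambda>x. x \<in> {0..R}) peak"
    unfolding density_max_def arg_max_on_def arg_max_def .
  thus "peak \<in> {0..R}" "u \<in> {0..R} \<Longrightarrow> f u \<le> f peak"
    unfolding is_arg_max_linorder by blast+
qed

lemma flux_max_eq: "flux_max f R = f peak"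
  unfolding flux_max_def by (rule cSup_eq_maximum[OF imageI[OF peak(1)]]) (metis peak(2) imageE)

lemma flux_less_peak:
  assumes "u \<in> {0..R}" "u \<noteq> peak" shows "f u < f peak"
proof (rule ccontr)
  assume "\<not> ?thesis"
  hence eq: "f u = f peak" using peak(2)[of u] assms by auto
  have "min (f (min u peak)) (f (max u peak)) < f ((u + peak) / 2)"
    using assms peak(1) by (intro flux_strictly_quasiconcave) auto
  moreover have "f ((u + peak) / 2) \<le> f peak" using assms peak(1) by (intro peak(2)) auto
  ultimately show False using eq by (auto simp: min_def max_def split: if_splits)
qed

lemma flux_increasing: "0 \<le> x \<Longrightarrow> x < y \<Longrightarrow> y \<le> peak \<Longrightarrow> f x < f y"
  using flux_strictly_quasiconcave[of x y peak] flux_less_peak[of x] peak(1)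
  by (cases "y = peak") auto

lemma flux_decreasing: "peak \<le> x \<Longrightarrow> x < y \<Longrightarrow> y \<le> R \<Longrightarrow> f y < f x"
  using flux_strictly_quasiconcave[of peak x y] flux_less_peak[of y] peak(1)
  by (cases "x = peak") auto

lemma flux_nonneg: "u \<in> {0..R} \<Longrightarrow> 0 \<le> f u"
  using flux_strictly_quasiconcave[of 0 u R] flux_zero by (cases "u = 0 \<or> u = R") auto

lemma flux_lipschitz:
  obtains \<Lambda> where "0 < \<Lambda>" "\<And>u v. u \<in> {0..R} \<Longrightarrow> v \<in> {0..R} \<Longrightarrow> \<bar>f u - f v\<bar> \<le> \<Lambda> * \<bar>u - v\<bar>"
proof -
  let ?L = "\<bar>speed 0\<bar> + \<bar>speed R\<bar> + 1"
  have *: "\<bar>f v - f u\<bar> \<le> ?L * \<bar>v - u\<bar>" if uv: "0 \<le> u" "u < v" "v \<le> R" for u v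
  proof -
    obtain z where z: "u < z" "z < v" "f v - f u = speed z * (v - u)"
      using flux_mvt[OF uv] by blast
    have "speed R \<le> speed z" "speed z \<le> speed 0"
      using speed_strict_decreasing[of z R] speed_strict_decreasing[of 0 z] z uv by auto
    hence "\<bar>speed z\<bar> \<le> ?L" by linarith
    thus ?thesis unfolding z(3) by (simp add: abs_mult mult_right_mono)
  qed
  show thesis
  proof (rule that)
    show "0 < ?L" by linarith
    fix u v assume uv: "u \<in> {0..R}" "v \<in> {0..R}"
    consider "u = v" | "u < v" | "v < u" by linarith
    thus "\<bar>f u - f v\<bar> \<le> ?L * \<bar>u - v\<bar>"
      by cases (use *[of u v] *[of v u] uv in \<open>auto simp: abs_minus_commute\<close>)
  qed
qed

lemma omega_in_eq: "omega_in f R r = f (min r peak)"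
  by (auto simp: omega_in_def flux_max_eq min_def)

lemma omega_in_mono: "0 \<le> x \<Longrightarrow> x \<le> y \<Longrightarrow> omega_in f R x \<le> omega_in f R y"
  unfolding omega_in_eq using flux_increasing[of "min x peak" "min y peak"] peak(1)
  by (cases "min x peak < min y peak") (auto simp: min_def split: if_splits)

lemma omega_in_bounds:
  "u \<in> {0..R} \<Longrightarrow> 0 \<le> omega_in f R u" "u \<in> {0..R} \<Longrightarrow> omega_in f R u \<le> flux_max f R"
  "u \<in> {0..R} \<Longrightarrow> f u \<le> omega_in f R u"
  using flux_nonneg[of "min u peak"] peak(1) peak(2)[of "min u peak"] peak(2)[of u]
  by (auto simp: omega_in_eq flux_max_eq min_def)

end

section \<open>Cutoff functions and weights\<close>

text \<open>A primitive of a continuous hinge: the simplest nonnegative function that is continuously differentiable and vanishes exactly on a half-line.\<close>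

definition sqpos :: "real \<Rightarrow> real" where "sqpos y = (max 0 y)\<^sup>2"

lemma sqpos_has_derivative: "(sqpos has_real_derivative 2 * max 0 y) (at y)"
proof -
  consider "y < 0" | "y = 0" | "0 < y" by linarith
  thus ?thesis
  proof cases
    case 1
    have "((\<lambda>_. 0) has_real_derivative 2 * max 0 y) (at y)" using 1 by simp
    thus ?thesis
      by (rule has_field_derivative_transform_within_open[of _ _ _ "{..<0}"])
        (use 1 in \<open>auto simp: sqpos_def\<close>)
  next
    case 3
    have "((\<lambda>y. y\<^sup>2) has_real_derivative 2 * max 0 y) (at y)"
      using 3 by (auto intro!: derivative_eq_intros)
    thus ?thesis
      by (rule has_field_derivative_transform_within_open[of _ _ _ "{0<..}"])
        (use 3 in \<open>auto simp: sqpos_def\<close>)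
  next
    case 2
    have "((\<lambda>h. (sqpos h - sqpos 0) / (h - 0)) \<longlongrightarrow> 0) (at 0)"
    proof (rule Lim_null_comparison)
      show "\<forall>\<^sub>F h in at 0. norm ((sqpos h - sqpos 0) / (h - 0)) \<le> \<bar>h\<bar>"
        by (auto simp: sqpos_def max_def power2_eq_square)
      show "((\<lambda>h. \<bar>h\<bar>) \<longlongrightarrow> (0::real)) (at 0)" by (rule tendsto_rabs_zero) auto
    qed
    thus ?thesis using 2 by (simp add: has_field_derivative_iff)
  qed
qed

text \<open>A transition from 0 to 1 over the unit interval. Its derivative is positive there, so that integrals against the derivative detect a nonzero integrand.\<close>

definition step :: "real \<Rightarrow> real" where
  "step y = sqpos y / (sqpos y + sqpos (1 - y))"

definition step_deriv :: "real \<Rightarrow> real" where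
  "step_deriv y = 2 * (max 0 y * sqpos (1 - y) + sqpos y * max 0 (1 - y)) / (sqpos y + sqpos (1 - y))\<^sup>2"

lemma sqpos_sum_pos: "0 < sqpos y + sqpos (1 - y)"
  by (cases "0 < y") (auto simp: sqpos_def add_pos_nonneg add_nonneg_pos)

lemma step_has_derivative: "(step has_real_derivative step_deriv y) (at y)"
  unfolding step_def step_deriv_def using sqpos_sum_pos[of y]
  by (auto intro!: derivative_eq_intros DERIV_chain2[OF sqpos_has_derivative]
        simp: power2_eq_square algebra_simps divide_simps)

lemma continuous_sqpos [continuous_intros]:
  "continuous_on A g \<Longrightarrow> continuous_on A (\<lambda>x. sqpos (g x))"
  unfolding sqpos_def by (intro continuous_intros)

lemma continuous_step_deriv [continuous_intros]:
  "continuous_on A g \<Longrightarrow> continuous_on A (\<lambda>x. step_deriv (g x))"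
proof -
  have "sqpos (g x) + sqpos (1 - g x) \<noteq> 0" for x using sqpos_sum_pos[of "g x"] by linarith
  thus "continuous_on A g \<Longrightarrow> continuous_on A (\<lambda>x. step_deriv (g x))"
    unfolding step_deriv_def by (intro continuous_intros) auto
qed

lemma continuous_step [continuous_intros]:
  "continuous_on A g \<Longrightarrow> continuous_on A (\<lambda>x. step (g x))"
proof -
  have "sqpos (g x) + sqpos (1 - g x) \<noteq> 0" for x using sqpos_sum_pos[of "g x"] by linarith
  thus "continuous_on A g \<Longrightarrow> continuous_on A (\<lambda>x. step (g x))"
    unfolding step_def by (intro continuous_intros) auto
qed

lemma step_low [simp]: "y \<le> 0 \<Longrightarrow> step y = 0"
  and step_high [simp]: "1 \<le> y \<Longrightarrow> step y = 1"
  and step_deriv_low [simp]: "y \<le> 0 \<Longrightarrow> step_deriv y = 0"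
  and step_deriv_high [simp]: "1 \<le> y \<Longrightarrow> step_deriv y = 0"
  by (auto simp: step_def step_deriv_def sqpos_def)

lemma step_deriv_pos: "0 < y \<Longrightarrow> y < 1 \<Longrightarrow> 0 < step_deriv y"
  unfolding step_deriv_def using sqpos_sum_pos[of y]
  by (intro divide_pos_pos mult_pos_pos add_pos_pos) (auto simp: sqpos_def)

lemma step_deriv_nonneg [simp]: "0 \<le> step_deriv y"
  using step_deriv_pos[of y] by (cases "y \<le> 0 \<or> 1 \<le> y") auto

lemma step_bounds [simp]: "0 \<le> step y" "step y \<le> 1"
  using sqpos_sum_pos[of y] by (auto simp: step_def divide_simps) (auto simp: sqpos_def)

lemma step_pos: "0 < y \<Longrightarrow> 0 < step y"
  unfolding step_def using sqpos_sum_pos[of y] by (intro divide_pos_pos) (auto simp: sqpos_def)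

lemma borel_step [measurable]: "step \<in> borel_measurable borel" "step_deriv \<in> borel_measurable borel"
  by (auto intro!: borel_measurable_continuous_onI continuous_intros)

lemma step_deriv_bounded: obtains C where "0 < C" "\<And>y. step_deriv y \<le> C"
proof -
  have "\<exists>x\<in>{0..1}. \<forall>y\<in>{0..1}. step_deriv y \<le> step_deriv x"
    by (rule continuous_attains_sup) (auto intro!: continuous_intros)
  then obtain x where "\<forall>y\<in>{0..1}. step_deriv y \<le> step_deriv x" by blast
  hence "step_deriv y \<le> step_deriv x + 1" for y
    by (cases "y \<le> 0 \<or> 1 \<le> y") (auto simp: add_nonneg_pos intro: order_trans[of _ "step_deriv x"])
  moreover have "0 < step_deriv x + 1" by (simp add: add_nonneg_pos)
  ultimately show thesis using that by blast
qed

text \<open>The factors of test functions: as smooth as these, but without compact support, so that a test function can be built as a product of transitions across lines.\<close>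

definition c1_weight ::
  "(real \<times> real \<Rightarrow> real) \<Rightarrow> (real \<times> real \<Rightarrow> real) \<Rightarrow> (real \<times> real \<Rightarrow> real) \<Rightarrow> bool" where
  "c1_weight w wt wx \<longleftrightarrow>
     (\<forall>p. (w has_derivative (\<lambda>h. wt p * fst h + wx p * snd h)) (at p)) \<and>
     continuous_on UNIV wt \<and> continuous_on UNIV wx \<and> (\<forall>p. 0 \<le> w p)"

lemma test_function_iff:
  "test_function D \<phi> \<phi>t \<phi>x \<longleftrightarrow> c1_weight \<phi> \<phi>t \<phi>x \<and>
     (\<exists>K. compact K \<and> K \<subseteq> {0<..} \<times> D \<and> (\<forall>p. p \<notin> K \<longrightarrow> \<phi> p = 0))"
  unfolding test_function_def c1_weight_def by auto

lemma c1_weight_mult: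
  assumes "c1_weight v vt vx" "c1_weight w wt wx"
  shows "c1_weight (\<lambda>p. v p * w p) (\<lambda>p. vt p * w p + v p * wt p) (\<lambda>p. vx p * w p + v p * wx p)"
proof -
  have v: "(v has_derivative (\<lambda>h. vt p * fst h + vx p * snd h)) (at p)"
    and w: "(w has_derivative (\<lambda>h. wt p * fst h + wx p * snd h)) (at p)" for p
    using assms unfolding c1_weight_def by blast+
  have cont: "continuous_on UNIV v" "continuous_on UNIV w"
    using v w by (meson continuous_at_imp_continuous_on has_derivative_continuous)+
  have "((\<lambda>p. v p * w p) has_derivative
      (\<lambda>h. (vt p * w p + v p * wt p) * fst h + (vx p * w p + v p * wx p) * snd h)) (at p)" for p
    by (rule has_derivative_eq_rhs[OF has_derivative_mult[OF v w]]) (auto simp: algebra_simps)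
  thus ?thesis
    using assms cont unfolding c1_weight_def by (auto intro!: continuous_intros)
qed

lemma c1_weight_affine:
  assumes "\<And>y. (S has_real_derivative S' y) (at y)" "continuous_on UNIV S'" "\<And>y. 0 \<le> S y"
  shows "c1_weight (\<lambda>p. S (\<alpha> * fst p + \<beta> * snd p + \<gamma>))
    (\<lambda>p. \<alpha> * S' (\<alpha> * fst p + \<beta> * snd p + \<gamma>)) (\<lambda>p. \<beta> * S' (\<alpha> * fst p + \<beta> * snd p + \<gamma>))"
proof -
  have "((\<lambda>p. S (\<alpha> * fst p + \<beta> * snd p + \<gamma>)) has_derivative
      (\<lambda>h. \<alpha> * S' (\<alpha> * fst p + \<beta> * snd p + \<gamma>) * fst h + \<beta> * S' (\<alpha> * fst p + \<beta> * snd p + \<gamma>) * snd h)) (at p)"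
    for p :: "real \<times> real"
  proof -
    have 1: "((\<lambda>p. \<alpha> * fst p + \<beta> * snd p + \<gamma>) has_derivative (\<lambda>h. \<alpha> * fst h + \<beta> * snd h)) (at p)"
      by (auto intro!: derivative_eq_intros)
    have 2: "(S has_derivative (*) (S' (\<alpha> * fst p + \<beta> * snd p + \<gamma>))) (at (\<alpha> * fst p + \<beta> * snd p + \<gamma>))"
      using assms(1) by (simp add: has_field_derivative_def)
    show ?thesis
      by (rule has_derivative_eq_rhs[OF has_derivative_compose[OF 1 2]]) (auto simp: algebra_simps)
  qed
  moreover have "continuous_on UNIV (\<lambda>p::real \<times> real. S' (\<alpha> * fst p + \<beta> * snd p + \<gamma>))"
    by (rule continuous_on_compose2[OF assms(2)]) (auto intro!: continuous_intros)
  ultimately show ?thesis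
    using assms(3) unfolding c1_weight_def by (auto intro!: continuous_intros)
qed

lemma c1_weight_step:
  "c1_weight (\<lambda>p. step (\<alpha> * fst p + \<beta> * snd p + \<gamma>))
    (\<lambda>p. \<alpha> * step_deriv (\<alpha> * fst p + \<beta> * snd p + \<gamma>)) (\<lambda>p. \<beta> * step_deriv (\<alpha> * fst p + \<beta> * snd p + \<gamma>))"
  by (intro c1_weight_affine step_has_derivative) (auto intro!: continuous_intros)

lemma c1_weight_step_down:
  "c1_weight (\<lambda>p. 1 - step (\<alpha> * fst p + \<beta> * snd p + \<gamma>))
    (\<lambda>p. \<alpha> * - step_deriv (\<alpha> * fst p + \<beta> * snd p + \<gamma>)) (\<lambda>p. \<beta> * - step_deriv (\<alpha> * fst p + \<beta> * snd p + \<gamma>))"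
proof (rule c1_weight_affine)
  show "((\<lambda>y. 1 - step y) has_real_derivative - step_deriv y) (at y)" for y
    using DERIV_diff[OF DERIV_const step_has_derivative[of y], of 1] by simp
qed (auto intro!: continuous_intros)

lemma c1_weight_continuous:
  assumes "c1_weight w wt wx"
  shows "continuous_on UNIV w" "continuous_on UNIV wt" "continuous_on UNIV wx"
  using assms unfolding c1_weight_def
  by (meson continuous_at_imp_continuous_on has_derivative_continuous)+

lemma test_function_mult:
  assumes "test_function D \<phi> \<phi>t \<phi>x" "c1_weight w wt wx"
  shows "test_function D (\<lambda>p. \<phi> p * w p) (\<lambda>p. \<phi>t p * w p + \<phi> p * wt p) (\<lambda>p. \<phi>x p * w p + \<phi> p * wx p)"
  using assms unfolding test_function_iff by (force intro: c1_weight_mult)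

lemma test_function_support:
  assumes "test_function D \<phi> \<phi>t \<phi>x"
  obtains K where "compact K" "K \<subseteq> {0<..} \<times> D"
    "\<And>p. p \<notin> K \<Longrightarrow> \<phi> p = 0" "\<And>p. p \<notin> K \<Longrightarrow> \<phi>t p = 0" "\<And>p. p \<notin> K \<Longrightarrow> \<phi>x p = 0"
proof -
  obtain K where K: "compact K" "K \<subseteq> {0<..} \<times> D" "\<And>p. p \<notin> K \<Longrightarrow> \<phi> p = 0"
    using assms unfolding test_function_def by blast
  have "\<phi>t p = 0 \<and> \<phi>x p = 0" if p: "p \<notin> K" for p
  proof -
    have "((\<lambda>_. 0) has_derivative (\<lambda>h. \<phi>t p * fst h + \<phi>x p * snd h)) (at p)"
    proof (rule has_derivative_transform_within_open)
      show "(\<phi> has_derivative (\<lambda>h. \<phi>t p * fst h + \<phi>x p * snd h)) (at p)"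
        using assms unfolding test_function_def by blast
      show "open (- K)" using K(1) by (simp add: compact_imp_closed open_Compl)
    qed (use p K(3) in auto)
    hence "(\<lambda>h. \<phi>t p * fst h + \<phi>x p * snd h) = (\<lambda>h. 0)"
      by (rule has_derivative_unique) simp
    from fun_cong[OF this, of "(1,0)"] fun_cong[OF this, of "(0,1)"] show ?thesis by simp
  qed
  thus thesis using that K by blast
qed

lemma test_function_continuous:
  assumes "test_function D \<phi> \<phi>t \<phi>x"
  shows "continuous_on UNIV \<phi>" "continuous_on UNIV \<phi>t" "continuous_on UNIV \<phi>x"
  using assms c1_weight_continuous unfolding test_function_iff by blast+

section \<open>Bounded Borel functions and their integrals\<close>

definition bounded_borel :: "('a::euclidean_space \<Rightarrow> real) \<Rightarrow> bool" where
  "bounded_borel B \<longleftrightarrow> B \<in> borel_measurable borel \<and> (\<exists>C. \<forall>p. \<bar>B p\<bar> \<le> C)"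

definition compactly_supported :: "('a::euclidean_space \<Rightarrow> real) \<Rightarrow> bool" where
  "compactly_supported g \<longleftrightarrow> continuous_on UNIV g \<and> (\<exists>K. compact K \<and> (\<forall>p. p \<notin> K \<longrightarrow> g p = 0))"

lemma compactly_supported_bounded_borel: "compactly_supported g \<Longrightarrow> bounded_borel g"
proof -
  assume g: "compactly_supported g"
  then obtain K where K: "compact K" "\<forall>p. p \<notin> K \<longrightarrow> g p = 0" "continuous_on UNIV g"
    unfolding compactly_supported_def by blast
  have "bounded (g ` K)"
    using K by (intro compact_imp_bounded compact_continuous_image) (auto intro: continuous_on_subset)
  then obtain C where C: "\<And>p. p \<in> K \<Longrightarrow> \<bar>g p\<bar> \<le> C" unfolding bounded_iff by auto
  have "\<bar>g p\<bar> \<le> max 0 C" for p using C[of p] K(2) by (cases "p \<in> K") auto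
  thus "bounded_borel g" unfolding bounded_borel_def
    using K(3) by (auto simp: borel_measurable_continuous_onI)
qed

lemma integrable_bounded_compact:
  assumes "bounded_borel B" "compactly_supported g"
  shows "integrable lborel (\<lambda>p. B p * g p)"
proof -
  obtain K where K: "compact K" "\<forall>p. p \<notin> K \<longrightarrow> g p = 0" "continuous_on UNIV g"
    using assms unfolding compactly_supported_def by blast
  obtain C where C: "\<forall>p. \<bar>B p\<bar> \<le> C" and [measurable]: "B \<in> borel_measurable borel"
    using assms unfolding bounded_borel_def by blast
  have [measurable]: "g \<in> borel_measurable borel" using K by (simp add: borel_measurable_continuous_onI)
  have "integrable lborel (\<lambda>x. indicator K x *\<^sub>R g x)"
    using K by (intro borel_integrable_compact) (auto intro: continuous_on_subset)
  hence "integrable lborel g"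
    by (rule back_subst[of "integrable lborel"]) (use K(2) in \<open>auto simp: fun_eq_iff indicator_def\<close>)
  hence "integrable lborel (\<lambda>x. C * g x)" by simp
  thus ?thesis
  proof (rule Bochner_Integration.integrable_bound)
    show "AE x in lborel. norm (B x * g x) \<le> norm (C * g x)"
    proof (rule AE_I2)
      fix x
      have "\<bar>B x\<bar> \<le> \<bar>C\<bar>" using C by (meson abs_ge_self order_trans)
      thus "norm (B x * g x) \<le> norm (C * g x)" by (simp add: abs_mult mult_right_mono)
    qed
  qed auto
qed

lemma bounded_borel_const [intro!, simp]: "bounded_borel (\<lambda>_. c)"
  unfolding bounded_borel_def by auto

lemma bounded_borel_add [intro]:
  assumes "bounded_borel A" "bounded_borel B" shows "bounded_borel (\<lambda>p. A p + B p)"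
proof -
  obtain C D where "\<forall>p. \<bar>A p\<bar> \<le> C" "\<forall>p. \<bar>B p\<bar> \<le> D" using assms unfolding bounded_borel_def by blast
  hence "\<bar>A p + B p\<bar> \<le> C + D" for p by (meson abs_triangle_ineq add_mono order_trans)
  thus ?thesis using assms unfolding bounded_borel_def by auto
qed

lemma bounded_borel_mult [intro]:
  assumes "bounded_borel A" "bounded_borel B" shows "bounded_borel (\<lambda>p. A p * B p)"
proof -
  obtain C D where "\<forall>p. \<bar>A p\<bar> \<le> C" "\<forall>p. \<bar>B p\<bar> \<le> D" using assms unfolding bounded_borel_def by blast
  hence "\<bar>A p * B p\<bar> \<le> C * D" for p
    unfolding abs_mult by (intro mult_mono) (auto intro: order_trans[OF abs_ge_zero])
  thus ?thesis using assms unfolding bounded_borel_def by auto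
qed

lemma bounded_borel_indicator [intro]: "A \<in> sets borel \<Longrightarrow> bounded_borel (indicator A)"
  unfolding bounded_borel_def by (auto intro!: exI[of _ 1] split: split_indicator)

lemma bounded_borel_compose:
  fixes u :: "'a::euclidean_space \<Rightarrow> real"
  assumes "continuous_on {a..b} h" "u \<in> borel_measurable borel" "\<And>p. u p \<in> {a..b}"
  shows "bounded_borel (\<lambda>p. h (u p))"
proof -
  have "a \<le> b" using assms(3)[of undefined] by (auto intro: order_trans)
  have 1: "continuous_on UNIV (\<lambda>x. h (max a (min b x)))"
    by (rule continuous_on_compose2[OF assms(1)]) (use \<open>a \<le> b\<close> in \<open>auto intro!: continuous_intros\<close>)
  have "(\<lambda>p. h (max a (min b (u p)))) \<in> borel_measurable borel"
    using borel_measurable_continuous_onI[OF 1] assms(2) by simp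
  hence "(\<lambda>p. h (u p)) \<in> borel_measurable borel"
    by (rule back_subst[of "\<lambda>g. g \<in> borel_measurable borel"]) (use assms(3) in \<open>simp add: fun_eq_iff min_absorb2 max_absorb2\<close>)
  moreover have "bounded (h ` {a..b})"
    by (intro compact_imp_bounded compact_continuous_image assms) auto
  ultimately show ?thesis using assms(3) unfolding bounded_borel_def bounded_iff by fastforce
qed

lemma test_function_compactly_supported:
  assumes "test_function D \<phi> \<phi>t \<phi>x"
  shows "compactly_supported \<phi>" "compactly_supported \<phi>t" "compactly_supported \<phi>x"
    "compactly_supported (\<lambda>t. \<phi> (t, a))" "compactly_supported (\<lambda>t. \<phi>t (t, a))"
    "compactly_supported (\<lambda>x. \<phi> (b, x))" "compactly_supported (\<lambda>x. \<phi>x (b, x))"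
proof -
  obtain K where K: "compact K" "\<And>p. p \<notin> K \<Longrightarrow> \<phi> p = 0" "\<And>p. p \<notin> K \<Longrightarrow> \<phi>t p = 0" "\<And>p. p \<notin> K \<Longrightarrow> \<phi>x p = 0"
    using test_function_support[OF assms] by metis
  note c = test_function_continuous[OF assms]
  have k: "compact (fst ` K)" "compact (snd ` K)"
    using K(1) by (auto intro!: compact_continuous_image continuous_intros)
  have n: "t \<notin> fst ` K \<Longrightarrow> (t, a) \<notin> K" "x \<notin> snd ` K \<Longrightarrow> (b, x) \<notin> K" for t x by force+
  have c': "continuous_on UNIV g \<Longrightarrow> continuous_on UNIV (\<lambda>t. g (t, a))"
    "continuous_on UNIV g \<Longrightarrow> continuous_on UNIV (\<lambda>x. g (b, x))" for g :: "real \<times> real \<Rightarrow> real"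
    by (auto elim!: continuous_on_compose2 intro!: continuous_intros)
  show "compactly_supported \<phi>" "compactly_supported \<phi>t" "compactly_supported \<phi>x"
    unfolding compactly_supported_def using K c by blast+
  show "compactly_supported (\<lambda>t. \<phi> (t, a))"
    unfolding compactly_supported_def using c'(1)[OF c(1)] k(1) n(1) K(2) by blast
  show "compactly_supported (\<lambda>t. \<phi>t (t, a))"
    unfolding compactly_supported_def using c'(1)[OF c(2)] k(1) n(1) K(3) by blast
  show "compactly_supported (\<lambda>x. \<phi> (b, x))"
    unfolding compactly_supported_def using c'(2)[OF c(1)] k(2) n(2) K(2) by blast
  show "compactly_supported (\<lambda>x. \<phi>x (b, x))"
    unfolding compactly_supported_def using c'(2)[OF c(3)] k(2) n(2) K(4) by blast
qed

lemma measurable_fst_snd_plane [measurable]: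
  "(\<lambda>p::real \<times> real. fst p) \<in> borel_measurable borel" "(\<lambda>p::real \<times> real. snd p) \<in> borel_measurable borel"
  by (auto intro!: borel_measurable_continuous_onI continuous_intros)

text \<open>Steeper and steeper transitions converge to a sharp cutoff. The limit at the jump itself depends on the shift being nonnegative.\<close>

lemma step_scaled_limit:
  assumes "0 \<le> a"
  shows "(\<lambda>n. step (real (Suc n) * y - a)) \<longlonglongrightarrow> (if 0 < y then 1 else 0)"
proof (cases "0 < y")
  case True
  obtain n0 where n0: "1 + a < real n0 * y" using ex_less_of_nat_mult[OF True] by blast
  have "step (real (Suc n) * y - a) = 1" if "n0 \<le> n" for n
  proof -
    have "real n0 * y \<le> real (Suc n) * y" using that True by (intro mult_right_mono) auto
    thus ?thesis using n0 by (intro step_high) linarith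
  qed
  hence "\<forall>\<^sub>F n in sequentially. step (real (Suc n) * y - a) = 1" by (rule eventually_sequentiallyI)
  thus ?thesis using True by (simp add: tendsto_eventually)
next
  case False
  have "real (Suc n) * y - a \<le> 0" for n
    using False assms mult_nonneg_nonpos[of "real (Suc n)" y] by simp
  thus ?thesis using False by simp
qed

lemma integrable_bounded_support:
  fixes F :: "'a::euclidean_space \<Rightarrow> real"
  assumes [measurable]: "F \<in> borel_measurable borel" and "\<And>p. \<bar>F p\<bar> \<le> C" "bounded S" "\<And>p. p \<notin> S \<Longrightarrow> F p = 0"
  shows "integrable lborel F"
proof -
  obtain r where r: "S \<subseteq> cball 0 r" using assms(3) unfolding bounded_iff by (auto simp: subset_iff)
  have "integrable lborel (\<lambda>p. indicator (cball 0 r) p *\<^sub>R C :: real)"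
    by (intro borel_integrable_compact) auto
  thus ?thesis
  proof (rule Bochner_Integration.integrable_bound)
    show "AE p in lborel. norm (F p) \<le> norm (indicator (cball 0 r) p *\<^sub>R C)"
    proof (rule AE_I2)
      fix p
      have "\<bar>F p\<bar> \<le> \<bar>C\<bar>" using assms(2)[of p] by linarith
      thus "norm (F p) \<le> norm (indicator (cball 0 r) p *\<^sub>R C)"
        using r assms(4)[of p] by (cases "p \<in> S") (auto simp: indicator_def)
    qed
  qed auto
qed

text \<open>Sharpening a smooth blend of two integrable functions; used both for gluing entropies along a line and for cutting off at the boundary.\<close>

lemma blend_limit:
  fixes Y Z :: "'a::euclidean_space \<Rightarrow> real"
  assumes Y: "integrable lborel Y" and Z: "integrable lborel Z"
    and wm: "\<And>n. w n \<in> borel_measurable borel" and w: "\<And>n p. 0 \<le> w n p" "\<And>n p. w n p \<le> 1"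
    and lim: "AE p in lborel. (\<lambda>n. w n p) \<longlonglongrightarrow> (if P p then 0 else 1)" and P: "Measurable.pred borel P"
  shows "(\<lambda>n. LINT p|lborel. (1 - w n p) * Y p + w n p * Z p) \<longlonglongrightarrow> (LINT p|lborel. (if P p then Y p else Z p))"
proof (rule integral_dominated_convergence[where w = "\<lambda>p. \<bar>Y p\<bar> + \<bar>Z p\<bar>"])
  note [measurable] = borel_measurable_integrable[OF Y] borel_measurable_integrable[OF Z] wm P
  have [measurable]: "w n \<in> borel_measurable lborel" "Measurable.pred lborel P" for n using wm P by auto
  show "(\<lambda>p. if P p then Y p else Z p) \<in> borel_measurable lborel"
    "(\<lambda>p. (1 - w n p) * Y p + w n p * Z p) \<in> borel_measurable lborel" for n by measurable
  show "integrable lborel (\<lambda>p. \<bar>Y p\<bar> + \<bar>Z p\<bar>)" using Y Z by simp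
  show "AE p in lborel. norm ((1 - w n p) * Y p + w n p * Z p) \<le> \<bar>Y p\<bar> + \<bar>Z p\<bar>" for n
  proof (rule AE_I2)
    fix p
    have "\<bar>(1 - w n p) * Y p\<bar> \<le> \<bar>Y p\<bar>" "\<bar>w n p * Z p\<bar> \<le> \<bar>Z p\<bar>"
      using w[of n p] by (auto simp: abs_mult intro!: mult_left_le_one_le)
    thus "norm ((1 - w n p) * Y p + w n p * Z p) \<le> \<bar>Y p\<bar> + \<bar>Z p\<bar>" by simp
  qed
  show "AE p in lborel. (\<lambda>n. (1 - w n p) * Y p + w n p * Z p) \<longlonglongrightarrow> (if P p then Y p else Z p)"
    using lim
  proof eventually_elim
    fix p assume "(\<lambda>n. w n p) \<longlonglongrightarrow> (if P p then 0 else 1)"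
    hence "(\<lambda>n. (1 - w n p) * Y p + w n p * Z p) \<longlonglongrightarrow>
      (1 - (if P p then 0 else 1)) * Y p + (if P p then 0 else 1) * Z p" by (intro tendsto_intros)
    thus "(\<lambda>n. (1 - w n p) * Y p + w n p * Z p) \<longlonglongrightarrow> (if P p then Y p else Z p)" by (cases "P p") simp_all
  qed
qed

lemma bounded_borelE:
  assumes "bounded_borel B" obtains C where "0 < C" "\<And>p. \<bar>B p\<bar> \<le> C" "B \<in> borel_measurable borel"
proof -
  obtain C where "\<forall>p. \<bar>B p\<bar> \<le> C" using assms unfolding bounded_borel_def by blast
  hence "\<bar>B p\<bar> \<le> \<bar>C\<bar> + 1" for p by (metis abs_ge_self add_increasing2 order_trans zero_le_one)
  moreover have "0 < \<bar>C\<bar> + 1" by linarith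
  ultimately show thesis using that assms unfolding bounded_borel_def by blast
qed

lemma bounded_borel_slice:
  fixes B :: "real \<times> real \<Rightarrow> real"
  assumes "bounded_borel B"
  shows "bounded_borel (\<lambda>x. B (t, x))" "bounded_borel (\<lambda>t. B (t, x))"
  using assms unfolding bounded_borel_def by (auto intro: borel_measurable_Pair)

lemma set_integrable_bounded:
  fixes B :: "real \<Rightarrow> real"
  assumes "bounded_borel B" "bounded A" "A \<in> sets borel"
  shows "set_integrable lborel A B"
proof -
  obtain C where C: "0 < C" "\<And>p. \<bar>B p\<bar> \<le> C" and [measurable]: "B \<in> borel_measurable borel"
    using bounded_borelE[OF assms(1)] by blast
  have "\<bar>indicator A p * B p\<bar> \<le> C" for p
    using C(1) C(2)[of p] by (auto simp: indicator_def)
  thus ?thesis unfolding set_integrable_def using assms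
    by (intro integrable_bounded_support[of _ C A]) auto
qed

section \<open>Entropy inequalities with a boundary flux\<close>

definition half_plane :: "(real \<times> real) set" where "half_plane = {0<..} \<times> {..<0}"

lemma half_plane_borel [measurable, simp]: "half_plane \<in> sets borel"
  unfolding half_plane_def by (intro borel_open open_Times) auto

text \<open>The weak form of \<open>E\<^sub>t + Q\<^sub>x \<le> 0\<close> on \<open>t > 0\<close>, \<open>x < 0\<close>. The test functions need not vanish at
\<open>x = 0\<close>, and \<open>G\<close> is the flux of \<open>E\<close> out of the half-line there. They do vanish near \<open>t = 0\<close>, so initial values
have to be supplied separately.\<close>

definition balance :: "(real \<times> real \<Rightarrow> real) \<Rightarrow> (real \<times> real \<Rightarrow> real) \<Rightarrow> (real \<Rightarrow> real) \<Rightarrow> bool" where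
  "balance E Q G \<longleftrightarrow> bounded_borel E \<and> bounded_borel Q \<and> bounded_borel G \<and>
     (\<forall>\<phi> \<phi>t \<phi>x. test_function UNIV \<phi> \<phi>t \<phi>x \<longrightarrow>
       (LINT t|lborel. G t * \<phi> (t, 0)) \<le> (LINT p:half_plane|lborel. E p * \<phi>t p + Q p * \<phi>x p))"

lemma set_integrable_half_plane:
  assumes "bounded_borel E" "compactly_supported g" "A \<in> sets borel"
  shows "set_integrable lborel A (\<lambda>p. E p * g p)"
proof -
  have "bounded_borel (\<lambda>p. indicator A p * E p)" using assms by auto
  from integrable_bounded_compact[OF this assms(2)] show ?thesis
    unfolding set_integrable_def by (simp add: mult.assoc)
qed

lemma plane_integral_iterated:
  fixes F :: "real \<times> real \<Rightarrow> real"
  assumes "integrable lborel F"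
  shows "(LINT p|lborel. F p) = (LINT t|lborel. LINT x|lborel. F (t, x))"
    and "(LINT p|lborel. F p) = (LINT x|lborel. LINT t|lborel. F (t, x))"
proof -
  have F: "integrable (lborel \<Otimes>\<^sub>M lborel) F" using assms by (simp add: lborel_prod)
  show "(LINT p|lborel. F p) = (LINT t|lborel. LINT x|lborel. F (t, x))"
    using lborel_pair.integral_fst'[OF F] by (simp add: lborel_prod)
  have F': "integrable (lborel \<Otimes>\<^sub>M lborel) (\<lambda>(t, x). F (t, x))" using F by simp
  show "(LINT p|lborel. F p) = (LINT x|lborel. LINT t|lborel. F (t, x))"
    using lborel_pair.integral_snd[OF F'] by (simp add: lborel_prod)
qed

lemma half_line_FTC:
  fixes g :: "real \<Rightarrow> real"
  assumes "\<And>x. (g has_real_derivative g' x) (at x)" "compactly_supported g" "compactly_supported g'"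
  shows "(LINT x|lborel. indicator {..<0} x * g' x) = g 0" "(LINT x|lborel. g' x) = 0"
proof -
  obtain K L where K: "compact K" "\<And>x. x \<notin> K \<Longrightarrow> g x = 0" and L: "compact L" "\<And>x. x \<notin> L \<Longrightarrow> g' x = 0"
    and c: "continuous_on UNIV g'"
    using assms(2,3) unfolding compactly_supported_def by metis
  have "bounded (K \<union> L)" using K L by (simp add: compact_imp_bounded)
  then obtain B0 where B0: "\<And>x. x \<in> K \<union> L \<Longrightarrow> \<bar>x\<bar> \<le> B0" unfolding bounded_iff by auto
  define B where "B = \<bar>B0\<bar> + 1"
  have z: "g x = 0" "g' x = 0" if "B \<le> \<bar>x\<bar>" for x
    using that B0[of x] K(2)[of x] L(2)[of x] unfolding B_def by force+
  have B: "0 < B" unfolding B_def by simp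
  have z': "g' x = 0" if "\<not> (- B \<le> x \<and> x \<le> B)" for x
    by (rule z(2)) (use that in linarith)
  have i: "isCont g' x" for x using c by (simp add: continuous_on_eq_continuous_at)
  have "(LINT x|lborel. indicator {..<0} x * g' x) = (LINT x|lborel. g' x * indicator {-B..0} x)"
  proof (rule integral_cong_AE)
    have "AE x in lborel. x \<noteq> (0::real)" by (rule AE_lborel_singleton)
    thus "AE x in lborel. indicator {..<0} x * g' x = g' x * indicator {-B..0} x"
      by (rule AE_mp) (intro AE_I2 impI, use z B in \<open>auto simp: indicator_def\<close>)
  qed (use borel_measurable_continuous_onI[OF c] in auto)
  also have "\<dots> = g 0 - g (-B)"
    by (rule integral_FTC_Icc_real) (use B assms(1) i in auto)
  finally show "(LINT x|lborel. indicator {..<0} x * g' x) = g 0" using z[of "-B"] B by simp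
  have "(LINT x|lborel. g' x) = (LINT x|lborel. g' x * indicator {-B..B} x)"
    by (rule Bochner_Integration.integral_cong) (use z' in \<open>auto simp: indicator_def\<close>)
  also have "\<dots> = g B - g (-B)"
    by (rule integral_FTC_Icc_real) (use B assms(1) i in auto)
  finally show "(LINT x|lborel. g' x) = 0" using z[of "-B"] z[of B] B by simp
qed

lemma test_function_partial:
  assumes "test_function D \<phi> \<phi>t \<phi>x"
  shows "((\<lambda>t. \<phi> (t, x)) has_real_derivative \<phi>t (t, x)) (at t)"
    "((\<lambda>x. \<phi> (t, x)) has_real_derivative \<phi>x (t, x)) (at x)"
proof -
  have d: "(\<phi> has_derivative (\<lambda>h. \<phi>t (t,x) * fst h + \<phi>x (t,x) * snd h)) (at (t, x))"
    using assms unfolding test_function_def by blast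
  have 1: "((\<lambda>t. (t, x)) has_derivative (\<lambda>h. (h, 0))) (at t)"
    and 2: "((\<lambda>x. (t, x)) has_derivative (\<lambda>h. (0, h))) (at x)"
    by (auto intro!: derivative_eq_intros)
  show "((\<lambda>t. \<phi> (t, x)) has_real_derivative \<phi>t (t, x)) (at t)"
    "((\<lambda>x. \<phi> (t, x)) has_real_derivative \<phi>x (t, x)) (at x)"
    using has_derivative_compose[OF 1 d] has_derivative_compose[OF 2 d]
    unfolding has_field_derivative_def by (simp_all add: fun_eq_iff mult_commute_abs)
qed

lemma test_function_integrals:
  assumes \<phi>: "test_function UNIV \<phi> \<phi>t \<phi>x"
  shows "(LINT p:half_plane|lborel. \<phi>t p) = 0"
    "(LINT p:half_plane|lborel. \<phi>x p) = (LINT t|lborel. \<phi> (t, 0))"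
    "(LINT p:{0<..} \<times> UNIV|lborel. \<phi>t p) = 0" "(LINT p:{0<..} \<times> UNIV|lborel. \<phi>x p) = 0"
proof -
  note c = test_function_compactly_supported[OF \<phi>]
  obtain K where K: "K \<subseteq> {0<..} \<times> UNIV" "\<And>p. p \<notin> K \<Longrightarrow> \<phi> p = 0"
    "\<And>p. p \<notin> K \<Longrightarrow> \<phi>t p = 0" "\<And>p. p \<notin> K \<Longrightarrow> \<phi>x p = 0"
    using test_function_support[OF \<phi>] by metis
  have z: "\<phi> (t, x) = 0" "\<phi>t (t, x) = 0" "\<phi>x (t, x) = 0" if "t \<le> 0" for t x
    using K(1) K(2,3,4)[of "(t, x)"] that by force+
  have it: "(LINT t|lborel. \<phi>t (t, x)) = 0" for x
    by (rule half_line_FTC(2)[OF test_function_partial(1)[OF \<phi>]]) (rule c)+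
  have ix: "(LINT x|lborel. \<phi>x (t, x)) = 0" "(LINT x|lborel. indicator {..<0} x * \<phi>x (t, x)) = \<phi> (t, 0)" for t
    by (rule half_line_FTC[OF test_function_partial(2)[OF \<phi>]], rule c, rule c)+
  have int: "set_integrable lborel A \<phi>t" "set_integrable lborel A \<phi>x" if "A \<in> sets borel" for A
    using set_integrable_half_plane[OF bounded_borel_const[of 1] c(2) that]
      set_integrable_half_plane[OF bounded_borel_const[of 1] c(3) that] by simp_all
  have [simp]: "{0<..} \<times> UNIV \<in> sets (borel :: (real \<times> real) measure)"
    by (intro borel_open open_Times) auto
  have it1: "indicator half_plane (t, x) * \<phi>t (t, x) = indicator {..<0} x * \<phi>t (t, x)"
    "indicator half_plane (t, x) * \<phi>x (t, x) = indicator {..<0} x * \<phi>x (t, x)"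
    "indicator ({0<..} \<times> UNIV) (t, x) * \<phi>t (t, x) = \<phi>t (t, x)"
    "indicator ({0<..} \<times> UNIV) (t, x) * \<phi>x (t, x) = \<phi>x (t, x)" for t x
    using z[of t x] by (auto simp: half_plane_def indicator_def)
  show "(LINT p:half_plane|lborel. \<phi>t p) = 0"
    using plane_integral_iterated(2)[OF int(1)[unfolded set_integrable_def, of half_plane]] it
    by (simp add: set_lebesgue_integral_def it1)
  show "(LINT p:half_plane|lborel. \<phi>x p) = (LINT t|lborel. \<phi> (t, 0))"
    using plane_integral_iterated(1)[OF int(2)[unfolded set_integrable_def, of half_plane]] ix
    by (simp add: set_lebesgue_integral_def it1)
  show "(LINT p:{0<..} \<times> UNIV|lborel. \<phi>t p) = 0"
    using plane_integral_iterated(2)[OF int(1)[unfolded set_integrable_def, of "{0<..} \<times> UNIV"]] it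
    by (simp add: set_lebesgue_integral_def it1)
  show "(LINT p:{0<..} \<times> UNIV|lborel. \<phi>x p) = 0"
    using plane_integral_iterated(1)[OF int(2)[unfolded set_integrable_def, of "{0<..} \<times> UNIV"]] ix
    by (simp add: set_lebesgue_integral_def it1)
qed

lemma balance_const: "balance (\<lambda>_. a) (\<lambda>_. b) (\<lambda>_. b)"
proof -
  have "(LINT t|lborel. b * \<phi> (t, 0)) \<le> (LINT p:half_plane|lborel. a * \<phi>t p + b * \<phi>x p)"
    if \<phi>: "test_function UNIV \<phi> \<phi>t \<phi>x" for \<phi> \<phi>t \<phi>x
  proof -
    note c = test_function_compactly_supported[OF \<phi>]
    have "(LINT p:half_plane|lborel. a * \<phi>t p + b * \<phi>x p)
        = (LINT p:half_plane|lborel. a * \<phi>t p) + (LINT p:half_plane|lborel. b * \<phi>x p)"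
      by (intro set_integral_add set_integrable_half_plane) (use c in auto)
    also have "\<dots> = b * (LINT t|lborel. \<phi> (t, 0))" using test_function_integrals[OF \<phi>] by simp
    finally show ?thesis by simp
  qed
  thus ?thesis unfolding balance_def by auto
qed

lemma balance_add:
  assumes "balance E Q G" "balance E' Q' G'"
  shows "balance (\<lambda>p. E p + E' p) (\<lambda>p. Q p + Q' p) (\<lambda>t. G t + G' t)"
proof -
  have bb: "bounded_borel E" "bounded_borel Q" "bounded_borel G"
    "bounded_borel E'" "bounded_borel Q'" "bounded_borel G'" using assms unfolding balance_def by auto
  have "(LINT t|lborel. (G t + G' t) * \<phi> (t, 0))
      \<le> (LINT p:half_plane|lborel. (E p + E' p) * \<phi>t p + (Q p + Q' p) * \<phi>x p)"
    if \<phi>: "test_function UNIV \<phi> \<phi>t \<phi>x" for \<phi> \<phi>t \<phi>x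
  proof -
    note c = test_function_compactly_supported[OF \<phi>]
    have "(LINT t|lborel. (G t + G' t) * \<phi> (t, 0))
        = (LINT t|lborel. G t * \<phi> (t, 0)) + (LINT t|lborel. G' t * \<phi> (t, 0))"
      unfolding distrib_right
      by (intro Bochner_Integration.integral_add integrable_bounded_compact bb c)
    also have "\<dots> \<le> (LINT p:half_plane|lborel. E p * \<phi>t p + Q p * \<phi>x p)
        + (LINT p:half_plane|lborel. E' p * \<phi>t p + Q' p * \<phi>x p)"
      using assms \<phi> unfolding balance_def by (intro add_mono) blast+
    also have "\<dots> = (LINT p:half_plane|lborel. (E p * \<phi>t p + Q p * \<phi>x p) + (E' p * \<phi>t p + Q' p * \<phi>x p))"
      by (intro set_integral_add(2)[symmetric] set_integral_add(1) set_integrable_half_plane bb c) auto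
    finally show ?thesis by (simp add: algebra_simps)
  qed
  thus ?thesis using bb unfolding balance_def by auto
qed

lemma balance_scale:
  assumes "balance E Q G" "0 \<le> a"
  shows "balance (\<lambda>p. a * E p) (\<lambda>p. a * Q p) (\<lambda>t. a * G t)"
proof -
  have "(LINT t|lborel. (a * G t) * \<phi> (t, 0)) \<le> (LINT p:half_plane|lborel. (a * E p) * \<phi>t p + (a * Q p) * \<phi>x p)"
    if \<phi>: "test_function UNIV \<phi> \<phi>t \<phi>x" for \<phi> \<phi>t \<phi>x
  proof -
    have "a * (LINT t|lborel. G t * \<phi> (t, 0)) \<le> a * (LINT p:half_plane|lborel. E p * \<phi>t p + Q p * \<phi>x p)"
      using assms \<phi> unfolding balance_def by (intro mult_left_mono) blast+
    thus ?thesis by (simp add: mult.assoc distrib_left[symmetric])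
  qed
  thus ?thesis using assms unfolding balance_def by auto
qed

lemma balance_cong:
  assumes "balance E Q G" "\<And>p. E p = E' p" "\<And>p. Q p = Q' p" "\<And>t. G t = G' t"
  shows "balance E' Q' G'"
proof -
  have "E = E'" "Q = Q'" "G = G'" using assms by auto
  thus ?thesis using assms(1) by simp
qed

lemma balanceD:
  assumes "balance E Q G"
  shows "bounded_borel E" "bounded_borel Q" "bounded_borel G"
    "test_function UNIV \<phi> \<phi>t \<phi>x \<Longrightarrow>
       (LINT t|lborel. G t * \<phi> (t, 0)) \<le> (LINT p:half_plane|lborel. E p * \<phi>t p + Q p * \<phi>x p)"
  using assms unfolding balance_def by auto

section \<open>Gluing along a line\<close>

lemma bounded_borel_if:
  assumes "bounded_borel A" "bounded_borel B" "S \<in> sets borel"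
  shows "bounded_borel (\<lambda>p. if p \<in> S then A p else B p)"
proof -
  have "bounded_borel (\<lambda>p. indicator S p * A p + indicator (-S) p * B p)"
    using assms by (intro bounded_borel_add bounded_borel_mult bounded_borel_indicator) auto
  thus ?thesis by (rule back_subst[of bounded_borel]) (auto simp: fun_eq_iff indicator_def)
qed

text \<open>Test the first inequality with \<open>(1 - w) \<phi>\<close> and the second with \<open>w \<phi>\<close>, where \<open>w\<close> passes from 0 to 1 in a strip of
width \<open>1 / N\<close> along the line of speed \<open>\<sigma>\<close>. The derivatives of \<open>w\<close> contribute the difference of the fluxes
\<open>Q - \<sigma> E\<close> through this line, which has a sign by hypothesis, however large \<open>N\<close> is.\<close>

lemma balance_across_strip:
  assumes b1: "balance E1 Q1 G1" and b2: "balance E2 Q2 G2" and "0 < N"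
    and jump: "\<And>p. p \<in> half_plane \<Longrightarrow> Q2 p - \<sigma> * E2 p \<le> Q1 p - \<sigma> * E1 p"
    and \<phi>: "test_function UNIV \<phi> \<phi>t \<phi>x"
  defines "w \<equiv> \<lambda>p. step ((- N * \<sigma>) * fst p + N * snd p + 0)"
  shows "(LINT t|lborel. (1 - w (t, 0)) * (G1 t * \<phi> (t, 0)) + w (t, 0) * (G2 t * \<phi> (t, 0))) \<le>
    (LINT p:half_plane|lborel. (1 - w p) * (E1 p * \<phi>t p + Q1 p * \<phi>x p) + w p * (E2 p * \<phi>t p + Q2 p * \<phi>x p))"
proof -
  define w' where "w' = (\<lambda>p. step_deriv ((- N * \<sigma>) * fst p + N * snd p + 0))"
  have up: "c1_weight w (\<lambda>p. (- N * \<sigma>) * w' p) (\<lambda>p. N * w' p)"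
    unfolding w_def w'_def by (rule c1_weight_step)
  have down: "c1_weight (\<lambda>p. 1 - w p) (\<lambda>p. (- N * \<sigma>) * - w' p) (\<lambda>p. N * - w' p)"
    unfolding w_def w'_def by (rule c1_weight_step_down)
  note \<phi>1 = test_function_mult[OF \<phi> down] and \<phi>2 = test_function_mult[OF \<phi> up]
  note c1 = test_function_compactly_supported[OF \<phi>1] and c2 = test_function_compactly_supported[OF \<phi>2]
  note bb = balanceD(1,2,3)[OF b1] balanceD(1,2,3)[OF b2]
  have cw: "compactly_supported (\<lambda>p. w p * g p)" "compactly_supported (\<lambda>p. (1 - w p) * g p)"
    if "compactly_supported g" for g
    using that c1_weight_continuous(1)[OF up] unfolding compactly_supported_def by (auto intro!: continuous_intros)
  have int: "set_integrable lborel half_plane (\<lambda>p. v p * (E p * \<phi>t p + Q p * \<phi>x p))"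
    if "v \<in> {w, \<lambda>p. 1 - w p}" "bounded_borel E" "bounded_borel Q" for v E Q
  proof -
    have "set_integrable lborel half_plane (\<lambda>p. E p * (v p * \<phi>t p) + Q p * (v p * \<phi>x p))"
      using that cw test_function_compactly_supported(2,3)[OF \<phi>]
      by (intro set_integral_add(1) set_integrable_half_plane) auto
    thus ?thesis by (simp add: algebra_simps)
  qed
  have nn: "0 \<le> \<phi> p" "0 \<le> w' p" for p
    using \<phi> unfolding test_function_def by blast (simp add: w'_def)
  have "(LINT t|lborel. (1 - w (t, 0)) * (G1 t * \<phi> (t, 0)) + w (t, 0) * (G2 t * \<phi> (t, 0)))
      = (LINT t|lborel. G1 t * (\<phi> (t, 0) * (1 - w (t, 0))) + G2 t * (\<phi> (t, 0) * w (t, 0)))"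
    by (simp add: algebra_simps)
  also have "\<dots> = (LINT t|lborel. G1 t * (\<phi> (t, 0) * (1 - w (t, 0)))) + (LINT t|lborel. G2 t * (\<phi> (t, 0) * w (t, 0)))"
    by (intro Bochner_Integration.integral_add integrable_bounded_compact bb c1 c2)
  also have "\<dots> \<le> (LINT p:half_plane|lborel. E1 p * (\<phi>t p * (1 - w p) + \<phi> p * ((- N * \<sigma>) * - w' p))
        + Q1 p * (\<phi>x p * (1 - w p) + \<phi> p * (N * - w' p)))
      + (LINT p:half_plane|lborel. E2 p * (\<phi>t p * w p + \<phi> p * ((- N * \<sigma>) * w' p))
        + Q2 p * (\<phi>x p * w p + \<phi> p * (N * w' p)))" (is "_ \<le> (LINT p:_|_. ?A p) + (LINT p:_|_. ?B p)")
    by (intro add_mono balanceD(4)[OF b1 \<phi>1] balanceD(4)[OF b2 \<phi>2])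
  also have "\<dots> = (LINT p:half_plane|lborel. ?A p + ?B p)"
    by (intro set_integral_add(2)[symmetric] set_integral_add(1) set_integrable_half_plane bb c1 c2) auto
  also have "\<dots> \<le> (LINT p:half_plane|lborel. (1 - w p) * (E1 p * \<phi>t p + Q1 p * \<phi>x p) + w p * (E2 p * \<phi>t p + Q2 p * \<phi>x p))"
  proof (rule set_integral_mono)
    show "set_integrable lborel half_plane (\<lambda>p. ?A p + ?B p)"
      by (intro set_integral_add(1) set_integrable_half_plane bb c1 c2) auto
    show "set_integrable lborel half_plane
        (\<lambda>p. (1 - w p) * (E1 p * \<phi>t p + Q1 p * \<phi>x p) + w p * (E2 p * \<phi>t p + Q2 p * \<phi>x p))"
      by (intro set_integral_add(1) int bb) auto
    fix p assume p: "p \<in> half_plane"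
    (* The terms with derivatives of w add up to this product. *)
    have "0 \<le> N * (w' p * \<phi> p) * ((Q1 p - \<sigma> * E1 p) - (Q2 p - \<sigma> * E2 p))"
      using jump[OF p] nn \<open>0 < N\<close> by (intro mult_nonneg_nonneg) auto
    thus "?A p + ?B p \<le> (1 - w p) * (E1 p * \<phi>t p + Q1 p * \<phi>x p) + w p * (E2 p * \<phi>t p + Q2 p * \<phi>x p)"
      by (simp add: algebra_simps)
  qed
  finally show ?thesis .
qed

text \<open>Entropies may be switched along a moving line if the flux through the line does not increase. With \<open>\<sigma> < 0\<close> the
line stays inside the half-line, so the flux at the boundary is that of the entropy on the right. This replaces
the doubling of variables: comparison with a self-similar solution needs only one line at a time.\<close>

lemma balance_across_line:
  assumes b1: "balance E1 Q1 G1" and b2: "balance E2 Q2 G2" and "\<sigma> < 0"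
    and jump: "\<And>p. p \<in> half_plane \<Longrightarrow> Q2 p - \<sigma> * E2 p \<le> Q1 p - \<sigma> * E1 p"
  shows "balance (\<lambda>p. if snd p \<le> \<sigma> * fst p then E1 p else E2 p)
    (\<lambda>p. if snd p \<le> \<sigma> * fst p then Q1 p else Q2 p) G2"
proof -
  define S where "S = {p :: real \<times> real. snd p \<le> \<sigma> * fst p}"
  have "closed S" unfolding S_def by (intro closed_Collect_le continuous_intros)
  hence S [measurable]: "S \<in> sets borel" by simp
  note bb = balanceD(1,2,3)[OF b1] balanceD(1,2,3)[OF b2]
  have "(LINT t|lborel. G2 t * \<phi> (t, 0)) \<le> (LINT p:half_plane|lborel.
      (if p \<in> S then E1 p else E2 p) * \<phi>t p + (if p \<in> S then Q1 p else Q2 p) * \<phi>x p)"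
    if \<phi>: "test_function UNIV \<phi> \<phi>t \<phi>x" for \<phi> \<phi>t \<phi>x
  proof (rule LIMSEQ_le)
    note c = test_function_compactly_supported[OF \<phi>]
    define w where "w = (\<lambda>n p. step ((- real (Suc n) * \<sigma>) * fst p + real (Suc n) * snd p + 0))"
    let ?Y = "\<lambda>p. indicator half_plane p *\<^sub>R (E1 p * \<phi>t p + Q1 p * \<phi>x p)"
    let ?Z = "\<lambda>p. indicator half_plane p *\<^sub>R (E2 p * \<phi>t p + Q2 p * \<phi>x p)"
    have "(LINT t|lborel. (1 - w n (t, 0)) * (G1 t * \<phi> (t, 0)) + w n (t, 0) * (G2 t * \<phi> (t, 0)))
        \<le> (LINT p|lborel. (1 - w n p) * ?Y p + w n p * ?Z p)" for n
      using balance_across_strip[OF b1 b2 _ jump \<phi>, of "real (Suc n)"]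
      unfolding w_def set_lebesgue_integral_def by (simp add: algebra_simps)
    thus "\<exists>N. \<forall>n\<ge>N. (LINT t|lborel. (1 - w n (t, 0)) * (G1 t * \<phi> (t, 0)) + w n (t, 0) * (G2 t * \<phi> (t, 0)))
        \<le> (LINT p|lborel. (1 - w n p) * ?Y p + w n p * ?Z p)" by blast
    have wm [measurable]: "w n \<in> borel_measurable borel" for n unfolding w_def by measurable
    have bw: "0 \<le> w n p" "w n p \<le> 1" for n p by (auto simp: w_def)
    have w0: "(\<lambda>n. w n p) \<longlonglongrightarrow> (if p \<in> S then 0 else 1)" for p
    proof -
      have "w n p = step (real (Suc n) * (snd p - \<sigma> * fst p) - 0)" for n
        unfolding w_def by (rule arg_cong[of _ _ step]) (simp add: algebra_simps)
      thus ?thesis using step_scaled_limit[of 0 "snd p - \<sigma> * fst p"] by (auto simp: S_def)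
    qed
    have "(\<lambda>n. LINT t|lborel. (1 - w n (t, 0)) * (G1 t * \<phi> (t, 0)) + w n (t, 0) * (G2 t * \<phi> (t, 0)))
        \<longlonglongrightarrow> (LINT t|lborel. (if (t, 0) \<in> S then G1 t * \<phi> (t, 0) else G2 t * \<phi> (t, 0)))"
      by (rule blend_limit) (use w0 in \<open>auto intro!: integrable_bounded_compact bb c bw simp: borel_measurable_Pair\<close>)
    also have "(LINT t|lborel. (if (t, 0) \<in> S then G1 t * \<phi> (t, 0) else G2 t * \<phi> (t, 0))) = (LINT t|lborel. G2 t * \<phi> (t, 0))"
    proof (rule Bochner_Integration.integral_cong[OF refl])
      fix t :: real
      have "(t, 0) \<notin> S" if "0 < t" using that \<open>\<sigma> < 0\<close> by (simp add: S_def mult_neg_pos not_le)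
      moreover have "\<phi> (t, 0) = 0" if "\<not> 0 < t" using \<phi> that unfolding test_function_def by force
      ultimately show "(if (t, 0) \<in> S then G1 t * \<phi> (t, 0) else G2 t * \<phi> (t, 0)) = G2 t * \<phi> (t, 0)" by auto
    qed
    finally show "(\<lambda>n. LINT t|lborel. (1 - w n (t, 0)) * (G1 t * \<phi> (t, 0)) + w n (t, 0) * (G2 t * \<phi> (t, 0)))
        \<longlonglongrightarrow> (LINT t|lborel. G2 t * \<phi> (t, 0))" .
    have "set_integrable lborel half_plane (\<lambda>p. E1 p * \<phi>t p + Q1 p * \<phi>x p)"
      "set_integrable lborel half_plane (\<lambda>p. E2 p * \<phi>t p + Q2 p * \<phi>x p)"
      by (intro set_integral_add(1) set_integrable_half_plane bb c half_plane_borel)+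
    hence "(\<lambda>n. LINT p|lborel. (1 - w n p) * ?Y p + w n p * ?Z p) \<longlonglongrightarrow> (LINT p|lborel. (if p \<in> S then ?Y p else ?Z p))"
      unfolding set_integrable_def by (rule blend_limit) (use w0 bw in auto)
    also have "(LINT p|lborel. (if p \<in> S then ?Y p else ?Z p)) = (LINT p:half_plane|lborel.
        (if p \<in> S then E1 p else E2 p) * \<phi>t p + (if p \<in> S then Q1 p else Q2 p) * \<phi>x p)"
      unfolding set_lebesgue_integral_def by (intro Bochner_Integration.integral_cong) auto
    finally show "(\<lambda>n. LINT p|lborel. (1 - w n p) * ?Y p + w n p * ?Z p) \<longlonglongrightarrow> (LINT p:half_plane|lborel.
        (if p \<in> S then E1 p else E2 p) * \<phi>t p + (if p \<in> S then Q1 p else Q2 p) * \<phi>x p)" .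
  qed
  moreover have "bounded_borel (\<lambda>p. if p \<in> S then E1 p else E2 p)" "bounded_borel (\<lambda>p. if p \<in> S then Q1 p else Q2 p)"
    by (intro bounded_borel_if bb S)+
  ultimately show ?thesis using bb unfolding balance_def S_def by simp
qed

section \<open>The energy method\<close>

context
  fixes E Q :: "real \<times> real \<Rightarrow> real" and G :: "real \<Rightarrow> real" and \<Lambda> :: real
  assumes b: "balance E Q G"
    and E: "\<And>p. p \<in> half_plane \<Longrightarrow> 0 \<le> E p"
    and Q: "\<And>p. p \<in> half_plane \<Longrightarrow> \<bar>Q p\<bar> \<le> \<Lambda> * E p"
    and \<Lambda>: "0 \<le> \<Lambda>"
begin

text \<open>The test function is a product of four cutoffs: it starts after time \<open>1 / N\<close>, is switched off during \<open>[T, T + \<tau>]\<close>, lives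
to the right of the line \<open>x = \<Lambda> t - L\<close>, and vanishes for large \<open>x\<close>. Since \<open>\<Lambda>\<close> bounds the speed of propagation, the
derivative of the third cutoff has a favourable sign and is dropped. The fourth equals 1 on the half-line and only makes the support compact. What
remains is the flux at the boundary, the energy during \<open>[T, T + \<tau>]\<close>, and the energy in the initial layer, where a
derivative of size \<open>N C\<close> acts on a time interval of length at most \<open>2 / N\<close>.\<close>

lemma cutoff_energy_ineq:
  assumes T: "0 \<le> T" and \<tau>: "0 < \<tau>" and N: "0 < N"
    and e: "\<And>t. 0 < t \<Longrightarrow> t \<le> 2 / N \<Longrightarrow> (LINT x:{-L..<0}|lborel. E (t, x)) \<le> \<epsilon>"
    and C: "\<And>y. step_deriv y \<le> C" and \<epsilon>: "0 \<le> \<epsilon>"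
  shows "(LINT t|lborel. G t * (step (N * t - 1) * (1 - step ((t - T) / \<tau>)) * step (L - \<Lambda> * t))) +
    (LINT p:half_plane|lborel. E p * (step (N * fst p - 1) * (1 / \<tau> * step_deriv ((fst p - T) / \<tau>)) *
      step (L + snd p - \<Lambda> * fst p))) \<le> 2 * C * \<epsilon>"
    (is "(LINT t|_. ?G t) + (LINT p:_|_. E p * ?J p) \<le> _")
proof -
  have C0: "0 \<le> C" using C[of 0] by simp
  note bb = balanceD(1,2,3)[OF b]
  define A A' where "A = (\<lambda>p. step (N * fst p + 0 * snd p + - 1))"
    and "A' = (\<lambda>p. step_deriv (N * fst p + 0 * snd p + - 1))"
  define B B' where "B = (\<lambda>p. 1 - step ((1 / \<tau>) * fst p + 0 * snd p + - T / \<tau>))"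
    and "B' = (\<lambda>p. step_deriv ((1 / \<tau>) * fst p + 0 * snd p + - T / \<tau>))"
  define l l' where "l = (\<lambda>p. step ((- \<Lambda>) * fst p + 1 * snd p + L))"
    and "l' = (\<lambda>p. step_deriv ((- \<Lambda>) * fst p + 1 * snd p + L))"
  define r r' where "r = (\<lambda>p::real \<times> real. step (0 * fst p + (- 1) * snd p + 2))"
    and "r' = (\<lambda>p::real \<times> real. step_deriv (0 * fst p + (- 1) * snd p + 2))"
  note defs = A_def A'_def B_def B'_def l_def l'_def r_def r'_def
  have eqs: "A p = step (N * fst p - 1)" "B p = 1 - step ((fst p - T) / \<tau>)"
    "B' p = step_deriv ((fst p - T) / \<tau>)" "l p = step (L + snd p - \<Lambda> * fst p)" for p
    by (simp_all add: defs diff_divide_distrib algebra_simps)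
  have wA: "c1_weight A (\<lambda>p. N * A' p) (\<lambda>p. 0 * A' p)"
    and wl: "c1_weight l (\<lambda>p. (- \<Lambda>) * l' p) (\<lambda>p. 1 * l' p)"
    and wr: "c1_weight r (\<lambda>p. 0 * r' p) (\<lambda>p. (- 1) * r' p)"
    unfolding defs by (rule c1_weight_step)+
  have wB: "c1_weight B (\<lambda>p. (1 / \<tau>) * - B' p) (\<lambda>p. 0 * - B' p)"
    unfolding defs by (rule c1_weight_step_down)
  note cont = wA[THEN c1_weight_continuous(1)] wB[THEN c1_weight_continuous(1)]
    wl[THEN c1_weight_continuous(1)] wr[THEN c1_weight_continuous(1)]
  have cont': "continuous_on UNIV A'" "continuous_on UNIV B'" unfolding defs by (intro continuous_intros)+
  define K where "K = {1 / N..T + \<tau>} \<times> {- L..2::real}"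
  have K: "compact K" "K \<subseteq> {0<..} \<times> UNIV"
    using N unfolding K_def by (auto intro!: compact_Times intro: less_le_trans[of 0 "1 / N"])
  have zero: "A p = 0 \<and> A' p = 0 \<or> (B p = 0 \<and> B' p = 0) \<or> l p = 0 \<or> r p = 0" if "p \<notin> K" for p
  proof -
    have "fst p < 1 / N \<or> T + \<tau> < fst p \<or> (1 / N \<le> fst p \<and> snd p < - L) \<or> 2 < snd p"
      using that by (auto simp: K_def mem_Times_iff)
    thus ?thesis
    proof (elim disjE conjE)
      assume "1 / N \<le> fst p" "snd p < - L"
      moreover have "0 \<le> \<Lambda> * fst p"
        using \<Lambda> N calculation(1) by (intro mult_nonneg_nonneg) (auto intro: order_trans[rotated])
      ultimately have "l p = 0" unfolding defs by (intro step_low) simp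
      thus ?thesis by blast
    qed (use N \<tau> in \<open>auto simp: defs field_simps\<close>)
  qed
  have \<phi>: "test_function UNIV (\<lambda>p. A p * B p * l p * r p)
     (\<lambda>p. ((N * A' p * B p + A p * ((1 / \<tau>) * - B' p)) * l p + A p * B p * ((- \<Lambda>) * l' p)) * r p
       + A p * B p * l p * (0 * r' p))
     (\<lambda>p. ((0 * A' p * B p + A p * (0 * - B' p)) * l p + A p * B p * (1 * l' p)) * r p
       + A p * B p * l p * ((- 1) * r' p))" (is "test_function _ _ ?\<phi>t ?\<phi>x")
    unfolding test_function_iff using c1_weight_mult[OF c1_weight_mult[OF c1_weight_mult[OF wA wB] wl] wr] K zero
    by (intro conjI exI[of _ K]) auto
  have cs: "compactly_supported (\<lambda>p. N * A' p * B p * l p * r p)" (is "compactly_supported ?layer")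
    "compactly_supported (\<lambda>p. A p * (1 / \<tau> * B' p) * l p * r p)" (is "compactly_supported ?decay")
    unfolding compactly_supported_def using K zero \<tau>
    by (auto intro!: exI[of _ K] continuous_intros cont cont')
  have rH: "r p = 1" "r' p = 0" if "p \<in> half_plane" for p
    using that unfolding defs half_plane_def by (auto simp: mem_Times_iff)
  have "(LINT t|lborel. G t * (A (t, 0) * B (t, 0) * l (t, 0) * r (t, 0)))
      \<le> (LINT p:half_plane|lborel. E p * ?\<phi>t p + Q p * ?\<phi>x p)"
    by (rule balanceD(4)[OF b \<phi>])
  (* The derivative of l contributes (Q - \<Lambda> E) A B l', which is nonpositive. *)
  also have "\<dots> \<le> (LINT p:half_plane|lborel. E p * ?layer p - E p * ?decay p)"
  proof (rule set_integral_mono)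
    show "set_integrable lborel half_plane (\<lambda>p. E p * ?\<phi>t p + Q p * ?\<phi>x p)"
      by (intro set_integral_add(1) set_integrable_half_plane bb test_function_compactly_supported[OF \<phi>] half_plane_borel)
    show "set_integrable lborel half_plane (\<lambda>p. E p * ?layer p - E p * ?decay p)"
      by (intro set_integral_diff(1) set_integrable_half_plane bb cs half_plane_borel)
    fix p assume p: "p \<in> half_plane"
    have "0 \<le> A p * B p * l' p" by (simp add: defs)
    hence "Q p * (A p * B p * l' p) \<le> \<Lambda> * E p * (A p * B p * l' p)"
      using Q[OF p] by (intro mult_right_mono) auto
    thus "E p * ?\<phi>t p + Q p * ?\<phi>x p \<le> E p * ?layer p - E p * ?decay p"
      by (simp add: rH[OF p] algebra_simps)
  qed
  also have "\<dots> = (LINT p:half_plane|lborel. E p * ?layer p) - (LINT p:half_plane|lborel. E p * ?decay p)"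
    by (intro set_integral_diff(2) set_integrable_half_plane bb cs half_plane_borel)
  also have "(LINT p:half_plane|lborel. E p * ?decay p) = (LINT p:half_plane|lborel. E p * ?J p)"
    by (intro set_lebesgue_integral_cong) (simp_all add: eqs rH)
  also have "(\<lambda>t. G t * (A (t, 0) * B (t, 0) * l (t, 0) * r (t, 0))) = ?G"
    by (simp add: eqs r_def)
  finally have main: "(LINT t|lborel. ?G t) + (LINT p:half_plane|lborel. E p * ?J p)
    \<le> (LINT p:half_plane|lborel. E p * ?layer p)" by simp
  define D where "D = {0..2 / N} \<times> {- L..0::real}"
  let ?U = "\<lambda>p. indicator ({0<..2 / N} \<times> {- L..<0}) p * (N * C * E p)"
  obtain CE where CE: "0 < CE" "\<And>p. \<bar>E p\<bar> \<le> CE" and [measurable]: "E \<in> borel_measurable borel"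
    using bounded_borelE[OF bb(1)] by blast
  have S [measurable]: "{0<..2 / N} \<times> {- L..<0} \<in> sets (borel :: (real \<times> real) measure)"
    by (simp add: borel_prod[symmetric])
  have U: "integrable lborel ?U"
  proof (rule integrable_bounded_support)
    show "bounded ({0..2 / N} \<times> {- L..0::real})" by (intro bounded_Times) auto
    fix p
    have "N * C * \<bar>E p\<bar> \<le> N * C * CE" using N C0 by (intro mult_left_mono CE) auto
    thus "\<bar>?U p\<bar> \<le> N * C * CE" using N C0 CE by (auto simp: indicator_def abs_mult)
    show "p \<notin> {0..2 / N} \<times> {- L..0} \<Longrightarrow> ?U p = 0" by (auto simp: indicator_def)
  qed measurable
  have "(LINT p:half_plane|lborel. E p * ?layer p) \<le> (LINT p|lborel. ?U p)"
    unfolding set_lebesgue_integral_def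
  proof (rule integral_mono[OF _ U])
    show "integrable lborel (\<lambda>p. indicator half_plane p *\<^sub>R (E p * ?layer p))"
      using set_integrable_half_plane[OF bb(1) cs(1) half_plane_borel] by (simp only: set_integrable_def)
    fix p :: "real \<times> real"
    show "indicator half_plane p *\<^sub>R (E p * ?layer p) \<le> ?U p"
    proof (cases "p \<in> half_plane")
      case True
      hence h: "0 < fst p" "snd p < 0" by (auto simp: half_plane_def)
      show ?thesis
      proof (cases "p \<in> {0<..2 / N} \<times> {- L..<0}")
        case in_S: True
        have "?layer p \<le> N * C * 1 * 1 * 1"
          using N C C0 by (intro mult_mono) (auto simp: defs)
        hence "E p * ?layer p \<le> E p * (N * C)" using E[OF True] by (intro mult_left_mono) auto
        thus ?thesis using in_S True by (simp add: mult.commute)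
      next
        case False
        have "2 / N < fst p \<or> snd p < - L" using False h by (auto simp: mem_Times_iff)
        hence "1 \<le> N * fst p + 0 * snd p + - 1 \<or> (- \<Lambda>) * fst p + 1 * snd p + L \<le> 0"
          using N mult_nonneg_nonneg[OF \<Lambda>, of "fst p"] h by (auto simp: field_simps)
        hence "A' p = 0 \<or> l p = 0" unfolding defs by auto
        thus ?thesis using False by auto
      qed
    qed (use E N C0 in \<open>auto simp: half_plane_def indicator_def\<close>)
  qed
  also have "\<dots> = (LINT t|lborel. LINT x|lborel. ?U (t, x))" by (rule plane_integral_iterated(1)[OF U])
  also have "\<dots> \<le> (LINT t|lborel. indicator {0..2 / N} t * (N * C * \<epsilon>))"
  proof (rule integral_mono')
    show "integrable lborel (\<lambda>t. indicator {0..2 / N} t * (N * C * \<epsilon>))"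
      using borel_integrable_compact[of "{0..2 / N}" "\<lambda>_. N * C * \<epsilon>"] by simp
    fix t :: real
    show "0 \<le> indicator {0..2 / N} t * (N * C * \<epsilon>)" using N C0 \<epsilon> by simp
    have "(\<lambda>x. ?U (t, x)) = (\<lambda>x. indicator {0<..2 / N} t * (N * C) * (indicator {- L..<0} x *\<^sub>R E (t, x)))"
      by (auto simp: fun_eq_iff indicator_def)
    hence "(LINT x|lborel. ?U (t, x)) = indicator {0<..2 / N} t * (N * C) * (LINT x:{- L..<0}|lborel. E (t, x))"
      unfolding set_lebesgue_integral_def by (simp only: Bochner_Integration.integral_mult_right_zero)
    also have "\<dots> \<le> indicator {0..2 / N} t * (N * C * \<epsilon>)"
      using e[of t] N C0 \<epsilon> by (auto simp: indicator_def mult.assoc intro!: mult_left_mono)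
    finally show "(LINT x|lborel. ?U (t, x)) \<le> indicator {0..2 / N} t * (N * C * \<epsilon>)" .
  qed
  also have "\<dots> = 2 * C * \<epsilon>" using N by simp
  finally show ?thesis using main by simp
qed

context
  assumes init: "\<And>L. ((\<lambda>t. LINT x:{-L..<0}|lborel. E (t, x)) \<longlongrightarrow> 0) (at_right 0)"
begin

lemma thin_initial_layer:
  assumes "0 < \<epsilon>" "0 < \<delta>"
  obtains N where "0 < N" "2 / N < \<delta>"
    "\<And>t. 0 < t \<Longrightarrow> t \<le> 2 / N \<Longrightarrow> (LINT x:{-L..<0}|lborel. E (t, x)) \<le> \<epsilon>"
proof -
  have "\<forall>\<^sub>F t in at_right 0. (LINT x:{-L..<0}|lborel. E (t, x)) < \<epsilon>"
    using order_tendstoD(2)[OF init assms(1)] .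
  then obtain d where d: "0 < d" "\<And>t. 0 < t \<Longrightarrow> t < d \<Longrightarrow> (LINT x:{-L..<0}|lborel. E (t, x)) < \<epsilon>"
    unfolding eventually_at_right_field by blast
  show thesis
  proof (rule that[of "4 / min d \<delta>"])
    have m: "2 / (4 / min d \<delta>) = min d \<delta> / 2" by simp
    show "0 < 4 / min d \<delta>" "2 / (4 / min d \<delta>) < \<delta>" using d assms unfolding m by (auto simp: min_def)
    fix t assume t: "0 < t" "t \<le> 2 / (4 / min d \<delta>)"
    have "t < d" using t(2) d(1) assms(2) unfolding m by (auto simp: min_def split: if_splits)
    thus "(LINT x:{-L..<0}|lborel. E (t, x)) \<le> \<epsilon>" using d(2)[OF t(1)] by simp
  qed
qed

text \<open>An energy that vanishes initially cannot flow out: discard the energy term and let the cutoffs become sharp.\<close>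

lemma boundary_flux_nonpos:
  assumes T: "0 \<le> T"
  shows "(LINT t:{0..T}|lborel. G t) \<le> 0"
proof -
  obtain C where C: "0 < C" "\<And>y. step_deriv y \<le> C" using step_deriv_bounded by blast
  obtain CG where CG: "0 < CG" "\<And>t. \<bar>G t\<bar> \<le> CG" and [measurable]: "G \<in> borel_measurable borel"
    using bounded_borelE[OF balanceD(3)[OF b]] by blast
  (* With this L the cone contains the boundary up to time T + 1. *)
  define L where "L = \<Lambda> * (T + 1) + 1"
  have "\<exists>N. 0 < N \<and> 2 / N < 1 / real (Suc n) \<and>
      (\<forall>t. 0 < t \<longrightarrow> t \<le> 2 / N \<longrightarrow> (LINT x:{-L..<0}|lborel. E (t, x)) \<le> 1 / real (Suc n))" for n
    by (rule thin_initial_layer[of "1 / real (Suc n)" "1 / real (Suc n)" L]) auto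
  then obtain N where N: "\<And>n. 0 < N n" "\<And>n. 2 / N n < 1 / real (Suc n)"
    "\<And>n t. 0 < t \<Longrightarrow> t \<le> 2 / N n \<Longrightarrow> (LINT x:{-L..<0}|lborel. E (t, x)) \<le> 1 / real (Suc n)" by metis
  define w where "w = (\<lambda>n t. step (N n * t - 1) * (1 - step ((t - T) / (1 / real (Suc n)))) * step (L - \<Lambda> * t))"
  have [measurable]: "w n \<in> borel_measurable borel" for n unfolding w_def by measurable
  have w: "0 \<le> w n t" "w n t \<le> 1" for n t
    by (auto simp: w_def intro!: mult_nonneg_nonneg mult_le_one)
  have w_zero: "w n t = 0" if "t \<le> 0 \<or> T + 1 < t" for n t
  proof -
    have "N n * t - 1 \<le> 0 \<or> 1 \<le> (t - T) / (1 / real (Suc n))"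
      using that
    proof
      assume "t \<le> 0"
      thus ?thesis using N(1)[of n] mult_nonneg_nonpos[of "N n" t] by simp
    next
      assume "T + 1 < t"
      hence "1 * 1 \<le> (t - T) * real (Suc n)" by (intro mult_mono) auto
      thus ?thesis by simp
    qed
    thus ?thesis unfolding w_def by auto
  qed
  have w_lim: "(\<lambda>n. w n t) \<longlonglongrightarrow> (if 0 < t \<and> t \<le> T then 1 else 0)" if "t \<noteq> 0" for t
  proof (cases "0 < t \<and> t \<le> T + 1")
    case False
    thus ?thesis using w_zero[of t] that by (auto simp: not_less not_le)
  next
    case True
    have "\<Lambda> * t \<le> \<Lambda> * (T + 1)" using True \<Lambda> by (intro mult_left_mono) auto
    hence l: "step (L - \<Lambda> * t) = 1" by (simp add: L_def)
    obtain n0 where n0: "1 < real n0 * t" using ex_less_of_nat_mult True by blast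
    have "step (N n * t - 1) = 1" if "n0 \<le> n" for n
    proof -
      have "real n0 * t \<le> real (Suc n) * t" using that True by (intro mult_right_mono) auto
      hence "1 < real (Suc n) * t" using n0 by linarith
      hence "1 / real (Suc n) < t" by (simp add: field_simps)
      hence "2 / N n < t" using N(2)[of n] by simp
      thus ?thesis using N(1)[of n] by (simp add: field_simps)
    qed
    hence "\<forall>\<^sub>F n in sequentially. 1 - step (real (Suc n) * (t - T) - 0) = w n t"
      by (intro eventually_sequentiallyI[of n0]) (simp add: w_def l mult.commute)
    moreover have "(\<lambda>n. 1 - step (real (Suc n) * (t - T) - 0)) \<longlonglongrightarrow> 1 - (if 0 < t - T then 1 else 0)"
      by (intro tendsto_intros step_scaled_limit) simp
    ultimately have "(\<lambda>n. w n t) \<longlonglongrightarrow> 1 - (if 0 < t - T then 1 else 0)" by (rule Lim_transform_eventually[rotated])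
    thus ?thesis using True by (auto simp: not_less)
  qed
  have "(\<lambda>n. LINT t|lborel. G t * w n t) \<longlonglongrightarrow> (LINT t:{0..T}|lborel. G t)"
    unfolding set_lebesgue_integral_def
  proof (rule integral_dominated_convergence[where w = "\<lambda>t. indicator {0..T + 1} t *\<^sub>R CG"])
    show "integrable lborel (\<lambda>t. indicator {0..T + 1} t *\<^sub>R CG)" by (intro borel_integrable_compact) auto
    show "AE t in lborel. (\<lambda>n. G t * w n t) \<longlonglongrightarrow> indicator {0..T} t *\<^sub>R G t"
      using AE_lborel_singleton[of "0::real"]
    proof eventually_elim
      fix t :: real assume "t \<noteq> 0"
      from tendsto_mult[OF tendsto_const[of "G t"] w_lim[OF this]]
      show "(\<lambda>n. G t * w n t) \<longlonglongrightarrow> indicator {0..T} t *\<^sub>R G t"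
        using \<open>t \<noteq> 0\<close> by (cases "0 < t \<and> t \<le> T") auto
    qed
    show "AE t in lborel. norm (G t * w n t) \<le> indicator {0..T + 1} t *\<^sub>R CG" for n
    proof (rule AE_I2)
      fix t
      have "\<bar>G t\<bar> * \<bar>w n t\<bar> \<le> CG * 1" using CG w[of n t] by (intro mult_mono) auto
      thus "norm (G t * w n t) \<le> indicator {0..T + 1} t *\<^sub>R CG"
        using w_zero[of t n] by (cases "t \<in> {0..T + 1}") (auto simp: abs_mult)
    qed
  qed measurable
  moreover have "(\<lambda>n. 2 * C * (1 / real (Suc n))) \<longlonglongrightarrow> 2 * C * 0"
    using LIMSEQ_inverse_real_of_nat by (intro tendsto_intros) (simp add: inverse_eq_divide)
  moreover have "(LINT t|lborel. G t * w n t) \<le> 2 * C * (1 / real (Suc n))" for n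
  proof -
    have "0 \<le> (LINT p:half_plane|lborel. E p * (step (N n * fst p - 1) *
        (1 / (1 / real (Suc n)) * step_deriv ((fst p - T) / (1 / real (Suc n)))) * step (L + snd p - \<Lambda> * fst p)))"
      unfolding set_lebesgue_integral_def using E
      by (intro Bochner_Integration.integral_nonneg) (auto simp: indicator_def)
    with cutoff_energy_ineq[OF T _ N(1) N(3) C(2), of "1 / real (Suc n)" n n]
    show ?thesis unfolding w_def by simp
  qed
  ultimately show ?thesis by (auto dest: LIMSEQ_le)
qed

text \<open>If energy can only leave, an energy that vanishes initially remains zero: discard the boundary term. The remaining
integrand is positive inside a backward cone; countably many cones exhaust the half-plane.\<close>

lemma energy_vanishes:
  assumes G: "AE t in lborel. 0 < t \<longrightarrow> 0 \<le> G t"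
  shows "AE p in lborel. p \<in> half_plane \<longrightarrow> E p = 0"
proof -
  obtain C where C: "0 < C" "\<And>y. step_deriv y \<le> C" using step_deriv_bounded by blast
  obtain CE where CE: "0 < CE" "\<And>p. \<bar>E p\<bar> \<le> CE" and [measurable]: "E \<in> borel_measurable borel"
    using bounded_borelE[OF balanceD(1)[OF b]] by blast
  have "AE p in lborel. p \<in> half_plane \<longrightarrow> 1 / real (Suc k) \<le> fst p \<longrightarrow> fst p < real (Suc n)
      \<longrightarrow> \<Lambda> * fst p < real m + snd p \<longrightarrow> E p = 0" for k n m
  proof -
    (* Energy is switched off over the whole interval [0, n + 1], so that the weight is positive throughout. *)
    define J where "J = (\<lambda>p. 1 / real (Suc n) * step_deriv ((fst p - 0) / real (Suc n)) * step (real m + snd p - \<Lambda> * fst p))"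
    define F where "F = (\<lambda>p. indicator half_plane p * (if 1 / real (Suc k) \<le> fst p then E p * J p else 0))"
    have [measurable]: "J \<in> borel_measurable borel" unfolding J_def by measurable
    have [measurable]: "F \<in> borel_measurable borel" unfolding F_def by measurable
    have J: "0 \<le> J p" "J p \<le> C" for p
    proof -
      show "0 \<le> J p" unfolding J_def by simp
      have "J p \<le> 1 * C * 1" unfolding J_def using C by (intro mult_mono) auto
      thus "J p \<le> C" by simp
    qed
    have J0: "J p = 0" if "p \<in> half_plane" "p \<notin> {0..real (Suc n)} \<times> {- real m..0}" for p
    proof -
      have h: "0 < fst p" "snd p < 0" using that(1) by (auto simp: half_plane_def)
      hence "real (Suc n) < fst p \<or> snd p < - real m" using that(2) by (auto simp: mem_Times_iff)
      hence "1 \<le> (fst p - 0) / real (Suc n) \<or> real m + snd p - \<Lambda> * fst p \<le> 0"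
        using mult_nonneg_nonneg[OF \<Lambda>, of "fst p"] h by (auto simp: field_simps)
      thus ?thesis unfolding J_def by auto
    qed
    have EJ: "\<bar>E p * J p\<bar> \<le> CE * C" for p unfolding abs_mult using CE J[of p] by (intro mult_mono) auto
    have supp: "bounded ({0..real (Suc n)} \<times> {- real m..0::real})" by (intro bounded_Times) auto
    have nn: "0 \<le> F p" for p using E J unfolding F_def by (auto simp: indicator_def)
    have int: "integrable lborel F"
      by (rule integrable_bounded_support[OF _ _ supp, of _ "CE * C"])
        (use EJ J0 CE C in \<open>auto simp: F_def indicator_def\<close>)
    have "(LINT p|lborel. F p) \<le> 0"
    proof (rule field_le_epsilon)
      fix \<epsilon> :: real assume "0 < \<epsilon>"
      hence "0 < \<epsilon> / (2 * C)" "0 < 1 / real (Suc k)" using C(1) by auto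
      then obtain N where N: "0 < N" "2 / N < 1 / real (Suc k)"
        "\<And>t. 0 < t \<Longrightarrow> t \<le> 2 / N \<Longrightarrow> (LINT x:{-real m..<0}|lborel. E (t, x)) \<le> \<epsilon> / (2 * C)"
        using thin_initial_layer by metis
      let ?a = "\<lambda>t. step (N * t - 1)"
      have "(LINT p|lborel. F p) \<le> (LINT p:half_plane|lborel. E p * (?a (fst p) * J p))"
        unfolding set_lebesgue_integral_def
      proof (rule integral_mono[OF int])
        show "integrable lborel (\<lambda>p. indicator half_plane p *\<^sub>R (E p * (?a (fst p) * J p)))"
        proof (rule integrable_bounded_support[OF _ _ supp])
          fix p
          have "\<bar>?a (fst p) * (E p * J p)\<bar> \<le> 1 * (CE * C)"
            unfolding abs_mult[of "?a (fst p)"] by (intro mult_mono EJ) auto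
          thus "\<bar>indicator half_plane p *\<^sub>R (E p * (?a (fst p) * J p))\<bar> \<le> CE * C"
            using CE C by (simp add: indicator_def mult_ac)
          show "p \<notin> {0..real (Suc n)} \<times> {- real m..0} \<Longrightarrow> indicator half_plane p *\<^sub>R (E p * (?a (fst p) * J p)) = 0"
            using J0 by (cases "p \<in> half_plane") auto
        qed measurable
        fix p :: "real \<times> real"
        have "?a (fst p) = 1" if "1 / real (Suc k) \<le> fst p"
        proof -
          have "2 / N < fst p" using N(2) that by simp
          thus ?thesis using N(1) by (simp add: field_simps)
        qed
        thus "F p \<le> indicator half_plane p *\<^sub>R (E p * (?a (fst p) * J p))"
          using E J unfolding F_def by (auto simp: indicator_def)
      qed
      moreover have "0 \<le> (LINT t|lborel. G t * (?a t * (1 - step ((t - 0) / real (Suc n))) * step (real m - \<Lambda> * t)))"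
      proof (rule integral_nonneg_AE)
        show "AE t in lborel. 0 \<le> G t * (?a t * (1 - step ((t - 0) / real (Suc n))) * step (real m - \<Lambda> * t))"
          using G
        proof eventually_elim
          fix t assume G: "0 < t \<longrightarrow> 0 \<le> G t"
          have "?a t = 0" if "\<not> 0 < t"
            using mult_nonneg_nonpos[of N t] N(1) that by simp
          thus "0 \<le> G t * (?a t * (1 - step ((t - 0) / real (Suc n))) * step (real m - \<Lambda> * t))"
            using G by (cases "0 < t") auto
        qed
      qed
      moreover have "(LINT t|lborel. G t * (?a t * (1 - step ((t - 0) / real (Suc n))) * step (real m - \<Lambda> * t)))
          + (LINT p:half_plane|lborel. E p * (?a (fst p) * J p)) \<le> 2 * C * (\<epsilon> / (2 * C))"
        using cutoff_energy_ineq[OF order_refl _ N(1) N(3) C(2), of "real (Suc n)"] C(1) \<open>0 < \<epsilon>\<close>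
        by (simp add: J_def mult.assoc)
      ultimately show "(LINT p|lborel. F p) \<le> 0 + \<epsilon>" using C(1) by simp
    qed
    hence "(LINT p|lborel. F p) = 0"
      using Bochner_Integration.integral_nonneg[of lborel F] nn by (intro antisym) auto
    hence "AE p in lborel. F p = 0"
      using integral_nonneg_eq_0_iff_AE[OF int] nn by simp
    thus ?thesis
    proof eventually_elim
      fix p assume F0: "F p = 0"
      show "p \<in> half_plane \<longrightarrow> 1 / real (Suc k) \<le> fst p \<longrightarrow> fst p < real (Suc n) \<longrightarrow> \<Lambda> * fst p < real m + snd p \<longrightarrow> E p = 0"
      proof (intro impI)
        assume p: "p \<in> half_plane" "1 / real (Suc k) \<le> fst p" "fst p < real (Suc n)" "\<Lambda> * fst p < real m + snd p"
        have "0 < fst p" using p(1) by (auto simp: half_plane_def)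
        hence "0 < J p" unfolding J_def using p
          by (intro mult_pos_pos step_deriv_pos step_pos) (auto simp: field_simps)
        thus "E p = 0" using F0 p(1,2) unfolding F_def by simp
      qed
    qed
  qed
  hence "AE p in lborel. \<forall>k n m. p \<in> half_plane \<longrightarrow> 1 / real (Suc k) \<le> fst p \<longrightarrow> fst p < real (Suc n)
      \<longrightarrow> \<Lambda> * fst p < real m + snd p \<longrightarrow> E p = 0"
    by (intro AE_all_countable[THEN iffD2] allI)
  thus ?thesis
  proof eventually_elim
    fix p assume *: "\<forall>k n m. p \<in> half_plane \<longrightarrow> 1 / real (Suc k) \<le> fst p \<longrightarrow> fst p < real (Suc n)
      \<longrightarrow> \<Lambda> * fst p < real m + snd p \<longrightarrow> E p = 0"
    show "p \<in> half_plane \<longrightarrow> E p = 0"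
    proof
      assume p: "p \<in> half_plane"
      hence "0 < fst p" by (auto simp: half_plane_def)
      then obtain k where "1 / real (Suc k) < fst p" using nat_approx_posE by blast
      moreover obtain n where n: "fst p < real n" using reals_Archimedean2 by blast
      hence "fst p < real (Suc n)" by simp
      moreover obtain m where "\<Lambda> * fst p - snd p < real m" using reals_Archimedean2 by blast
      hence "\<Lambda> * fst p < real m + snd p" by simp
      ultimately show "E p = 0" using * p by (meson less_imp_le)
    qed
  qed
qed

end

end

section \<open>Solutions with a trace on a half-line\<close>

definition kruzkov_flux :: "(real \<Rightarrow> real) \<Rightarrow> real \<Rightarrow> real \<Rightarrow> real" where
  "kruzkov_flux f k u = sgn (u - k) * (f u - f k)"

text \<open>What the comparison arguments need of an entropy solution on \<open>x < 0\<close> with constant initial value \<open>l\<close>: Kruzkov's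
inequalities up to the boundary, where \<open>b\<close> is the trace. The function \<open>u\<close> is defined on the whole plane, so that it is
measurable without reference to a domain.\<close>

definition trace_solution ::
  "(real \<Rightarrow> real) \<Rightarrow> real \<Rightarrow> real \<Rightarrow> (real \<times> real \<Rightarrow> real) \<Rightarrow> (real \<Rightarrow> real) \<Rightarrow> bool" where
  "trace_solution f R l u b \<longleftrightarrow>
     u \<in> borel_measurable borel \<and> (\<forall>p. u p \<in> {0..R}) \<and>
     b \<in> borel_measurable borel \<and> (\<forall>t. b t \<in> {0..R}) \<and>
     (\<forall>L. ((\<lambda>t. LINT x:{-L..<0}|lborel. \<bar>u (t, x) - l\<bar>) \<longlongrightarrow> 0) (at_right 0)) \<and>
     (\<forall>k\<in>{0..R}. balance (\<lambda>p. \<bar>u p - k\<bar>) (\<lambda>p. kruzkov_flux f k (u p)) (\<lambda>t. kruzkov_flux f k (b t)))"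

lemma trace_solutionD:
  assumes "trace_solution f R l u b"
  shows "u \<in> borel_measurable borel" "u p \<in> {0..R}" "b \<in> borel_measurable borel" "b t \<in> {0..R}"
    "((\<lambda>t. LINT x:{-L..<0}|lborel. \<bar>u (t, x) - l\<bar>) \<longlongrightarrow> 0) (at_right 0)"
    "k \<in> {0..R} \<Longrightarrow> balance (\<lambda>p. \<bar>u p - k\<bar>) (\<lambda>p. kruzkov_flux f k (u p)) (\<lambda>t. kruzkov_flux f k (b t))"
  using assms unfolding trace_solution_def by blast+

lemma nonneg_zero_of_integrals:
  fixes G :: "real \<Rightarrow> real"
  assumes G: "bounded_borel G" and nn: "AE t in lborel. 0 < t \<longrightarrow> 0 \<le> G t"
    and le: "\<And>T. 0 \<le> T \<Longrightarrow> (LINT t:{0..T}|lborel. G t) \<le> 0"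
  shows "AE t in lborel. 0 < t \<longrightarrow> G t = 0"
proof -
  have "AE t in lborel. 0 < t \<longrightarrow> t \<le> real n \<longrightarrow> G t = 0" for n
  proof -
    have int: "integrable lborel (\<lambda>t. indicator {0..real n} t *\<^sub>R G t)"
      using set_integrable_bounded[OF G, of "{0..real n}"] by (simp add: set_integrable_def)
    have nn': "AE t in lborel. 0 \<le> indicator {0..real n} t *\<^sub>R G t"
      using nn AE_lborel_singleton[of "0::real"] by eventually_elim (auto simp: indicator_def)
    have "(LINT t|lborel. indicator {0..real n} t *\<^sub>R G t) = 0"
      using le[of "real n"] integral_nonneg_AE[OF nn'] by (simp add: set_lebesgue_integral_def)
    hence "AE t in lborel. indicator {0..real n} t *\<^sub>R G t = 0"
      using integral_nonneg_eq_0_iff_AE[OF int nn'] by simp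
    thus ?thesis by eventually_elim (auto simp: indicator_def)
  qed
  hence "AE t in lborel. \<forall>n. 0 < t \<longrightarrow> t \<le> real n \<longrightarrow> G t = 0"
    by (intro AE_all_countable[THEN iffD2] allI)
  thus ?thesis by eventually_elim (meson real_arch_simple)
qed

text \<open>To the right of the line \<open>x = \<sigma> t\<close> the energy may exceed the distance to \<open>l\<close>, but at time \<open>t\<close> that region is only
\<open>\<bar>\<sigma>\<bar> t\<close> wide.\<close>

lemma energy_initially_zero:
  assumes ts: "trace_solution f R l u b" and E: "bounded_borel E"
    and EH: "\<And>p. p \<in> half_plane \<Longrightarrow> 0 \<le> E p"
    and le: "\<And>p. p \<in> half_plane \<Longrightarrow> E p \<le> \<bar>u p - l\<bar> + (if \<sigma> * fst p < snd p then C else 0)"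
    and "\<sigma> \<le> 0" "0 \<le> C"
  shows "((\<lambda>t. LINT x:{-L..<0}|lborel. E (t, x)) \<longlongrightarrow> 0) (at_right 0)"
proof (rule tendsto_sandwich)
  have ub: "bounded_borel u"
    using bounded_borel_compose[OF continuous_on_id, of u 0 R] trace_solutionD[OF ts] by simp
  have [measurable]: "u \<in> borel_measurable borel" using trace_solutionD[OF ts] by simp
  have dev: "bounded_borel (\<lambda>p. \<bar>u p - l\<bar>)"
  proof -
    obtain D where D: "0 < D" "\<And>p. \<bar>u p\<bar> \<le> D" using bounded_borelE[OF ub] by blast
    have "\<bar>\<bar>u p - l\<bar>\<bar> \<le> D + \<bar>l\<bar>" for p using D(2)[of p] by linarith
    thus ?thesis unfolding bounded_borel_def by (intro conjI exI[of _ "D + \<bar>l\<bar>"]) auto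
  qed
  show "\<forall>\<^sub>F t in at_right 0. 0 \<le> (LINT x:{-L..<0}|lborel. E (t, x))"
  proof (rule eventually_at_rightI[of 0 1])
    fix t :: real assume "t \<in> {0<..<1}"
    thus "0 \<le> (LINT x:{-L..<0}|lborel. E (t, x))"
      unfolding set_lebesgue_integral_def
      by (intro Bochner_Integration.integral_nonneg) (auto simp: indicator_def half_plane_def intro!: EH)
  qed simp
  show "\<forall>\<^sub>F t in at_right 0. (LINT x:{-L..<0}|lborel. E (t, x)) \<le>
      (LINT x:{-L..<0}|lborel. \<bar>u (t, x) - l\<bar>) + C * (- \<sigma> * t)"
  proof (rule eventually_at_rightI[of 0 1])
    fix t :: real assume "t \<in> {0<..<1}"
    hence t: "0 < t" by simp
    have st: "\<sigma> * t \<le> 0" using t \<open>\<sigma> \<le> 0\<close> by (simp add: mult_nonpos_nonneg)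
    have i1: "set_integrable lborel {-L..<0} (\<lambda>x. \<bar>u (t, x) - l\<bar>)"
      by (rule set_integrable_bounded[OF bounded_borel_slice(1)[OF dev]]) auto
    have i0: "set_integrable lborel {-L..<0} (\<lambda>x. E (t, x))"
      by (rule set_integrable_bounded[OF bounded_borel_slice(1)[OF E]]) auto
    have i2: "integrable lborel (\<lambda>x. indicator {\<sigma> * t..0} x *\<^sub>R C)"
      by (rule borel_integrable_compact) auto
    have "(LINT x:{-L..<0}|lborel. E (t, x))
        \<le> (LINT x|lborel. indicator {-L..<0} x *\<^sub>R \<bar>u (t, x) - l\<bar> + indicator {\<sigma> * t..0} x *\<^sub>R C)"
      unfolding set_lebesgue_integral_def
    proof (rule integral_mono)
      fix x :: real
      show "indicator {-L..<0} x *\<^sub>R E (t, x) \<le> indicator {-L..<0} x *\<^sub>R \<bar>u (t, x) - l\<bar> + indicator {\<sigma> * t..0} x *\<^sub>R C"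
      proof (cases "x \<in> {-L..<0}")
        case True
        hence "(t, x) \<in> half_plane" using t by (simp add: half_plane_def)
        from le[OF this] True \<open>0 \<le> C\<close> show ?thesis by (auto simp: indicator_def split: if_splits)
      qed (use \<open>0 \<le> C\<close> in simp)
    qed (use i0 i1 i2 in \<open>auto simp: set_integrable_def\<close>)
    also have "\<dots> = (LINT x:{-L..<0}|lborel. \<bar>u (t, x) - l\<bar>) + (LINT x|lborel. indicator {\<sigma> * t..0} x *\<^sub>R C)"
      unfolding set_lebesgue_integral_def
      by (rule Bochner_Integration.integral_add) (use i1 i2 in \<open>auto simp: set_integrable_def\<close>)
    also have "(LINT x|lborel. indicator {\<sigma> * t..0} x *\<^sub>R C) = C * (- \<sigma> * t)" using st by simp
    finally show "(LINT x:{-L..<0}|lborel. E (t, x)) \<le>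
      (LINT x:{-L..<0}|lborel. \<bar>u (t, x) - l\<bar>) + C * (- \<sigma> * t)" .
  qed simp
  have "((\<lambda>t. (LINT x:{-L..<0}|lborel. \<bar>u (t, x) - l\<bar>) + C * (- \<sigma> * t)) \<longlongrightarrow> 0 + C * (- \<sigma> * 0)) (at_right 0)"
    by (intro tendsto_intros trace_solutionD(5)[OF ts])
  thus "((\<lambda>t. (LINT x:{-L..<0}|lborel. \<bar>u (t, x) - l\<bar>) + C * (- \<sigma> * t)) \<longlongrightarrow> 0) (at_right 0)" by simp
qed simp

context concave_road begin

text \<open>On \<open>[0, R]\<close> the positive part of \<open>u - k\<close> is half the sum of the Kruzkov entropies for the constants \<open>k\<close> and \<open>0\<close>, up to an
additive constant; here \<open>f 0 = 0\<close> enters.\<close>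

lemma above_balance:
  assumes ts: "trace_solution f R l u b" and k: "k \<in> {0..R}"
  shows "balance (\<lambda>p. max 0 (u p - k)) (\<lambda>p. if k < u p then f (u p) - f k else 0)
    (\<lambda>t. if k < b t then f (b t) - f k else 0)"
proof -
  note r = trace_solutionD(2)[OF ts] trace_solutionD(4)[OF ts]
  have 0: "(0::real) \<in> {0..R}" using R_pos by simp
  have k0: "kruzkov_flux f 0 x = f x" "\<bar>x - 0\<bar> = x" if "x \<in> {0..R}" for x
    using that flux_zero by (cases "x = 0", auto simp: kruzkov_flux_def sgn_if)
  have "balance (\<lambda>p. 1/2 * \<bar>u p - k\<bar> + 1/2 * \<bar>u p - 0\<bar> + - k/2)
     (\<lambda>p. 1/2 * kruzkov_flux f k (u p) + 1/2 * kruzkov_flux f 0 (u p) + - f k/2)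
     (\<lambda>t. 1/2 * kruzkov_flux f k (b t) + 1/2 * kruzkov_flux f 0 (b t) + - f k/2)"
    by (intro balance_add balance_scale balance_const trace_solutionD(6)[OF ts] k 0) auto
  thus ?thesis
    by (rule balance_cong)
      (simp_all only: k0[OF r(1)] k0[OF r(2)], auto simp: kruzkov_flux_def sgn_if max_def abs_if field_simps)
qed

text \<open>As before, with the constants \<open>k\<close> and \<open>R\<close>, and \<open>f R = 0\<close>.\<close>

lemma below_balance:
  assumes ts: "trace_solution f R l u b" and k: "k \<in> {0..R}"
  shows "balance (\<lambda>p. max 0 (k - u p)) (\<lambda>p. if u p < k then f k - f (u p) else 0)
    (\<lambda>t. if b t < k then f k - f (b t) else 0)"
proof -
  note r = trace_solutionD(2)[OF ts] trace_solutionD(4)[OF ts]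
  have 0: "R \<in> {0..R}" using R_pos by simp
  have kR: "kruzkov_flux f R x = - f x" "\<bar>x - R\<bar> = R - x" if "x \<in> {0..R}" for x
    using that flux_zero by (cases "x = R", auto simp: kruzkov_flux_def sgn_if)
  have "balance (\<lambda>p. 1/2 * \<bar>u p - k\<bar> + 1/2 * \<bar>u p - R\<bar> + (k - R)/2)
     (\<lambda>p. 1/2 * kruzkov_flux f k (u p) + 1/2 * kruzkov_flux f R (u p) + f k/2)
     (\<lambda>t. 1/2 * kruzkov_flux f k (b t) + 1/2 * kruzkov_flux f R (b t) + f k/2)"
    by (intro balance_add balance_scale balance_const trace_solutionD(6)[OF ts] k 0) auto
  thus ?thesis
    by (rule balance_cong)
      (simp_all only: kR[OF r(1)] kR[OF r(2)], auto simp: kruzkov_flux_def sgn_if max_def abs_if field_simps)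
qed

lemma above_init:
  assumes ts: "trace_solution f R l u b" and k: "l \<le> k" "k \<in> {0..R}"
  shows "((\<lambda>t. LINT x:{-L..<0}|lborel. max 0 (u (t, x) - k)) \<longlongrightarrow> 0) (at_right 0)"
  by (rule energy_initially_zero[OF ts balanceD(1)[OF above_balance[OF ts k(2)]], of 0 0]) (use k in auto)

lemma below_init:
  assumes ts: "trace_solution f R l u b" and k: "k \<le> l" "k \<in> {0..R}"
  shows "((\<lambda>t. LINT x:{-L..<0}|lborel. max 0 (k - u (t, x))) \<longlongrightarrow> 0) (at_right 0)"
  by (rule energy_initially_zero[OF ts balanceD(1)[OF below_balance[OF ts k(2)]], of 0 0]) (use k in auto)

lemma finite_speed:
  obtains \<Lambda> where "0 \<le> \<Lambda>"
    "\<And>u k. u \<in> {0..R} \<Longrightarrow> k \<in> {0..R} \<Longrightarrow> \<bar>if k < u then f u - f k else 0\<bar> \<le> \<Lambda> * max 0 (u - k)"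
    "\<And>u k. u \<in> {0..R} \<Longrightarrow> k \<in> {0..R} \<Longrightarrow> \<bar>if u < k then f k - f u else 0\<bar> \<le> \<Lambda> * max 0 (k - u)"
    "\<And>u k. u \<in> {0..R} \<Longrightarrow> k \<in> {0..R} \<Longrightarrow> \<bar>kruzkov_flux f k u\<bar> \<le> \<Lambda> * \<bar>u - k\<bar>"
proof -
  obtain \<Lambda> where \<Lambda>: "0 < \<Lambda>" "\<And>u v. u \<in> {0..R} \<Longrightarrow> v \<in> {0..R} \<Longrightarrow> \<bar>f u - f v\<bar> \<le> \<Lambda> * \<bar>u - v\<bar>"
    using flux_lipschitz by blast
  show thesis
  proof (rule that[of \<Lambda>])
    show "0 \<le> \<Lambda>" using \<Lambda> by simp
    fix u k assume uk: "u \<in> {0..R}" "k \<in> {0..R}"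
    note L = \<Lambda>(2)[OF uk] \<Lambda>(2)[OF uk(2) uk(1)]
    show "\<bar>if k < u then f u - f k else 0\<bar> \<le> \<Lambda> * max 0 (u - k)"
      "\<bar>if u < k then f k - f u else 0\<bar> \<le> \<Lambda> * max 0 (k - u)"
      using L \<Lambda>(1) by (auto simp: max_def)
    show "\<bar>kruzkov_flux f k u\<bar> \<le> \<Lambda> * \<bar>u - k\<bar>"
      using L by (auto simp: kruzkov_flux_def sgn_if)
  qed
qed

text \<open>The part of \<open>u\<close> below \<open>k\<close> is absent initially. Where the trace is below \<open>k\<close> it would flow out at the rate
\<open>f k - f (b t)\<close>, positive since \<open>f\<close> increases up to the peak. As the total outflow is at most zero, this happens at almost no time.\<close>

lemma trace_at_least:
  assumes ts: "trace_solution f R l u b" and k: "0 \<le> k" "k \<le> l" "k \<le> peak"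
  shows "AE t in lborel. 0 < t \<longrightarrow> k \<le> b t"
proof -
  have kR: "k \<in> {0..R}" using k peak(1) by auto
  note bal = below_balance[OF ts kR]
  obtain \<Lambda> where \<Lambda>: "0 \<le> \<Lambda>"
    "\<And>u k. u \<in> {0..R} \<Longrightarrow> k \<in> {0..R} \<Longrightarrow> \<bar>if u < k then f k - f u else 0\<bar> \<le> \<Lambda> * max 0 (k - u)"
    using finite_speed by metis
  have pos: "0 < f k - f (b t)" if "b t < k" for t
    using flux_increasing[of "b t" k] that k trace_solutionD(4)[OF ts, of t] by auto
  have "AE t in lborel. 0 < t \<longrightarrow> (if b t < k then f k - f (b t) else 0) = 0"
  proof (rule nonneg_zero_of_integrals[OF balanceD(3)[OF bal]])
    show "AE t in lborel. 0 < t \<longrightarrow> 0 \<le> (if b t < k then f k - f (b t) else 0)"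
      using pos by (intro AE_I2) (auto intro: less_imp_le)
    fix T :: real assume T: "0 \<le> T"
    show "(LINT t:{0..T}|lborel. if b t < k then f k - f (b t) else 0) \<le> 0"
      by (rule boundary_flux_nonpos[OF bal _ _ \<Lambda>(1) below_init[OF ts k(2) kR] T])
        (use \<Lambda>(2)[OF trace_solutionD(2)[OF ts] kR] in auto)
  qed
  thus ?thesis
  proof eventually_elim
    fix t assume *: "0 < t \<longrightarrow> (if b t < k then f k - f (b t) else 0) = 0"
    show "0 < t \<longrightarrow> k \<le> b t" using * pos[of t] by (cases "b t < k") auto
  qed
qed

text \<open>The boundary can only make an incoming road more congested, so the maximum boundary flux at the trace is at least
that of the initial state.\<close>

lemma demand_not_reduced:
  assumes ts: "trace_solution f R l u b" and l: "0 \<le> l"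
  shows "AE t in lborel. 0 < t \<longrightarrow> omega_in f R l \<le> omega_in f R (b t)"
proof -
  have "AE t in lborel. 0 < t \<longrightarrow> min l peak \<le> b t"
    by (rule trace_at_least[OF ts]) (use l peak(1) in auto)
  thus ?thesis
  proof eventually_elim
    fix t assume *: "0 < t \<longrightarrow> min l peak \<le> b t"
    show "0 < t \<longrightarrow> omega_in f R l \<le> omega_in f R (b t)"
    proof
      assume "0 < t"
      hence "omega_in f R (min l peak) \<le> omega_in f R (b t)"
        using * l peak(1) by (intro omega_in_mono) auto
      thus "omega_in f R l \<le> omega_in f R (b t)" by (simp add: omega_in_eq)
    qed
  qed
qed

text \<open>A free road cannot send more cars than arrive on it. Pointwise in time this may fail, but it holds on average: the trace is at
least \<open>l\<close>, so that \<open>f (b t) - f l\<close> is the outflow of the part of \<open>u\<close> above \<open>l\<close>.\<close>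

lemma free_trace_flux:
  assumes ts: "trace_solution f R l u b" and l: "0 \<le> l" "l \<le> peak" and T: "0 \<le> T"
  shows "(LINT t:{0..T}|lborel. f (b t) - f l) \<le> 0"
proof -
  have lR: "l \<in> {0..R}" using l peak(1) by auto
  note bal = above_balance[OF ts lR]
  obtain \<Lambda> where \<Lambda>: "0 \<le> \<Lambda>"
    "\<And>u k. u \<in> {0..R} \<Longrightarrow> k \<in> {0..R} \<Longrightarrow> \<bar>if k < u then f u - f k else 0\<bar> \<le> \<Lambda> * max 0 (u - k)"
    using finite_speed by metis
  have fb: "(\<lambda>t. f (b t)) \<in> borel_measurable borel"
    using bounded_borel_compose[OF continuous_flux, of b] trace_solutionD[OF ts] by (auto simp: bounded_borel_def)
  have "(LINT t:{0..T}|lborel. f (b t) - f l) = (LINT t:{0..T}|lborel. if l < b t then f (b t) - f l else 0)"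
    unfolding set_lebesgue_integral_def
  proof (rule integral_cong_AE)
    show "AE t in lborel. indicator {0..T} t *\<^sub>R (f (b t) - f l) = indicator {0..T} t *\<^sub>R (if l < b t then f (b t) - f l else 0)"
      using trace_at_least[OF ts l(1) order_refl l(2)] AE_lborel_singleton[of "0::real"]
    proof eventually_elim
      fix t :: real assume "0 < t \<longrightarrow> l \<le> b t" "t \<noteq> 0"
      hence "t \<in> {0..T} \<Longrightarrow> l \<noteq> b t \<Longrightarrow> l < b t" by auto
      thus "indicator {0..T} t *\<^sub>R (f (b t) - f l) = indicator {0..T} t *\<^sub>R (if l < b t then f (b t) - f l else 0)"
        by (cases "l = b t") (auto simp: indicator_def)
    qed
  qed (use balanceD(3)[OF bal] fb in \<open>auto simp: bounded_borel_def\<close>)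
  also have "\<dots> \<le> 0"
    by (rule boundary_flux_nonpos[OF bal _ _ \<Lambda>(1) above_init[OF ts order_refl lR] T])
      (use \<Lambda>(2)[OF trace_solutionD(2)[OF ts] lR] in auto)
  finally show ?thesis .
qed

text \<open>With the boundary flux \<open>f l\<close> the outflow of \<open>\<bar>u - l\<bar>\<close> vanishes, whichever of the two states with this flux the trace is.\<close>

lemma solution_constant:
  assumes ts: "trace_solution f R l u b" and l: "l \<in> {0..R}"
    and F: "AE t in lborel. 0 < t \<longrightarrow> f (b t) = f l"
  shows "AE p in lborel. p \<in> half_plane \<longrightarrow> u p = l"
proof -
  note bal = trace_solutionD(6)[OF ts l]
  obtain \<Lambda> where \<Lambda>: "0 \<le> \<Lambda>"
    "\<And>u k. u \<in> {0..R} \<Longrightarrow> k \<in> {0..R} \<Longrightarrow> \<bar>kruzkov_flux f k u\<bar> \<le> \<Lambda> * \<bar>u - k\<bar>"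
    using finite_speed by metis
  have "AE p in lborel. p \<in> half_plane \<longrightarrow> \<bar>u p - l\<bar> = 0"
  proof (rule energy_vanishes[OF bal _ _ \<Lambda>(1) trace_solutionD(5)[OF ts]])
    show "AE t in lborel. 0 < t \<longrightarrow> 0 \<le> kruzkov_flux f l (b t)"
      using F by eventually_elim (auto simp: kruzkov_flux_def)
  qed (use \<Lambda>(2)[OF trace_solutionD(2)[OF ts] l] in auto)
  thus ?thesis by eventually_elim auto
qed

text \<open>The energy is \<open>\<bar>u - l\<bar>\<close> to the left of the shock and \<open>\<bar>u - r\<bar>\<close> to its right. The gluing condition along the shock says
that the graph of \<open>f\<close> lies above its chord, and the outflow of \<open>\<bar>u - r\<bar>\<close> vanishes because the trace has the flux of \<open>r\<close>.\<close>

lemma solution_shock: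
  assumes ts: "trace_solution f R l u b" and l: "0 \<le> l" "l < r" "r \<le> R" and less: "f r < f l"
    and F: "AE t in lborel. 0 < t \<longrightarrow> f (b t) = f r"
  shows "AE p in lborel. p \<in> half_plane \<longrightarrow> u p = (if snd p \<le> (f r - f l) / (r - l) * fst p then l else r)"
proof -
  define \<sigma> where "\<sigma> = (f r - f l) / (r - l)"
  have lr: "l \<in> {0..R}" "r \<in> {0..R}" using l by auto
  have \<sigma>: "\<sigma> < 0" "f r - f l = \<sigma> * (r - l)" using l less by (auto simp: \<sigma>_def divide_neg_pos)
  obtain \<Lambda> where \<Lambda>: "0 \<le> \<Lambda>"
    "\<And>u k. u \<in> {0..R} \<Longrightarrow> k \<in> {0..R} \<Longrightarrow> \<bar>kruzkov_flux f k u\<bar> \<le> \<Lambda> * \<bar>u - k\<bar>"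
    using finite_speed by metis
  have jump: "kruzkov_flux f r v - \<sigma> * \<bar>v - r\<bar> \<le> kruzkov_flux f l v - \<sigma> * \<bar>v - l\<bar>" if "v \<in> {0..R}" for v
  proof -
    consider "v \<le> l" | "r \<le> v" | "l < v" "v < r" by linarith
    thus ?thesis
    proof cases
      case 3
      have "\<sigma> * (v - l) < f v - f l" using flux_above_chord[of l v r] 3 l by (simp add: \<sigma>_def)
      thus ?thesis using 3 \<sigma>(2) by (simp add: kruzkov_flux_def algebra_simps)
    qed (use l \<sigma>(2) in \<open>auto simp: kruzkov_flux_def sgn_if abs_if algebra_simps\<close>)
  qed
  define E where "E = (\<lambda>p. if snd p \<le> \<sigma> * fst p then \<bar>u p - l\<bar> else \<bar>u p - r\<bar>)"
  define Q where "Q = (\<lambda>p. if snd p \<le> \<sigma> * fst p then kruzkov_flux f l (u p) else kruzkov_flux f r (u p))"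
  have bal: "balance E Q (\<lambda>t. kruzkov_flux f r (b t))"
    unfolding E_def Q_def
    by (rule balance_across_line[OF trace_solutionD(6)[OF ts lr(1)] trace_solutionD(6)[OF ts lr(2)] \<sigma>(1)])
      (rule jump[OF trace_solutionD(2)[OF ts]])
  have "AE p in lborel. p \<in> half_plane \<longrightarrow> E p = 0"
  proof (rule energy_vanishes[OF bal _ _ \<Lambda>(1)])
    show "0 \<le> E p" "\<bar>Q p\<bar> \<le> \<Lambda> * E p" for p
      using \<Lambda>(2)[OF trace_solutionD(2)[OF ts]] lr by (auto simp: E_def Q_def)
    show "AE t in lborel. 0 < t \<longrightarrow> 0 \<le> kruzkov_flux f r (b t)"
      using F by eventually_elim (auto simp: kruzkov_flux_def)
    show "((\<lambda>t. LINT x:{-L..<0}|lborel. E (t, x)) \<longlongrightarrow> 0) (at_right 0)" for L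
      by (rule energy_initially_zero[OF ts balanceD(1)[OF bal], of \<sigma> "r - l"])
        (use \<sigma> l in \<open>auto simp: E_def abs_if\<close>)
  qed
  thus ?thesis by eventually_elim (auto simp: E_def \<sigma>_def split: if_splits)
qed

lemma speed_negative: "peak < k \<Longrightarrow> k \<le> R \<Longrightarrow> speed k < 0"
proof -
  assume k: "peak < k" "k \<le> R"
  hence kR: "k \<in> {0..R}" using peak(1) by auto
  have "0 < f peak - f k" using flux_less_peak[OF kR] k by simp
  also have "\<dots> \<le> speed k * (peak - k)" by (rule flux_below_tangent[OF peak(1) kR])
  finally show "speed k < 0" using k by (simp add: zero_less_mult_iff)
qed

text \<open>A rarefaction wave is described by its level sets: the density passes through \<open>k\<close> on the characteristic \<open>x = f' k t\<close>. For each
\<open>k\<close> this follows by gluing the parts below and above \<open>k\<close> along that line, and the gluing condition says that the graph of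
\<open>f\<close> lies below its tangent at \<open>k\<close>.\<close>

lemma solution_rarefaction:
  assumes ts: "trace_solution f R l u b" and r: "peak \<le> r" "r < l" "l \<le> R"
    and F: "AE t in lborel. 0 < t \<longrightarrow> f (b t) = f r"
  shows "AE p in lborel. p \<in> half_plane \<longrightarrow> r \<le> u p \<and> u p \<le> l"
    and "k \<in> {r<..<l} \<Longrightarrow> AE p in lborel. p \<in> half_plane \<longrightarrow> (if snd p \<le> speed k * fst p then k \<le> u p else u p \<le> k)"
proof -
  have lr: "l \<in> {0..R}" "r \<in> {0..R}" using r peak(1) by auto
  obtain \<Lambda> where \<Lambda>: "0 \<le> \<Lambda>"
    "\<And>u k. u \<in> {0..R} \<Longrightarrow> k \<in> {0..R} \<Longrightarrow> \<bar>if k < u then f u - f k else 0\<bar> \<le> \<Lambda> * max 0 (u - k)"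
    "\<And>u k. u \<in> {0..R} \<Longrightarrow> k \<in> {0..R} \<Longrightarrow> \<bar>if u < k then f k - f u else 0\<bar> \<le> \<Lambda> * max 0 (k - u)"
    using finite_speed by metis
  have "AE p in lborel. p \<in> half_plane \<longrightarrow> max 0 (r - u p) = 0"
  proof (rule energy_vanishes[OF below_balance[OF ts lr(2)] _ _ \<Lambda>(1) below_init[OF ts _ lr(2)]])
    show "AE t in lborel. 0 < t \<longrightarrow> 0 \<le> (if b t < r then f r - f (b t) else 0)"
      using F by eventually_elim auto
  qed (use \<Lambda>(3)[OF trace_solutionD(2)[OF ts] lr(2)] r in auto)
  moreover have "AE p in lborel. p \<in> half_plane \<longrightarrow> max 0 (u p - l) = 0"
  proof (rule energy_vanishes[OF above_balance[OF ts lr(1)] _ _ \<Lambda>(1) above_init[OF ts _ lr(1)]])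
    have less: "f l < f r" using flux_decreasing r by auto
    show "AE t in lborel. 0 < t \<longrightarrow> 0 \<le> (if l < b t then f (b t) - f l else 0)"
      using F by eventually_elim (use less in auto)
  qed (use \<Lambda>(2)[OF trace_solutionD(2)[OF ts] lr(1)] in auto)
  ultimately show "AE p in lborel. p \<in> half_plane \<longrightarrow> r \<le> u p \<and> u p \<le> l"
    by eventually_elim (auto simp: max_def split: if_splits)
  assume k: "k \<in> {r<..<l}"
  hence kR: "k \<in> {0..R}" "peak < k" using r lr by auto
  have \<sigma>: "speed k < 0" using speed_negative kR by auto
  define E where "E = (\<lambda>p. if snd p \<le> speed k * fst p then max 0 (k - u p) else max 0 (u p - k))"
  define Q where "Q = (\<lambda>p. if snd p \<le> speed k * fst p then (if u p < k then f k - f (u p) else 0)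
    else (if k < u p then f (u p) - f k else 0))"
  have jump: "(if k < v then f v - f k else 0) - speed k * max 0 (v - k)
      \<le> (if v < k then f k - f v else 0) - speed k * max 0 (k - v)" if "v \<in> {0..R}" for v
    using flux_below_tangent[OF that kR(1)] by (auto simp: max_def algebra_simps)
  have bal: "balance E Q (\<lambda>t. if k < b t then f (b t) - f k else 0)"
    unfolding E_def Q_def
    by (rule balance_across_line[OF below_balance[OF ts kR(1)] above_balance[OF ts kR(1)] \<sigma>])
      (rule jump[OF trace_solutionD(2)[OF ts]])
  have "AE p in lborel. p \<in> half_plane \<longrightarrow> E p = 0"
  proof (rule energy_vanishes[OF bal _ _ \<Lambda>(1)])
    show "0 \<le> E p" "\<bar>Q p\<bar> \<le> \<Lambda> * E p" for p
      using \<Lambda>(2,3)[OF trace_solutionD(2)[OF ts] kR(1)] by (auto simp: E_def Q_def)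
    have less: "f k < f r" using flux_decreasing[of r k] r k by auto
    show "AE t in lborel. 0 < t \<longrightarrow> 0 \<le> (if k < b t then f (b t) - f k else 0)"
      using F by eventually_elim (use less in auto)
    show "((\<lambda>t. LINT x:{-L..<0}|lborel. E (t, x)) \<longlongrightarrow> 0) (at_right 0)" for L
      by (rule energy_initially_zero[OF ts balanceD(1)[OF bal], of "speed k" "l - k"])
        (use \<sigma> k in \<open>auto simp: E_def abs_if max_def\<close>)
  qed
  thus "AE p in lborel. p \<in> half_plane \<longrightarrow> (if snd p \<le> speed k * fst p then k \<le> u p else u p \<le> k)"
    by eventually_elim (auto simp: E_def max_def split: if_splits)
qed

end

section \<open>Entropy solutions up to the boundary\<close>

lemma kruzkov_flux_max_min: "kruzkov_flux f k u = f (max u k) - f (min u k)"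
  by (auto simp: kruzkov_flux_def sgn_if max_def min_def)

lemma continuous_kruzkov_flux:
  assumes "continuous_on {0..R} f" "k \<in> {0..R}"
  shows "continuous_on {0..R} (kruzkov_flux f k)"
  unfolding kruzkov_flux_max_min
  by (intro continuous_intros continuous_on_compose2[OF assms(1)]) (use assms(2) in auto)

text \<open>Extension by zero, which turns measurability on a domain into measurability on the plane.\<close>

definition extension :: "real set \<Rightarrow> (real \<Rightarrow> real \<Rightarrow> real) \<Rightarrow> real \<times> real \<Rightarrow> real" where
  "extension D u p = indicator ({0..} \<times> D) p *\<^sub>R u (fst p) (snd p)"

lemma extension_eq: "0 \<le> t \<Longrightarrow> x \<in> D \<Longrightarrow> extension D u (t, x) = u t x"
  by (simp add: extension_def)

lemma extension_borel: "entropy_solution f R D u0 u \<Longrightarrow> extension D u \<in> borel_measurable borel"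
  unfolding entropy_solution_def set_borel_measurable_def extension_def[abs_def] by simp

lemma extension_range: "entropy_solution f R D u0 u \<Longrightarrow> 0 \<le> R \<Longrightarrow> extension D u p \<in> {0..R}"
  unfolding entropy_solution_def extension_def by (auto simp: indicator_def)

abbreviation left_extension :: "(real \<Rightarrow> real \<Rightarrow> real) \<Rightarrow> real \<times> real \<Rightarrow> real" where
  "left_extension \<equiv> extension {..<0}"

lemma left_extension_half_plane: "p \<in> half_plane \<Longrightarrow> left_extension u p = u (fst p) (snd p)"
  by (auto simp: half_plane_def extension_def)

lemma left_extension_init:
  assumes sol: "entropy_solution f R {..<0} (\<lambda>x. l) \<rho>"
  shows "((\<lambda>t. LINT x:{-L..<0}|lborel. \<bar>left_extension \<rho> (t, x) - l\<bar>) \<longlongrightarrow> 0) (at_right 0)"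
proof -
  note m = extension_borel[OF sol]
  have e: "{..<0} \<inter> {-L..L} = {-L..<0}" by auto
  have "((\<lambda>t. LINT x:{..<0} \<inter> {-L..L}|lborel. \<bar>\<rho> t x - \<rho> 0 x\<bar>) \<longlongrightarrow> 0) (at 0 within {0..})"
    using sol unfolding entropy_solution_def by blast
  hence lim: "((\<lambda>t. LINT x:{-L..<0}|lborel. \<bar>\<rho> t x - \<rho> 0 x\<bar>) \<longlongrightarrow> 0) (at_right 0)"
    unfolding e by (rule tendsto_within_subset) auto
  have ini: "AE x in lborel. x < 0 \<longrightarrow> \<rho> 0 x = l"
    using sol unfolding entropy_solution_def by simp
  have [measurable]: "(\<lambda>x. left_extension \<rho> (t, x)) \<in> borel_measurable borel" for t
    by (rule measurable_compose[OF _ m]) simp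
  have "(LINT x:{-L..<0}|lborel. \<bar>\<rho> t x - \<rho> 0 x\<bar>) = (LINT x:{-L..<0}|lborel. \<bar>left_extension \<rho> (t, x) - l\<bar>)"
    if "0 < t" for t
  proof -
    have "(LINT x:{-L..<0}|lborel. \<bar>\<rho> t x - \<rho> 0 x\<bar>)
        = (LINT x:{-L..<0}|lborel. \<bar>left_extension \<rho> (t, x) - left_extension \<rho> (0, x)\<bar>)"
      by (intro set_lebesgue_integral_cong) (use that in \<open>auto simp: extension_eq\<close>)
    also have "\<dots> = (LINT x:{-L..<0}|lborel. \<bar>left_extension \<rho> (t, x) - l\<bar>)"
      unfolding set_lebesgue_integral_def
    proof (rule integral_cong_AE)
      show "AE x in lborel. indicator {-L..<0} x *\<^sub>R \<bar>left_extension \<rho> (t, x) - left_extension \<rho> (0, x)\<bar>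
          = indicator {-L..<0} x *\<^sub>R \<bar>left_extension \<rho> (t, x) - l\<bar>"
        using ini by eventually_elim (auto simp: indicator_def extension_eq)
    qed measurable
    finally show ?thesis .
  qed
  hence "\<forall>\<^sub>F t in at_right 0. (LINT x:{-L..<0}|lborel. \<bar>\<rho> t x - \<rho> 0 x\<bar>) = (LINT x:{-L..<0}|lborel. \<bar>left_extension \<rho> (t, x) - l\<bar>)"
    by (intro eventually_at_rightI[of 0 1]) auto
  from Lim_transform_eventually[OF lim this] show ?thesis .
qed

lemma kruzkov_ineq:
  assumes "entropy_solution f R D u0 u" "k \<in> {0..R}" "test_function D \<phi> \<phi>t \<phi>x"
  shows "0 \<le> (LINT p:{0<..} \<times> D|lborel. \<bar>u (fst p) (snd p) - k\<bar> * \<phi>t p + kruzkov_flux f k (u (fst p) (snd p)) * \<phi>x p)"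
  using assms unfolding entropy_solution_def kruzkov_flux_def by blast

lemma integral_step_deriv: "(LINT y|lborel. step_deriv y) = 1" "integrable lborel step_deriv"
proof -
  have i: "isCont step_deriv y" for y
    using continuous_step_deriv[of UNIV "\<lambda>y. y"] by (simp add: continuous_on_eq_continuous_at)
  have e: "(\<lambda>y. step_deriv y * indicator {0..1} y) = step_deriv"
  proof
    fix y show "step_deriv y * indicator {0..1} y = step_deriv y"
      by (cases "y \<le> 0 \<or> 1 \<le> y") auto
  qed
  have "has_bochner_integral lborel (\<lambda>y. step_deriv y * indicator {0..1} y) (step 1 - step 0)"
    by (rule has_bochner_integral_FTC_Icc_real) (auto intro: step_has_derivative i)
  thus "(LINT y|lborel. step_deriv y) = 1" "integrable lborel step_deriv"
    unfolding e by (auto simp: has_bochner_integral_iff)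
qed

text \<open>The derivative of a sharpening cutoff acts like a point mass at \<open>x = 0\<close>; substituting \<open>x = - (1 + y) / n\<close> makes the layer
a fixed interval, and dominated convergence needs a trace only at almost every time.\<close>

lemma boundary_layer_limit:
  fixes Q :: "real \<times> real \<Rightarrow> real"
  assumes Q: "bounded_borel Q" and \<phi>: "test_function UNIV \<phi> \<phi>t \<phi>x"
    and lim: "AE t in lborel. 0 < t \<longrightarrow> ((\<lambda>x. Q (t, x)) \<longlongrightarrow> G t) (at_left 0)" and G: "bounded_borel G"
  shows "(\<lambda>n. LINT p:half_plane|lborel. Q p * (\<phi> p * (real (Suc n) * step_deriv (- real (Suc n) * snd p - 1))))
    \<longlonglongrightarrow> (LINT t|lborel. G t * \<phi> (t, 0))"
proof -
  obtain CQ where CQ: "0 < CQ" "\<And>p. \<bar>Q p\<bar> \<le> CQ" and [measurable]: "Q \<in> borel_measurable borel"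
    using bounded_borelE[OF Q] by blast
  have [measurable]: "G \<in> borel_measurable borel" using G by (simp add: bounded_borel_def)
  note c = test_function_compactly_supported[OF \<phi>]
  obtain CP where CP: "0 < CP" "\<And>p. \<bar>\<phi> p\<bar> \<le> CP" and [measurable]: "\<phi> \<in> borel_measurable borel"
    using bounded_borelE[OF compactly_supported_bounded_borel[OF c(1)]] by blast
  obtain K where K: "compact K" "K \<subseteq> {0<..} \<times> UNIV" "\<And>p. p \<notin> K \<Longrightarrow> \<phi> p = 0"
    using test_function_support[OF \<phi>] by metis
  have "bounded (fst ` K)" using K(1) by (intro compact_imp_bounded compact_continuous_image continuous_intros)
  then obtain B where B: "\<And>p. p \<in> K \<Longrightarrow> \<bar>fst p\<bar> \<le> B" unfolding bounded_iff by auto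
  have z: "\<phi> (t, x) = 0" if "t \<le> 0 \<or> B < t" for t x
    using that K(2) B[of "(t, x)"] K(3)[of "(t, x)"] by force
  define g where "g = (\<lambda>n t y. Q (t, - (1 + y) / real (Suc n)) * \<phi> (t, - (1 + y) / real (Suc n)) * step_deriv y)"
  have m1: "(\<lambda>y. (t, - (1 + y) / real (Suc n))) \<in> borel_measurable borel" for t n
    by (intro borel_measurable_continuous_onI continuous_intros) auto
  have [measurable]: "(\<lambda>y. Q (t, - (1 + y) / real (Suc n))) \<in> borel_measurable borel"
    "(\<lambda>y. \<phi> (t, - (1 + y) / real (Suc n))) \<in> borel_measurable borel" for t n
    by (rule measurable_compose[OF m1], simp)+
  have gm [measurable]: "g n t \<in> borel_measurable borel" for n t unfolding g_def by measurable
  have gb: "\<bar>g n t y\<bar> \<le> CQ * CP * step_deriv y" for n t y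
    unfolding g_def abs_mult using CQ CP by (intro mult_mono) auto
  have inner: "(LINT x|lborel. indicator half_plane (t, x) *\<^sub>R
      (Q (t, x) * (\<phi> (t, x) * (real (Suc n) * step_deriv (- real (Suc n) * snd (t, x) - 1)))))
      = (LINT y|lborel. g n t y)" for n t
  proof -
    let ?F = "\<lambda>x. Q (t, x) * (\<phi> (t, x) * (real (Suc n) * step_deriv (- real (Suc n) * x - 1)))"
    have "(LINT x|lborel. indicator half_plane (t, x) *\<^sub>R
      (Q (t, x) * (\<phi> (t, x) * (real (Suc n) * step_deriv (- real (Suc n) * snd (t, x) - 1))))) = (LINT x|lborel. ?F x)"
    proof (rule Bochner_Integration.integral_cong[OF refl])
      fix x
      show "indicator half_plane (t, x) *\<^sub>R (Q (t, x) * (\<phi> (t, x) * (real (Suc n) * step_deriv (- real (Suc n) * snd (t, x) - 1)))) = ?F x"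
      proof (cases "(t, x) \<in> half_plane")
        case False
        hence "t \<le> 0 \<or> 0 \<le> x" by (auto simp: half_plane_def)
        hence "\<phi> (t, x) = 0 \<or> step_deriv (- real (Suc n) * x - 1) = 0"
        proof
          assume "0 \<le> x"
          hence "0 \<le> real (Suc n) * x" by simp
          thus ?thesis by (intro disjI2 step_deriv_low) linarith
        qed (use z in auto)
        thus ?thesis using False by auto
      qed simp
    qed
    also have "\<dots> = \<bar>- 1 / real (Suc n)\<bar> *\<^sub>R (LINT y|lborel. ?F (- 1 / real (Suc n) + (- 1 / real (Suc n)) * y))"
      by (rule lborel_integral_real_affine) auto
    also have "(\<lambda>y. ?F (- 1 / real (Suc n) + (- 1 / real (Suc n)) * y)) = (\<lambda>y. real (Suc n) * g n t y)"
    proof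
      fix y
      have 1: "- 1 / real (Suc n) + (- 1 / real (Suc n)) * y = - (1 + y) / real (Suc n)"
        by (simp add: field_simps)
      have 2: "- real (Suc n) * (- (1 + y) / real (Suc n)) - 1 = y" by (simp add: field_simps)
      show "?F (- 1 / real (Suc n) + (- 1 / real (Suc n)) * y) = real (Suc n) * g n t y"
        unfolding 1 2 g_def by (simp only: mult_ac)
    qed
    finally show ?thesis by simp
  qed
  have J: "(LINT p:half_plane|lborel. Q p * (\<phi> p * (real (Suc n) * step_deriv (- real (Suc n) * snd p - 1))))
      = (LINT t|lborel. LINT y|lborel. g n t y)" for n
  proof -
    have "continuous_on UNIV (\<lambda>p. \<phi> p * (real (Suc n) * step_deriv (- real (Suc n) * snd p - 1)))"
      by (intro continuous_intros test_function_continuous(1)[OF \<phi>])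
    hence "compactly_supported (\<lambda>p. \<phi> p * (real (Suc n) * step_deriv (- real (Suc n) * snd p - 1)))"
      unfolding compactly_supported_def using K by auto
    from set_integrable_half_plane[OF Q this half_plane_borel]
    show ?thesis unfolding set_lebesgue_integral_def set_integrable_def
      by (subst plane_integral_iterated(1)) (simp_all only: inner)
  qed
  have gi: "integrable lborel (g n t)" for n t
    by (rule Bochner_Integration.integrable_bound[OF integrable_mult_right[OF integral_step_deriv(2), of "CQ * CP"]])
      (use gb CQ CP in \<open>auto simp: abs_mult\<close>)
  show ?thesis unfolding J
  proof (rule integral_dominated_convergence[where w = "\<lambda>t. indicator {0..B} t *\<^sub>R (CQ * CP)"])
    show "integrable lborel (\<lambda>t. indicator {0..B} t *\<^sub>R (CQ * CP))" by (rule borel_integrable_compact) auto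
    have "(\<lambda>p::real\<times>real. (fst p, - (1 + snd p) / real (Suc n))) \<in> borel_measurable borel" for n
      by (intro borel_measurable_continuous_onI continuous_intros) auto
    hence "(\<lambda>p. Q (fst p, - (1 + snd p) / real (Suc n))) \<in> borel_measurable borel"
      "(\<lambda>p. \<phi> (fst p, - (1 + snd p) / real (Suc n))) \<in> borel_measurable borel" for n
      by (auto intro: measurable_compose)
    moreover have "(\<lambda>p::real\<times>real. step_deriv (snd p)) \<in> borel_measurable borel"
      by (intro borel_measurable_continuous_onI continuous_intros)
    ultimately have "(\<lambda>p. g n (fst p) (snd p)) \<in> borel_measurable borel" for n
      unfolding g_def by (intro borel_measurable_times)
    hence "(\<lambda>(t, y). g n t y) \<in> borel_measurable (lborel \<Otimes>\<^sub>M lborel)" for n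
      by (simp add: lborel_prod case_prod_unfold)
    thus "(\<lambda>t. LINT y|lborel. g n t y) \<in> borel_measurable lborel" for n
      by (rule lborel.borel_measurable_lebesgue_integral)
    show "(\<lambda>t. G t * \<phi> (t, 0)) \<in> borel_measurable lborel"
      using compactly_supported_bounded_borel[OF c(4)[of 0]] by (simp add: bounded_borel_def)
    show "AE t in lborel. norm (LINT y|lborel. g n t y) \<le> indicator {0..B} t *\<^sub>R (CQ * CP)" for n
    proof (rule AE_I2)
      fix t
      show "norm (LINT y|lborel. g n t y) \<le> indicator {0..B} t *\<^sub>R (CQ * CP)"
      proof (cases "t \<in> {0..B}")
        case True
        have "norm (LINT y|lborel. g n t y) \<le> (LINT y|lborel. CQ * CP * step_deriv y)"
          by (rule Bochner_Integration.integral_norm_bound_integral[OF gi integrable_mult_right[OF integral_step_deriv(2)]])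
            (use gb in auto)
        thus ?thesis using True integral_step_deriv by simp
      next
        case False
        hence "g n t y = 0" for y using z[of t] by (auto simp: g_def)
        thus ?thesis using False by simp
      qed
    qed
    show "AE t in lborel. (\<lambda>n. LINT y|lborel. g n t y) \<longlonglongrightarrow> G t * \<phi> (t, 0)"
      using lim
    proof eventually_elim
      fix t assume l: "0 < t \<longrightarrow> ((\<lambda>x. Q (t, x)) \<longlongrightarrow> G t) (at_left 0)"
      show "(\<lambda>n. LINT y|lborel. g n t y) \<longlonglongrightarrow> G t * \<phi> (t, 0)"
      proof (cases "0 < t")
        case False
        hence "g n t y = 0" "\<phi> (t, 0) = 0" for n y using z[of t] by (auto simp: g_def)
        thus ?thesis by simp
      next
        case True
        have "(\<lambda>n. LINT y|lborel. g n t y) \<longlonglongrightarrow> (LINT y|lborel. G t * \<phi> (t, 0) * step_deriv y)"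
        proof (rule integral_dominated_convergence[where w = "\<lambda>y. CQ * CP * step_deriv y"])
          show "integrable lborel (\<lambda>y. CQ * CP * step_deriv y)"
            by (rule integrable_mult_right[OF integral_step_deriv(2)])
          show "AE y in lborel. norm (g n t y) \<le> CQ * CP * step_deriv y" for n
            using gb by (intro AE_I2) auto
          show "AE y in lborel. (\<lambda>n. g n t y) \<longlonglongrightarrow> G t * \<phi> (t, 0) * step_deriv y"
          proof (rule AE_I2)
            fix y
            show "(\<lambda>n. g n t y) \<longlonglongrightarrow> G t * \<phi> (t, 0) * step_deriv y"
            proof (cases "0 < y")
              case False
              thus ?thesis by (simp add: g_def)
            next
              case y: True
              have s: "(\<lambda>n. - (1 + y) / real (Suc n)) \<longlonglongrightarrow> 0"
                using tendsto_mult[OF tendsto_const LIMSEQ_inverse_real_of_nat, of "- (1 + y)"]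
                by (simp add: divide_inverse)
              have "filterlim (\<lambda>n. - (1 + y) / real (Suc n)) (at_left 0) sequentially"
                unfolding filterlim_at using s y by (auto intro!: always_eventually divide_neg_pos)
              hence 1: "(\<lambda>n. Q (t, - (1 + y) / real (Suc n))) \<longlonglongrightarrow> G t"
                using filterlim_compose l True by blast
              have "isCont (\<lambda>x. \<phi> (t, x)) 0"
                using c(6)[of t] by (simp add: compactly_supported_def continuous_on_eq_continuous_at)
              from isCont_tendsto_compose[OF this s]
              have 2: "(\<lambda>n. \<phi> (t, - (1 + y) / real (Suc n))) \<longlonglongrightarrow> \<phi> (t, 0)" .
              show ?thesis unfolding g_def by (intro tendsto_intros 1 2)
            qed
          qed
        qed auto
        thus ?thesis using integral_step_deriv(1) by simp
      qed
    qed
  qed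
qed

text \<open>The cutoff \<open>step (- n x - 1)\<close> vanishes for \<open>x > - 1 / n\<close>, so that its product with a test function is supported inside the half-line.\<close>

lemma cutoff_limit:
  assumes F: "set_integrable lborel half_plane F"
  shows "(\<lambda>n. LINT p:half_plane|lborel. step (- real (Suc n) * snd p - 1) * F p) \<longlonglongrightarrow> (LINT p:half_plane|lborel. F p)"
proof -
  let ?Z = "\<lambda>p. indicator half_plane p *\<^sub>R F p"
  have lim: "(\<lambda>n. step (- real (Suc n) * snd p - 1)) \<longlonglongrightarrow> (if 0 \<le> snd p then 0 else 1)" for p :: "real \<times> real"
  proof -
    have "- real (Suc n) * snd p - 1 = real (Suc n) * (- snd p) - 1" for n by (simp add: algebra_simps)
    moreover have "(if 0 \<le> snd p then 0 else 1) = (if 0 < - snd p then 1 else 0 :: real)" by auto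
    ultimately show ?thesis using step_scaled_limit[of 1 "- snd p"] by (simp only: zero_le_one)
  qed
  have "(\<lambda>n. LINT p|lborel. (1 - step (- real (Suc n) * snd p - 1)) * 0 + step (- real (Suc n) * snd p - 1) * ?Z p)
      \<longlonglongrightarrow> (LINT p|lborel. (if 0 \<le> snd p then 0 else ?Z p))"
    using F unfolding set_integrable_def by (intro blend_limit lim AE_I2) auto
  moreover have "(if 0 \<le> snd p then 0 else ?Z p) = ?Z p" for p by (auto simp: half_plane_def indicator_def)
  ultimately show ?thesis by (simp add: set_lebesgue_integral_def mult.left_commute)
qed

text \<open>Entropy solutions are tested only inside the half-line. Multiply a test function by a cutoff near \<open>x = 0\<close> and let the
cutoff become sharp: the derivative of the cutoff turns into the entropy flux at the trace.\<close>

lemma entropy_trace_solution: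
  assumes sol: "entropy_solution f R {..<0} (\<lambda>x. l) \<rho>" and R: "0 \<le> R" and f: "continuous_on {0..R} f"
    and tr: "AE t in lborel. 0 < t \<longrightarrow> (\<exists>\<beta>. (\<rho> t \<longlongrightarrow> \<beta>) (at_left 0))"
  obtains b where "trace_solution f R l (left_extension \<rho>) b"
    "AE t in lborel. 0 < t \<longrightarrow> (\<rho> t \<longlongrightarrow> b t) (at_left 0)"
proof -
  define u where "u = left_extension \<rho>"
  have um [measurable]: "u \<in> borel_measurable borel" and uR: "u p \<in> {0..R}" for p
    unfolding u_def by (rule extension_borel[OF sol], rule extension_range[OF sol R])
  define b where "b = (\<lambda>t. max 0 (min R (lim (\<lambda>n. u (t, - 1 / real (Suc n))))))"
  have [measurable]: "(\<lambda>t. u (t, - 1 / real (Suc n))) \<in> borel_measurable borel" for n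
    by (rule measurable_compose[OF _ um]) simp
  have bm: "b \<in> borel_measurable borel" unfolding b_def by measurable
  have bR: "b t \<in> {0..R}" for t using R by (simp add: b_def)
  have u_lim: "((\<lambda>x. u (t, x)) \<longlongrightarrow> \<beta>) (at_left 0)" if "0 < t" "(\<rho> t \<longlongrightarrow> \<beta>) (at_left 0)" for t \<beta>
  proof (rule Lim_transform_eventually[OF that(2)])
    show "\<forall>\<^sub>F x in at_left 0. \<rho> t x = u (t, x)"
      by (rule eventually_at_leftI[of "-1"]) (use that in \<open>auto simp: u_def extension_eq\<close>)
  qed
  have b_eq: "b t = \<beta>" if "0 < t" "(\<rho> t \<longlongrightarrow> \<beta>) (at_left 0)" for t \<beta>
  proof -
    have "(\<lambda>n. - 1 / real (Suc n)) \<longlonglongrightarrow> 0"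
      using tendsto_mult[OF tendsto_const LIMSEQ_inverse_real_of_nat, of "- 1"]
      by (simp add: divide_inverse)
    hence "filterlim (\<lambda>n. - 1 / real (Suc n)) (at_left 0) sequentially"
      unfolding filterlim_at by (auto intro!: always_eventually divide_neg_pos)
    from filterlim_compose[OF u_lim[OF that] this]
    have l: "(\<lambda>n. u (t, - 1 / real (Suc n))) \<longlonglongrightarrow> \<beta>" .
    have "\<beta> \<in> {0..R}" using closed_sequentially[OF closed_real_atLeastAtMost _ l] uR by blast
    thus ?thesis unfolding b_def limI[OF l] by simp
  qed
  have lim: "AE t in lborel. 0 < t \<longrightarrow> (\<rho> t \<longlongrightarrow> b t) (at_left 0)"
    using tr by eventually_elim (use b_eq in blast)
  have "balance (\<lambda>p. \<bar>u p - k\<bar>) (\<lambda>p. kruzkov_flux f k (u p)) (\<lambda>t. kruzkov_flux f k (b t))"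
    if k: "k \<in> {0..R}" for k
  proof -
    define E Q G where "E = (\<lambda>p. \<bar>u p - k\<bar>)" and "Q = (\<lambda>p. kruzkov_flux f k (u p))"
      and "G = (\<lambda>t. kruzkov_flux f k (b t))"
    note ck = continuous_kruzkov_flux[OF f k]
    have bE: "bounded_borel E" unfolding E_def
      by (rule bounded_borel_compose[OF _ um uR, of "\<lambda>v. \<bar>v - k\<bar>"]) (intro continuous_intros)
    have bQ: "bounded_borel Q" unfolding Q_def by (rule bounded_borel_compose[OF ck um uR])
    have bG: "bounded_borel G" unfolding G_def by (rule bounded_borel_compose[OF ck bm bR])
    have limQ: "AE t in lborel. 0 < t \<longrightarrow> ((\<lambda>x. Q (t, x)) \<longlongrightarrow> G t) (at_left 0)"
      using lim
    proof eventually_elim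
      fix t assume *: "0 < t \<longrightarrow> (\<rho> t \<longlongrightarrow> b t) (at_left 0)"
      show "0 < t \<longrightarrow> ((\<lambda>x. Q (t, x)) \<longlongrightarrow> G t) (at_left 0)"
        using continuous_on_tendsto_compose[OF ck u_lim bR] * uR unfolding Q_def G_def by simp
    qed
    have "(LINT t|lborel. G t * \<phi> (t, 0)) \<le> (LINT p:half_plane|lborel. E p * \<phi>t p + Q p * \<phi>x p)"
      if \<phi>: "test_function UNIV \<phi> \<phi>t \<phi>x" for \<phi> \<phi>t \<phi>x
    proof (rule LIMSEQ_le)
      note c = test_function_compactly_supported[OF \<phi>]
      obtain K where K: "compact K" "K \<subseteq> {0<..} \<times> UNIV" "\<And>p. p \<notin> K \<Longrightarrow> \<phi> p = 0"
        using test_function_support[OF \<phi>] by metis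
      define w w' where "w = (\<lambda>n p. step (0 * fst p + (- real (Suc n)) * snd p + - 1))"
        and "w' = (\<lambda>n p. step_deriv (0 * fst p + (- real (Suc n)) * snd p + - 1))"
      have ws: "w n p = step (- real (Suc n) * snd p - 1)" "w' n p = step_deriv (- real (Suc n) * snd p - 1)" for n p
        by (simp_all add: w_def w'_def)
      let ?A = "\<lambda>n. LINT p:half_plane|lborel. Q p * (\<phi> p * (real (Suc n) * w' n p))"
      let ?B = "\<lambda>n. LINT p:half_plane|lborel. w n p * (E p * \<phi>t p + Q p * \<phi>x p)"
      show "?A \<longlonglongrightarrow> (LINT t|lborel. G t * \<phi> (t, 0))"
        unfolding ws by (rule boundary_layer_limit[OF bQ \<phi> limQ bG])
      show "?B \<longlonglongrightarrow> (LINT p:half_plane|lborel. E p * \<phi>t p + Q p * \<phi>x p)"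
        unfolding ws
        by (rule cutoff_limit) (intro set_integral_add(1) set_integrable_half_plane bE bQ c half_plane_borel)
      have "?A n \<le> ?B n" for n
      proof -
        have weight: "c1_weight (w n) (\<lambda>p. 0 * w' n p) (\<lambda>p. (- real (Suc n)) * w' n p)"
          unfolding w_def w'_def by (rule c1_weight_step)
        define K' where "K' = K \<inter> {p. snd p \<le> - 1 / real (Suc n)}"
        have "closed {p::real \<times> real. snd p \<le> - 1 / real (Suc n)}" by (intro closed_Collect_le continuous_intros)
        hence K': "compact K'" unfolding K'_def using K(1) by (rule compact_Int_closed[rotated])
        have neg: "- 1 / real (Suc n) < 0" by simp
        have K'2: "K' \<subseteq> {0<..} \<times> {..<0}"
        proof
          fix p assume p: "p \<in> K'"
          hence "0 < fst p" using K(2) by (auto simp: K'_def)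
          moreover have "snd p < 0" using p neg unfolding K'_def by (simp only: Int_iff mem_Collect_eq) linarith
          ultimately show "p \<in> {0<..} \<times> {..<0}" by (simp add: mem_Times_iff)
        qed
        have zero: "\<phi> p * w n p = 0" if "p \<notin> K'" for p
        proof (cases "p \<in> K")
          case True
          hence "- 1 / real (Suc n) < snd p" using that by (simp add: K'_def)
          hence "- real (Suc n) * snd p - 1 \<le> 0" by (simp add: field_simps)
          thus ?thesis by (simp add: ws)
        qed (use K(3) in simp)
        have \<phi>': "test_function {..<0} (\<lambda>p. \<phi> p * w n p) (\<lambda>p. \<phi>t p * w n p + \<phi> p * (0 * w' n p))
          (\<lambda>p. \<phi>x p * w n p + \<phi> p * ((- real (Suc n)) * w' n p))"
          unfolding test_function_iff
          using c1_weight_mult[OF _ weight, of \<phi> \<phi>t \<phi>x] \<phi> K' K'2 zero unfolding test_function_iff by blast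
        have cont: "continuous_on UNIV (w n)" "continuous_on UNIV (w' n)"
          unfolding w_def w'_def by (intro continuous_intros)+
        have cs: "compactly_supported (\<lambda>p. \<phi> p * (real (Suc n) * w' n p))"
          "compactly_supported (\<lambda>p. w n p * \<phi>t p)" "compactly_supported (\<lambda>p. w n p * \<phi>x p)"
          using c(1,2,3) cont unfolding compactly_supported_def by (auto intro!: continuous_intros)
        have iA: "set_integrable lborel half_plane (\<lambda>p. Q p * (\<phi> p * (real (Suc n) * w' n p)))"
          and iB: "set_integrable lborel half_plane (\<lambda>p. E p * (w n p * \<phi>t p) + Q p * (w n p * \<phi>x p))"
          by (intro set_integral_add(1) set_integrable_half_plane bE bQ cs half_plane_borel)+
        have "0 \<le> (LINT p:half_plane|lborel. \<bar>\<rho> (fst p) (snd p) - k\<bar> * (\<phi>t p * w n p + \<phi> p * (0 * w' n p))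
          + kruzkov_flux f k (\<rho> (fst p) (snd p)) * (\<phi>x p * w n p + \<phi> p * ((- real (Suc n)) * w' n p)))"
          using kruzkov_ineq[OF sol k \<phi>'] unfolding half_plane_def .
        also have "\<dots> = (LINT p:half_plane|lborel. (E p * (w n p * \<phi>t p) + Q p * (w n p * \<phi>x p))
          - Q p * (\<phi> p * (real (Suc n) * w' n p)))"
          by (intro set_lebesgue_integral_cong)
            (auto simp: E_def Q_def u_def left_extension_half_plane ring_distribs)
        also have "\<dots> = ?B n - ?A n"
          by (subst set_integral_diff(2)[OF iB iA]) (simp add: ring_distribs mult_ac)
        finally show ?thesis by simp
      qed
      thus "\<exists>N. \<forall>n\<ge>N. ?A n \<le> ?B n" by blast
    qed
    thus ?thesis using bE bQ bG unfolding balance_def E_def Q_def G_def by auto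
  qed
  hence "trace_solution f R l u b"
    unfolding trace_solution_def using um uR bm bR left_extension_init[OF sol] by (simp add: u_def)
  thus thesis using that lim by (simp add: u_def)
qed

section \<open>Uniqueness on incoming roads\<close>

lemma AE_lborel_interval_ex:
  fixes a b :: real
  assumes "AE s in lborel. P s" "a < b"
  obtains s where "a < s" "s < b" "P s"
proof -
  have "\<exists>s. a < s \<and> s < b \<and> P s"
  proof (rule ccontr)
    assume n: "\<not> ?thesis"
    have "AE s in lborel. s \<notin> {a<..<b}"
      using assms(1) by eventually_elim (use n in auto)
    hence "emeasure lborel {a<..<b} = 0"
      by (subst (asm) AE_iff_measurable[of "{a<..<b}"]) auto
    thus False using \<open>a < b\<close> by simp
  qed
  thus thesis using that by blast
qed

lemma AE_plane:
  assumes "{p :: real \<times> real. P p} \<in> sets borel" "AE t in lborel. AE x in lborel. P (t, x)"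
  shows "AE p in lborel. P p"
proof -
  have "{p \<in> space (lborel \<Otimes>\<^sub>M lborel). P p} \<in> sets (lborel \<Otimes>\<^sub>M lborel)"
    unfolding lborel_prod using assms(1) by simp
  from lborel_pair.AE_pair_measure[OF this assms(2)] show ?thesis unfolding lborel_prod .
qed

lemma entropy_solution_restrict:
  assumes sol: "entropy_solution f R UNIV u0 u" and D: "D \<in> sets borel"
    and u0: "\<And>x. x \<in> D \<Longrightarrow> u0 x = u0' x" and f: "continuous_on {0..R} f" and R: "0 \<le> R"
  shows "entropy_solution f R D u0' u"
proof -
  define U where "U = extension UNIV u"
  have U [measurable]: "U \<in> borel_measurable borel" and UR: "U p \<in> {0..R}" for p
    unfolding U_def by (rule extension_borel[OF sol], rule extension_range[OF sol R])
  have Us [measurable]: "(\<lambda>x. U (t, x)) \<in> borel_measurable borel" for t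
    by (rule measurable_compose[OF _ U]) simp
  have 1: "set_borel_measurable lborel ({0..} \<times> D) (\<lambda>p. u (fst p) (snd p))"
  proof -
    have "{0::real..} \<times> D \<in> sets borel"
      using D unfolding borel_prod[symmetric] by (auto intro!: pair_measureI)
    hence "(\<lambda>p. indicator ({0..} \<times> D) p *\<^sub>R U p) \<in> borel_measurable borel"
      by (intro borel_measurable_scaleR borel_measurable_indicator U)
    also have "(\<lambda>p. indicator ({0..} \<times> D) p *\<^sub>R U p) = (\<lambda>p. indicator ({0..} \<times> D) p *\<^sub>R u (fst p) (snd p))"
      by (auto simp: fun_eq_iff U_def extension_eq indicator_def)
    finally show ?thesis unfolding set_borel_measurable_def by simp
  qed
  have 2: "((\<lambda>t. LINT x:D \<inter> {-L..L}|lborel. \<bar>u t x - u t0 x\<bar>) \<longlongrightarrow> 0) (at t0 within {0..})" if "0 \<le> t0" for t0 L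
  proof (rule tendsto_sandwich[where f = "\<lambda>_. 0" and h = "\<lambda>t. LINT x:{-L..L}|lborel. \<bar>u t x - u t0 x\<bar>"])
    have "\<forall>L. ((\<lambda>t. LINT x:UNIV \<inter> {-L..L}|lborel. \<bar>u t x - u t0 x\<bar>) \<longlongrightarrow> 0) (at t0 within {0..})"
      using sol that unfolding entropy_solution_def by blast
    thus "((\<lambda>t. LINT x:{-L..L}|lborel. \<bar>u t x - u t0 x\<bar>) \<longlongrightarrow> 0) (at t0 within {0..})" by simp
    show "\<forall>\<^sub>F t in at t0 within {0..}. 0 \<le> (LINT x:D \<inter> {-L..L}|lborel. \<bar>u t x - u t0 x\<bar>)"
      unfolding set_lebesgue_integral_def
      by (intro always_eventually allI Bochner_Integration.integral_nonneg) simp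
    show "\<forall>\<^sub>F t in at t0 within {0..}. (LINT x:D \<inter> {-L..L}|lborel. \<bar>u t x - u t0 x\<bar>) \<le> (LINT x:{-L..L}|lborel. \<bar>u t x - u t0 x\<bar>)"
      unfolding eventually_at_filter
    proof (intro always_eventually allI impI)
      fix t :: real assume t: "t \<noteq> t0" "t \<in> {0..}"
      have bb: "bounded_borel (\<lambda>x. \<bar>U (t, x) - U (t0, x)\<bar>)" unfolding bounded_borel_def
      proof (intro conjI exI allI)
        show "\<bar>\<bar>U (t, x) - U (t0, x)\<bar>\<bar> \<le> R" for x using UR[of "(t, x)"] UR[of "(t0, x)"] by auto
      qed measurable
      have "set_integrable lborel {-L..L} (\<lambda>x. \<bar>U (t, x) - U (t0, x)\<bar>)"
        by (rule set_integrable_bounded[OF bb]) auto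
      hence "integrable lborel (\<lambda>x. indicator {-L..L} x *\<^sub>R \<bar>u t x - u t0 x\<bar>)"
        unfolding set_integrable_def
        by (rule back_subst[of "integrable lborel"]) (use t that in \<open>auto simp: U_def extension_eq fun_eq_iff\<close>)
      thus "(LINT x:D \<inter> {-L..L}|lborel. \<bar>u t x - u t0 x\<bar>) \<le> (LINT x:{-L..L}|lborel. \<bar>u t x - u t0 x\<bar>)"
        unfolding set_lebesgue_integral_def
        by (intro integral_mono') (auto simp: indicator_def)
    qed
  qed simp
  have 3: "AE x in lborel. x \<in> D \<longrightarrow> u 0 x = u0' x"
  proof -
    have "AE x in lborel. u 0 x = u0 x" using sol unfolding entropy_solution_def by simp
    thus ?thesis by eventually_elim (use u0 in auto)
  qed
  have 4: "0 \<le> (LINT p:{0<..} \<times> D|lborel. \<bar>u (fst p) (snd p) - k\<bar> * \<phi>t p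
      + sgn (u (fst p) (snd p) - k) * (f (u (fst p) (snd p)) - f k) * \<phi>x p)"
    if k: "k \<in> {0..R}" and \<phi>: "test_function D \<phi> \<phi>t \<phi>x" for k \<phi> \<phi>t \<phi>x
  proof -
    have \<phi>': "test_function UNIV \<phi> \<phi>t \<phi>x" using \<phi> unfolding test_function_def by blast
    obtain K where K: "K \<subseteq> {0<..} \<times> D" "\<And>p. p \<notin> K \<Longrightarrow> \<phi>t p = 0" "\<And>p. p \<notin> K \<Longrightarrow> \<phi>x p = 0"
      using test_function_support[OF \<phi>] by metis
    have "0 \<le> (LINT p:{0<..} \<times> UNIV|lborel. \<bar>u (fst p) (snd p) - k\<bar> * \<phi>t p
      + sgn (u (fst p) (snd p) - k) * (f (u (fst p) (snd p)) - f k) * \<phi>x p)"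
      using sol k \<phi>' unfolding entropy_solution_def by blast
    also have "\<dots> = (LINT p:{0<..} \<times> D|lborel. \<bar>u (fst p) (snd p) - k\<bar> * \<phi>t p
      + sgn (u (fst p) (snd p) - k) * (f (u (fst p) (snd p)) - f k) * \<phi>x p)"
      unfolding set_lebesgue_integral_def
    proof (rule Bochner_Integration.integral_cong[OF refl])
      fix p :: "real \<times> real"
      show "indicator ({0<..} \<times> UNIV) p *\<^sub>R (\<bar>u (fst p) (snd p) - k\<bar> * \<phi>t p
          + sgn (u (fst p) (snd p) - k) * (f (u (fst p) (snd p)) - f k) * \<phi>x p)
        = indicator ({0<..} \<times> D) p *\<^sub>R (\<bar>u (fst p) (snd p) - k\<bar> * \<phi>t p
          + sgn (u (fst p) (snd p) - k) * (f (u (fst p) (snd p)) - f k) * \<phi>x p)"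
        using K by (cases "p \<in> K") (auto simp: indicator_def)
    qed
    finally show ?thesis .
  qed
  have 0: "\<And>t x. 0 \<le> t \<Longrightarrow> u t x \<in> {0..R}"
    using sol unfolding entropy_solution_def by blast
  show ?thesis
    unfolding entropy_solution_def
    by (intro conjI allI ballI impI) (rule 1 0 2 3 4; assumption)+
qed

text \<open>Agreement almost everywhere in the plane gives agreement at almost every time, and continuity in time with values in
\<open>L\<^sup>1\<close> on bounded intervals extends it to every time.\<close>

lemma solutions_agree_at_each_time:
  assumes u: "entropy_solution f R {..<0} u0 u" and v: "entropy_solution g S {..<0} v0 v"
    and R: "0 \<le> R" "0 \<le> S" and t: "0 < t"
    and agree: "AE p in lborel. p \<in> half_plane \<longrightarrow> left_extension u p = left_extension v p"
  shows "AE x in lborel. x < 0 \<longrightarrow> u t x = v t x"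
proof -
  define U V where "U = left_extension u" and "V = left_extension v"
  have [measurable]: "U \<in> borel_measurable borel" "V \<in> borel_measurable borel"
    unfolding U_def V_def by (rule extension_borel[OF u], rule extension_borel[OF v])
  have UV: "U p \<in> {0..R}" "V p \<in> {0..S}" for p
    unfolding U_def V_def by (rule extension_range[OF u R(1)], rule extension_range[OF v R(2)])
  have [measurable]: "(\<lambda>x. U (s, x)) \<in> borel_measurable borel" "(\<lambda>x. V (s, x)) \<in> borel_measurable borel" for s
    by (rule measurable_compose[where N = borel], simp, simp)+
  have e: "{..<0} \<inter> {-L..L} = {-L..<0}" for L :: real by auto
  have lim: "((\<lambda>s. LINT x:{-L..<0}|lborel. \<bar>u s x - u t x\<bar>) \<longlongrightarrow> 0) (at t within {0..})"
    "((\<lambda>s. LINT x:{-L..<0}|lborel. \<bar>v s x - v t x\<bar>) \<longlongrightarrow> 0) (at t within {0..})" for L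
    using u v t unfolding entropy_solution_def e[symmetric] by (meson less_imp_le)+
  have good: "AE s in lborel. AE x in lborel. (s, x) \<in> half_plane \<longrightarrow> U (s, x) = V (s, x)"
  proof -
    have "AE p in lborel \<Otimes>\<^sub>M lborel. p \<in> half_plane \<longrightarrow> U p = V p"
      using agree unfolding lborel_prod U_def V_def .
    from lborel_pair.AE_pair[OF this] show ?thesis .
  qed
  have zero: "AE x in lborel. x \<in> {-L..<0} \<longrightarrow> U (t, x) = V (t, x)" for L
  proof -
    have bb: "bounded_borel (\<lambda>x. \<bar>A (s, x) - B (s', x)\<bar>)"
      if "A \<in> {U, V}" "B \<in> {U, V}" for A B s s'
    proof -
      have "\<bar>\<bar>A (s, x) - B (s', x)\<bar>\<bar> \<le> R + S" for x
        using that UV[of "(s, x)"] UV[of "(s', x)"] R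
        by (elim insertE emptyE) (simp_all only: atLeastAtMost_iff, linarith+)
      thus ?thesis unfolding bounded_borel_def using that by (intro conjI exI[of _ "R + S"]) auto
    qed
    have int: "integrable lborel (\<lambda>x. indicator {-L..<0} x *\<^sub>R \<bar>A (s, x) - B (s', x)\<bar>)"
      if "A \<in> {U, V}" "B \<in> {U, V}" for A B s s'
      using set_integrable_bounded[OF bb[OF that], of "{-L..<0}"] by (simp add: set_integrable_def)
    have "(LINT x|lborel. indicator {-L..<0} x *\<^sub>R \<bar>U (t, x) - V (t, x)\<bar>) \<le> 0"
    proof (rule field_le_epsilon)
      fix \<epsilon> :: real assume "0 < \<epsilon>"
      hence "\<forall>\<^sub>F s in at t within {0..}. (LINT x:{-L..<0}|lborel. \<bar>u s x - u t x\<bar>) < \<epsilon> / 2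
          \<and> (LINT x:{-L..<0}|lborel. \<bar>v s x - v t x\<bar>) < \<epsilon> / 2"
        by (intro eventually_conj order_tendstoD(2)[OF lim(1)] order_tendstoD(2)[OF lim(2)]) auto
      then obtain d where d: "0 < d" "\<And>s. 0 \<le> s \<Longrightarrow> s \<noteq> t \<Longrightarrow> dist s t < d \<Longrightarrow>
          (LINT x:{-L..<0}|lborel. \<bar>u s x - u t x\<bar>) < \<epsilon> / 2 \<and> (LINT x:{-L..<0}|lborel. \<bar>v s x - v t x\<bar>) < \<epsilon> / 2"
        unfolding eventually_at by auto
      obtain s where s: "t < s" "s < t + d" "AE x in lborel. (s, x) \<in> half_plane \<longrightarrow> U (s, x) = V (s, x)"
        by (rule AE_lborel_interval_ex[OF good, of t "t + d"]) (use d in auto)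
      have s0: "0 < s" using s t by simp
      have "(LINT x|lborel. indicator {-L..<0} x *\<^sub>R \<bar>U (t, x) - V (t, x)\<bar>)
          \<le> (LINT x|lborel. indicator {-L..<0} x *\<^sub>R \<bar>U (s, x) - U (t, x)\<bar> + indicator {-L..<0} x *\<^sub>R \<bar>V (s, x) - V (t, x)\<bar>)"
      proof (rule integral_mono_AE)
        show "AE x in lborel. indicator {-L..<0} x *\<^sub>R \<bar>U (t, x) - V (t, x)\<bar>
            \<le> indicator {-L..<0} x *\<^sub>R \<bar>U (s, x) - U (t, x)\<bar> + indicator {-L..<0} x *\<^sub>R \<bar>V (s, x) - V (t, x)\<bar>"
          using s(3) by eventually_elim (use s0 in \<open>auto simp: indicator_def half_plane_def\<close>)
      qed (intro Bochner_Integration.integrable_add int insertI1 insertI2)+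
      also have "\<dots> = (LINT x|lborel. indicator {-L..<0} x *\<^sub>R \<bar>U (s, x) - U (t, x)\<bar>)
          + (LINT x|lborel. indicator {-L..<0} x *\<^sub>R \<bar>V (s, x) - V (t, x)\<bar>)"
        by (rule Bochner_Integration.integral_add) (intro int insertI1 insertI2)+
      also have "(LINT x|lborel. indicator {-L..<0} x *\<^sub>R \<bar>U (s, x) - U (t, x)\<bar>) = (LINT x:{-L..<0}|lborel. \<bar>u s x - u t x\<bar>)"
        unfolding set_lebesgue_integral_def using s0 t
        by (intro Bochner_Integration.integral_cong) (auto simp: indicator_def U_def extension_eq)
      also have "(LINT x|lborel. indicator {-L..<0} x *\<^sub>R \<bar>V (s, x) - V (t, x)\<bar>) = (LINT x:{-L..<0}|lborel. \<bar>v s x - v t x\<bar>)"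
        unfolding set_lebesgue_integral_def using s0 t
        by (intro Bochner_Integration.integral_cong) (auto simp: indicator_def V_def extension_eq)
      finally show "(LINT x|lborel. indicator {-L..<0} x *\<^sub>R \<bar>U (t, x) - V (t, x)\<bar>) \<le> 0 + \<epsilon>"
        using d(2)[of s] s s0 by (simp add: dist_real_def)
    qed
    moreover have "0 \<le> (LINT x|lborel. indicator {-L..<0} x *\<^sub>R \<bar>U (t, x) - V (t, x)\<bar>)"
      by (intro Bochner_Integration.integral_nonneg) simp
    ultimately have "(LINT x|lborel. indicator {-L..<0} x *\<^sub>R \<bar>U (t, x) - V (t, x)\<bar>) = 0" by (rule antisym)
    hence "AE x in lborel. indicator {-L..<0} x *\<^sub>R \<bar>U (t, x) - V (t, x)\<bar> = 0"
      by (subst (asm) integral_nonneg_eq_0_iff_AE[OF int]) auto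
    thus ?thesis by eventually_elim (auto simp: indicator_def)
  qed
  have "AE x in lborel. \<forall>n. x \<in> {- real n..<0} \<longrightarrow> U (t, x) = V (t, x)"
    by (intro AE_all_countable[THEN iffD2] allI zero)
  thus ?thesis
  proof eventually_elim
    fix x :: real assume *: "\<forall>n. x \<in> {- real n..<0} \<longrightarrow> U (t, x) = V (t, x)"
    obtain n where "- x \<le> real n" using real_arch_simple by blast
    hence "x < 0 \<longrightarrow> x \<in> {- real n..<0}" by auto
    thus "x < 0 \<longrightarrow> u t x = v t x" using * t by (auto simp: U_def V_def extension_eq)
  qed
qed

text \<open>A whole-line solution that is constantly \<open>r\<close> for \<open>x > 0\<close> restricts to a solution with trace \<open>r\<close>: the contribution of \<open>x > 0\<close> to
Kruzkov's inequality is the integral of a constant state, which equals minus the boundary term.\<close>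

lemma whole_line_trace_solution:
  assumes sol: "entropy_solution f R UNIV (riemann_data l r) v" and R: "0 \<le> R" and f: "continuous_on {0..R} f"
    and r: "r \<in> {0..R}" and right: "\<And>t. 0 < t \<Longrightarrow> AE x in lborel. 0 < x \<longrightarrow> v t x = r"
  shows "trace_solution f R l (left_extension v) (\<lambda>_. r)"
proof -
  have solH: "entropy_solution f R {..<0} (\<lambda>_. l) v"
    by (rule entropy_solution_restrict[OF sol _ _ f R]) (auto simp: riemann_data_def)
  note pe = extension_borel[OF solH] extension_range[OF solH R] left_extension_init[OF solH]
  define V where "V = extension UNIV v"
  have s: "{0<..} \<times> UNIV \<in> sets (borel :: (real \<times> real) measure)"
    by (auto simp: borel_prod[symmetric])
  have Vm [measurable]: "V \<in> borel_measurable borel" and VR: "V p \<in> {0..R}" for p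
    unfolding V_def by (rule extension_borel[OF sol], rule extension_range[OF sol R])
  have AEr: "AE p in lborel. 0 < fst p \<longrightarrow> 0 < snd p \<longrightarrow> V p = r"
  proof -
    have "{p :: real \<times> real. 0 < fst p \<longrightarrow> 0 < snd p \<longrightarrow> V p = r} \<in> sets borel"
    proof -
      have "{p \<in> space borel. 0 < fst p \<longrightarrow> 0 < snd p \<longrightarrow> V p = r} \<in> sets (borel :: (real \<times> real) measure)"
        by measurable
      thus ?thesis by simp
    qed
    moreover have "AE t in lborel. AE x in lborel. 0 < fst (t, x) \<longrightarrow> 0 < snd (t, x) \<longrightarrow> V (t, x) = r"
    proof (rule AE_I2)
      fix t :: real
      show "AE x in lborel. 0 < fst (t, x) \<longrightarrow> 0 < snd (t, x) \<longrightarrow> V (t, x) = r"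
      proof (cases "0 < t")
        case True
        from right[OF this] show ?thesis by eventually_elim (use True in \<open>auto simp: V_def extension_eq\<close>)
      qed simp
    qed
    ultimately have "AE p in lborel. 0 < fst p \<longrightarrow> 0 < snd p \<longrightarrow> V p = r"
      by (rule AE_plane)
    thus ?thesis .
  qed
  have AE0: "AE p :: real \<times> real in lborel. snd p \<noteq> 0"
  proof -
    have "AE t in lborel. AE x in lborel. snd (t::real, x) \<noteq> (0::real)"
      using AE_lborel_singleton[of "0::real"] by simp
    moreover have "{p :: real \<times> real. snd p \<noteq> 0} \<in> sets borel"
      by (intro borel_open open_Collect_neq continuous_intros)
    ultimately show ?thesis by (intro AE_plane)
  qed
  have "balance (\<lambda>p. \<bar>left_extension v p - k\<bar>) (\<lambda>p. kruzkov_flux f k (left_extension v p)) (\<lambda>t. kruzkov_flux f k r)"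
    if k: "k \<in> {0..R}" for k
  proof -
    note ck = continuous_kruzkov_flux[OF f k]
    define E Q where "E = (\<lambda>p. \<bar>V p - k\<bar>)" and "Q = (\<lambda>p. kruzkov_flux f k (V p))"
    have ca: "continuous_on {0..R} (\<lambda>v. \<bar>v - k\<bar>)" by (intro continuous_intros)
    have bE: "bounded_borel E" unfolding E_def by (rule bounded_borel_compose[OF ca Vm VR])
    have bQ: "bounded_borel Q" unfolding Q_def by (rule bounded_borel_compose[OF ck Vm VR])
    have bE': "bounded_borel (\<lambda>p. \<bar>left_extension v p - k\<bar>)" by (rule bounded_borel_compose[OF ca pe(1,2)])
    have bQ': "bounded_borel (\<lambda>p. kruzkov_flux f k (left_extension v p))" by (rule bounded_borel_compose[OF ck pe(1,2)])
    have "(LINT t|lborel. kruzkov_flux f k r * \<phi> (t, 0)) \<le> (LINT p:half_plane|lborel.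
        \<bar>left_extension v p - k\<bar> * \<phi>t p + kruzkov_flux f k (left_extension v p) * \<phi>x p)"
      if \<phi>: "test_function UNIV \<phi> \<phi>t \<phi>x" for \<phi> \<phi>t \<phi>x
    proof -
      note c = test_function_compactly_supported[OF \<phi>]
      let ?r = "\<lambda>p. \<bar>r - k\<bar> * \<phi>t p + kruzkov_flux f k r * \<phi>x p"
      let ?F = "\<lambda>p. E p * \<phi>t p + Q p * \<phi>x p"
      have iF: "set_integrable lborel A ?F" if "A \<in> sets borel" for A
        by (intro set_integral_add(1) set_integrable_half_plane bE bQ c that)
      have ir: "set_integrable lborel A ?r" if "A \<in> sets borel" for A
        by (intro set_integral_add(1) set_integrable_half_plane bounded_borel_const c that)
      have rint: "(LINT p:A|lborel. ?r p) = \<bar>r - k\<bar> * (LINT p:A|lborel. \<phi>t p) + kruzkov_flux f k r * (LINT p:A|lborel. \<phi>x p)"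
        if "A \<in> sets borel" for A
        by (subst set_integral_add(2)) (auto intro!: set_integrable_half_plane[OF bounded_borel_const c(2) that]
            set_integrable_half_plane[OF bounded_borel_const c(3) that])
      have "0 \<le> (LINT p:{0<..} \<times> UNIV|lborel. \<bar>v (fst p) (snd p) - k\<bar> * \<phi>t p + kruzkov_flux f k (v (fst p) (snd p)) * \<phi>x p)"
        by (rule kruzkov_ineq[OF sol k \<phi>])
      also have "\<dots> = (LINT p:{0<..} \<times> UNIV|lborel. ?F p)"
        by (intro set_lebesgue_integral_cong) (use s in \<open>auto simp: E_def Q_def V_def extension_eq\<close>)
      (* For x > 0 the integrand is that of the constant state r; write this part as the whole line minus x < 0. *)
      also have "\<dots> = (LINT p|lborel. indicator half_plane p *\<^sub>R ?F p
          + (indicator ({0<..} \<times> UNIV) p *\<^sub>R ?r p - indicator half_plane p *\<^sub>R ?r p))"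
        unfolding set_lebesgue_integral_def
      proof (rule integral_cong_AE)
        show "AE p in lborel. indicator ({0<..} \<times> UNIV) p *\<^sub>R ?F p = indicator half_plane p *\<^sub>R ?F p
          + (indicator ({0<..} \<times> UNIV) p *\<^sub>R ?r p - indicator half_plane p *\<^sub>R ?r p)"
          using AEr AE0
        proof eventually_elim
          fix p :: "real \<times> real"
          assume p: "0 < fst p \<longrightarrow> 0 < snd p \<longrightarrow> V p = r" "snd p \<noteq> 0"
          consider "p \<in> half_plane" | "0 < fst p" "0 < snd p" | "fst p \<le> 0"
            using p(2) by (fastforce simp: half_plane_def mem_Times_iff)
          thus "indicator ({0<..} \<times> UNIV) p *\<^sub>R ?F p = indicator half_plane p *\<^sub>R ?F p
            + (indicator ({0<..} \<times> UNIV) p *\<^sub>R ?r p - indicator half_plane p *\<^sub>R ?r p)"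
          proof cases
            case 1
            hence "p \<in> {0<..} \<times> UNIV" by (auto simp: half_plane_def)
            thus ?thesis using 1 by simp
          next
            case 2
            hence "p \<in> {0<..} \<times> UNIV" "p \<notin> half_plane" "V p = r" using p by (auto simp: half_plane_def mem_Times_iff)
            thus ?thesis by (simp add: E_def Q_def)
          next
            case 3
            hence "p \<notin> {0<..} \<times> UNIV" "p \<notin> half_plane" by (auto simp: half_plane_def mem_Times_iff)
            thus ?thesis by simp
          qed
        qed
        show "(\<lambda>p. indicator ({0<..} \<times> UNIV) p *\<^sub>R ?F p) \<in> borel_measurable lborel"
          using iF[OF s] unfolding set_integrable_def by (rule borel_measurable_integrable)
        show "(\<lambda>p. indicator half_plane p *\<^sub>R ?F p
          + (indicator ({0<..} \<times> UNIV) p *\<^sub>R ?r p - indicator half_plane p *\<^sub>R ?r p)) \<in> borel_measurable lborel"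
          using iF[OF half_plane_borel] ir[OF half_plane_borel] ir[OF s] unfolding set_integrable_def
          by (intro borel_measurable_add borel_measurable_diff) (rule borel_measurable_integrable, assumption)+
      qed
      also have "\<dots> = (LINT p:half_plane|lborel. ?F p) + ((LINT p:{0<..} \<times> UNIV|lborel. ?r p) - (LINT p:half_plane|lborel. ?r p))"
        using iF[OF half_plane_borel] ir[OF half_plane_borel] ir[OF s]
        unfolding set_integrable_def set_lebesgue_integral_def by simp
      also have "\<dots> = (LINT p:half_plane|lborel. ?F p) - kruzkov_flux f k r * (LINT t|lborel. \<phi> (t, 0))"
        unfolding rint[OF s] rint[OF half_plane_borel] test_function_integrals[OF \<phi>] by simp
      also have "(LINT p:half_plane|lborel. ?F p) = (LINT p:half_plane|lborel.
        \<bar>left_extension v p - k\<bar> * \<phi>t p + kruzkov_flux f k (left_extension v p) * \<phi>x p)"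
        by (intro set_lebesgue_integral_cong)
          (auto simp: E_def Q_def V_def extension_eq left_extension_half_plane half_plane_def[symmetric], auto simp: half_plane_def extension_eq)
      finally show ?thesis by simp
    qed
    thus ?thesis using bE' bQ' unfolding balance_def by auto
  qed
  thus ?thesis unfolding trace_solution_def using pe r by auto
qed

context concave_road begin

text \<open>A solution on an incoming road is determined by its initial state and its boundary flux, without knowledge of its
trace. It is compared with the profile of the limit Riemann solver, which either is constant or arises from a whole-line solution and then has
a constant trace \<open>r\<close>; the cases \<open>l < r\<close> and \<open>r < l\<close> lead to a shock and to a rarefaction wave.\<close>

lemma incoming_unique:
  assumes sol: "entropy_solution f R {..<0} (\<lambda>x. l) \<rho>" and l: "l \<in> {0..R}"
    and tr: "AE t in lborel. 0 < t \<longrightarrow> (\<exists>\<beta>. (\<rho> t \<longlongrightarrow> \<beta>) (at_left 0) \<and> f \<beta> = F)"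
    and prof: "lrs_profile_in f R l F \<rho>h" and t: "0 < t"
  shows "AE x in lborel. x < 0 \<longrightarrow> \<rho> t x = \<rho>h t x"
proof -
  have R: "0 \<le> R" using R_pos by simp
  have tr': "AE t in lborel. 0 < t \<longrightarrow> (\<exists>\<beta>. (\<rho> t \<longlongrightarrow> \<beta>) (at_left 0))"
    using tr by eventually_elim blast
  obtain b where ts: "trace_solution f R l (left_extension \<rho>) b"
    and b: "AE t in lborel. 0 < t \<longrightarrow> (\<rho> t \<longlongrightarrow> b t) (at_left 0)"
    using entropy_trace_solution[OF sol R continuous_flux tr'] by blast
  have Fb: "AE t in lborel. 0 < t \<longrightarrow> f (b t) = F"
    using tr b
  proof eventually_elim
    fix t assume "0 < t \<longrightarrow> (\<exists>\<beta>. (\<rho> t \<longlongrightarrow> \<beta>) (at_left 0) \<and> f \<beta> = F)" "0 < t \<longrightarrow> (\<rho> t \<longlongrightarrow> b t) (at_left 0)"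
    thus "0 < t \<longrightarrow> f (b t) = F" using tendsto_unique[of "at_left (0::real)" "\<rho> t"] by auto
  qed
  show ?thesis
  proof (cases "F = f l")
    case True
    have AEl: "AE p in lborel. p \<in> half_plane \<longrightarrow> left_extension \<rho> p = l"
      by (rule solution_constant[OF ts l]) (use Fb True in simp)
    have triv: "entropy_solution f R {..<0} (\<lambda>x. l) (\<lambda>t x. l)"
    proof -
      have "0 \<le> (LINT p:{0<..} \<times> {..<0}|lborel. \<bar>l - k\<bar> * \<phi>t p + sgn (l - k) * (f l - f k) * \<phi>x p)"
        if \<phi>: "test_function {..<0} \<phi> \<phi>t \<phi>x" for k \<phi> \<phi>t \<phi>x
      proof -
        have \<phi>': "test_function UNIV \<phi> \<phi>t \<phi>x" using \<phi> unfolding test_function_def by blast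
        have "\<phi> (t, 0) = 0" for t using \<phi> unfolding test_function_def by force
        thus ?thesis
          using balanceD(4)[OF balance_const[of "\<bar>l - k\<bar>" "sgn (l - k) * (f l - f k)"] \<phi>']
          by (simp add: half_plane_def)
      qed
      moreover have "(\<lambda>p. indicator ({0..} \<times> {..<0}) p * l) \<in> borel_measurable (borel :: (real \<times> real) measure)"
        by (intro borel_measurable_times borel_measurable_indicator) (auto simp: borel_prod[symmetric])
      ultimately show ?thesis using l unfolding entropy_solution_def set_borel_measurable_def
        by (auto simp: set_lebesgue_integral_def)
    qed
    have "AE x in lborel. x < 0 \<longrightarrow> \<rho> t x = (\<lambda>t x. l) t x"
    proof (rule solutions_agree_at_each_time[OF sol triv R R t])
      show "AE p in lborel. p \<in> half_plane \<longrightarrow> left_extension \<rho> p = left_extension (\<lambda>t x. l) p"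
        using AEl by eventually_elim (auto simp: extension_eq half_plane_def)
    qed
    moreover have "\<rho>h t x = l" if "x < 0" for x
      using prof True t that unfolding lrs_profile_in_def by simp
    ultimately show ?thesis by simp
  next
    case False
    then obtain r v where r: "r \<in> {0..R}" "f r = F" and v: "entropy_solution f R UNIV (riemann_data l r) v"
      and right: "\<And>t. 0 < t \<Longrightarrow> AE x in lborel. 0 < x \<longrightarrow> v t x = r"
      and \<rho>h: "\<And>t x. 0 < t \<Longrightarrow> x < 0 \<Longrightarrow> \<rho>h t x = v t x"
      using prof unfolding lrs_profile_in_def by auto
    have ts': "trace_solution f R l (left_extension v) (\<lambda>_. r)"
      by (rule whole_line_trace_solution[OF v R continuous_flux r(1) right])
    have solH: "entropy_solution f R {..<0} (\<lambda>_. l) v"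
      by (rule entropy_solution_restrict[OF v _ _ continuous_flux R]) (auto simp: riemann_data_def)
    have Fr: "AE t in lborel. 0 < t \<longrightarrow> f ((\<lambda>_. r) t) = f r" by simp
    have Fb': "AE t in lborel. 0 < t \<longrightarrow> f (b t) = f r" using Fb r by simp
    have "AE p in lborel. p \<in> half_plane \<longrightarrow> left_extension \<rho> p = left_extension v p"
    proof (cases "l < r")
      case True
      obtain \<Lambda> where \<Lambda>: "0 \<le> \<Lambda>"
        "\<And>u k. u \<in> {0..R} \<Longrightarrow> k \<in> {0..R} \<Longrightarrow> \<bar>kruzkov_flux f k u\<bar> \<le> \<Lambda> * \<bar>u - k\<bar>"
        using finite_speed by metis
      (* The distance to l vanishes initially, so that its outflow f r - f l is at most zero. *)
      have "(LINT t:{0..1::real}|lborel. kruzkov_flux f l r) \<le> 0"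
        by (rule boundary_flux_nonpos[OF trace_solutionD(6)[OF ts' l] _ _ \<Lambda>(1) trace_solutionD(5)[OF ts']])
          (use \<Lambda>(2)[OF trace_solutionD(2)[OF ts'] l] in auto)
      hence "f r \<le> f l" using True by (simp add: kruzkov_flux_def set_lebesgue_integral_def)
      hence less: "f r < f l" using False r by simp
      have lr: "0 \<le> l" "r \<le> R" using l r by auto
      from solution_shock[OF ts lr(1) True lr(2) less Fb'] solution_shock[OF ts' lr(1) True lr(2) less Fr]
      show ?thesis by eventually_elim auto
    next
      case nl: False
      hence rl: "r < l" using False r by (cases "r = l") auto
      (* The trace r is at least min l peak; as r < l, it is congested. *)
      have "AE t :: real in lborel. 0 < t \<longrightarrow> min l peak \<le> (\<lambda>_. r) t"
        by (rule trace_at_least[OF ts']) (use l peak(1) in auto)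
      then obtain s :: real where "0 < s" "0 < s \<longrightarrow> min l peak \<le> (\<lambda>_. r) s"
        by (rule AE_lborel_interval_ex[of _ 0 1]) auto
      hence pr: "peak \<le> r" using rl by auto
      have lR: "l \<le> R" using l by simp
      note A = solution_rarefaction[OF ts pr rl lR Fb'] and B = solution_rarefaction[OF ts' pr rl lR Fr]
      have AEq: "AE p in lborel. p \<in> half_plane \<longrightarrow> k \<in> {r<..<l} \<longrightarrow>
          (if snd p \<le> speed k * fst p then k \<le> left_extension \<rho> p \<and> k \<le> left_extension v p
           else left_extension \<rho> p \<le> k \<and> left_extension v p \<le> k)" for k
      proof (cases "k \<in> {r<..<l}")
        case True
        from A(2)[OF True] B(2)[OF True] show ?thesis by eventually_elim auto
      next
        case False
        thus ?thesis by (intro AE_I2) blast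
      qed
      (* Two different densities would be separated by a rational level set. *)
      have "AE p in lborel. \<forall>q::rat. p \<in> half_plane \<longrightarrow> of_rat q \<in> {r<..<l} \<longrightarrow>
          (if snd p \<le> speed (of_rat q) * fst p then of_rat q \<le> left_extension \<rho> p \<and> of_rat q \<le> left_extension v p
           else left_extension \<rho> p \<le> of_rat q \<and> left_extension v p \<le> of_rat q)"
        by (intro AE_all_countable[THEN iffD2] allI AEq)
      with A(1) B(1) show ?thesis
      proof eventually_elim
        fix p :: "real \<times> real"
        let ?u = "left_extension \<rho> p" and ?v = "left_extension v p"
        assume 1: "p \<in> half_plane \<longrightarrow> r \<le> ?u \<and> ?u \<le> l" "p \<in> half_plane \<longrightarrow> r \<le> ?v \<and> ?v \<le> l"
          and 2: "\<forall>q::rat. p \<in> half_plane \<longrightarrow> of_rat q \<in> {r<..<l} \<longrightarrow>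
            (if snd p \<le> speed (of_rat q) * fst p then of_rat q \<le> ?u \<and> of_rat q \<le> ?v else ?u \<le> of_rat q \<and> ?v \<le> of_rat q)"
        show "p \<in> half_plane \<longrightarrow> ?u = ?v"
        proof (intro impI, rule ccontr)
          assume p: "p \<in> half_plane" and "?u \<noteq> ?v"
          hence "min ?u ?v < max ?u ?v" by auto
          then obtain q :: rat where q: "min ?u ?v < of_rat q" "of_rat q < max ?u ?v" using of_rat_dense by blast
          have "of_rat q \<in> {r<..<l}" using q 1 p by (auto simp: min_def max_def split: if_splits)
          with 2 p have "if snd p \<le> speed (of_rat q) * fst p then of_rat q \<le> ?u \<and> of_rat q \<le> ?v else ?u \<le> of_rat q \<and> ?v \<le> of_rat q"
            by blast
          thus False using q by (auto simp: min_def max_def split: if_splits)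
        qed
      qed
    qed
    hence "AE x in lborel. x < 0 \<longrightarrow> \<rho> t x = v t x"
      by (rule solutions_agree_at_each_time[OF sol solH R R t])
    thus ?thesis by eventually_elim (use \<rho>h t in auto)
  qed
qed

end

section \<open>Self-similar solutions of Riemann problems\<close>

text \<open>Stated for Lipschitz fluxes: Osher's formula treats shocks, rarefaction waves and their combinations alike.\<close>

locale riemann_problem =
  fixes f :: "real \<Rightarrow> real" and R \<Lambda> l r :: real
  assumes f_cont: "continuous_on {0..R} f" and \<Lambda>_nonneg: "0 \<le> \<Lambda>"
    and f_lip: "\<And>u v. u \<in> {0..R} \<Longrightarrow> v \<in> {0..R} \<Longrightarrow> \<bar>f u - f v\<bar> \<le> \<Lambda> * \<bar>u - v\<bar>"
    and l: "l \<in> {0..R}" and r: "r \<in> {0..R}"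
begin

text \<open>Increasing and decreasing data call for minima and for maxima; the sign makes both a minimum.\<close>

definition orient :: real where "orient = (if l \<le> r then 1 else - 1)"

abbreviation states :: "real set" where "states \<equiv> {min l r..max l r}"

text \<open>Osher's formula: the value of the self-similar solution on the ray \<open>x = \<xi> t\<close> minimises \<open>f u - \<xi> u\<close> between the two states if
these increase, and maximises it otherwise. The choice among several minimisers concerns only the countably many rays carrying a shock.\<close>

definition fan :: "real \<Rightarrow> real" where
  "fan \<xi> = (SOME u. u \<in> states \<and> (\<forall>v\<in>states. orient * (f u - \<xi> * u) \<le> orient * (f v - \<xi> * v)))"

lemma states_sub: "v \<in> states \<Longrightarrow> v \<in> {0..R}"
  using l r by (auto simp: min_def max_def split: if_splits)

lemma fan: "fan \<xi> \<in> states" "v \<in> states \<Longrightarrow> orient * (f (fan \<xi>) - \<xi> * fan \<xi>) \<le> orient * (f v - \<xi> * v)"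
proof -
  have "continuous_on states f" by (rule continuous_on_subset[OF f_cont]) (use states_sub in blast)
  hence "continuous_on states (\<lambda>u. orient * (f u - \<xi> * u))" by (intro continuous_intros)
  hence "\<exists>u\<in>states. \<forall>v\<in>states. orient * (f u - \<xi> * u) \<le> orient * (f v - \<xi> * v)"
    by (intro continuous_attains_inf) (auto simp: min_def max_def)
  hence "\<exists>u. u \<in> states \<and> (\<forall>v\<in>states. orient * (f u - \<xi> * u) \<le> orient * (f v - \<xi> * v))" by blast
  from someI_ex[OF this]
  show "fan \<xi> \<in> states" "v \<in> states \<Longrightarrow> orient * (f (fan \<xi>) - \<xi> * fan \<xi>) \<le> orient * (f v - \<xi> * v)"
    unfolding fan_def by blast+
qed

lemma fan_range: "fan \<xi> \<in> {0..R}" by (rule states_sub[OF fan(1)])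

lemma orient_cases: "orient = 1 \<and> l \<le> r \<or> orient = - 1 \<and> r < l"
  by (auto simp: orient_def)

text \<open>Add the two inequalities that express minimality of each value against the other.\<close>

lemma fan_mono: "\<xi> \<le> \<eta> \<Longrightarrow> orient * fan \<xi> \<le> orient * fan \<eta>"
proof (cases "\<xi> = \<eta>")
  case False
  assume "\<xi> \<le> \<eta>"
  hence less: "0 < \<eta> - \<xi>" using False by simp
  have "orient * (f (fan \<xi>) - \<xi> * fan \<xi>) + orient * (f (fan \<eta>) - \<eta> * fan \<eta>)
      \<le> orient * (f (fan \<eta>) - \<xi> * fan \<eta>) + orient * (f (fan \<xi>) - \<eta> * fan \<xi>)"
    by (intro add_mono fan)
  hence "0 \<le> (\<eta> - \<xi>) * (orient * fan \<eta> - orient * fan \<xi>)" by (simp add: algebra_simps)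
  thus ?thesis using less by (simp add: zero_le_mult_iff)
qed simp

text \<open>Beyond the maximal speed \<open>\<Lambda>\<close> the linear term dominates the flux.\<close>

lemma fan_left: assumes "\<xi> < - \<Lambda>" shows "fan \<xi> = l"
proof -
  have s: "l \<in> states" by auto
  have "\<bar>f l - f (fan \<xi>)\<bar> \<le> \<Lambda> * \<bar>l - fan \<xi>\<bar>" by (rule f_lip[OF l fan_range])
  moreover have "orient * (f (fan \<xi>) - \<xi> * fan \<xi>) \<le> orient * (f l - \<xi> * l)" by (rule fan(2)[OF s])
  ultimately have "(- \<xi> - \<Lambda>) * \<bar>fan \<xi> - l\<bar> \<le> 0"
    using fan(1)[of \<xi>] orient_cases by (auto simp: algebra_simps abs_if split: if_splits)
  thus ?thesis using assms by (simp add: mult_le_0_iff)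
qed

lemma fan_right: assumes "\<Lambda> < \<xi>" shows "fan \<xi> = r"
proof -
  have s: "r \<in> states" by auto
  have "\<bar>f r - f (fan \<xi>)\<bar> \<le> \<Lambda> * \<bar>r - fan \<xi>\<bar>" by (rule f_lip[OF r fan_range])
  moreover have "orient * (f (fan \<xi>) - \<xi> * fan \<xi>) \<le> orient * (f r - \<xi> * r)" by (rule fan(2)[OF s])
  ultimately have "(\<xi> - \<Lambda>) * \<bar>fan \<xi> - r\<bar> \<le> 0"
    using fan(1)[of \<xi>] orient_cases by (auto simp: algebra_simps abs_if split: if_splits)
  thus ?thesis using assms by (simp add: mult_le_0_iff)
qed

lemma orient_orient: "orient * (orient * x) = x" by (auto simp: orient_def)

lemma fan_borel [measurable]: "fan \<in> borel_measurable borel"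
proof -
  have "mono (\<lambda>\<xi>. orient * fan \<xi>)" by (rule monoI) (rule fan_mono)
  hence "(\<lambda>\<xi>. orient * fan \<xi>) \<in> borel_measurable borel" by (rule borel_measurable_mono)
  hence "(\<lambda>\<xi>. orient * (orient * fan \<xi>)) \<in> borel_measurable borel" by simp
  thus ?thesis unfolding orient_orient .
qed

lemma fan_discontinuities: "countable {\<xi>. \<not> isCont fan \<xi>}"
proof -
  have "mono (\<lambda>\<xi>. orient * fan \<xi>)" by (rule monoI) (rule fan_mono)
  hence "countable {\<xi>. \<not> isCont (\<lambda>\<xi>. orient * fan \<xi>) \<xi>}" by (rule mono_ctble_discont)
  moreover have "isCont (\<lambda>\<xi>. orient * fan \<xi>) \<xi> \<Longrightarrow> isCont fan \<xi>" for \<xi>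
    using isCont_mult[OF continuous_const, of \<xi> "\<lambda>\<xi>. orient * fan \<xi>" orient] by (simp add: orient_orient)
  hence "{\<xi>. \<not> isCont fan \<xi>} \<subseteq> {\<xi>. \<not> isCont (\<lambda>\<xi>. orient * fan \<xi>) \<xi>}" by blast
  ultimately show ?thesis by (rule countable_subset[rotated])
qed

lemma AE_fan_continuous: "t \<noteq> 0 \<Longrightarrow> AE x in lborel. isCont fan (x / t)"
proof -
  assume t: "t \<noteq> 0"
  have "countable ((\<lambda>\<xi>. \<xi> * t) ` {\<xi>. \<not> isCont fan \<xi>})" using fan_discontinuities by simp
  hence "AE x in lborel. x \<notin> (\<lambda>\<xi>. \<xi> * t) ` {\<xi>. \<not> isCont fan \<xi>}"
    by (intro AE_not_in countable_imp_null_set_lborel)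
  thus ?thesis
  proof eventually_elim
    fix x assume x: "x \<notin> (\<lambda>\<xi>. \<xi> * t) ` {\<xi>. \<not> isCont fan \<xi>}"
    have "x = x / t * t" using t by simp
    thus "isCont fan (x / t)" using x by blast
  qed
qed

definition fan_entropy :: "real \<Rightarrow> real \<Rightarrow> real" where
  "fan_entropy k \<xi> = \<bar>fan \<xi> - k\<bar>"

text \<open>For a function of \<open>\<xi> = x / t\<close> alone, the entropy inequality reads \<open>(q - \<xi> N)' \<le> - N\<close> with entropy \<open>N\<close> and entropy flux \<open>q\<close>.\<close>

definition fan_flux :: "real \<Rightarrow> real \<Rightarrow> real" where
  "fan_flux k \<xi> = kruzkov_flux f k (fan \<xi>) - \<xi> * fan_entropy k \<xi>"

text \<open>A lower bound for the entropy on \<open>[\<xi> - h, \<xi>]\<close>, which tends to the entropy at \<open>\<xi>\<close> where the fan is continuous. It vanishes if the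
fan crosses \<open>k\<close> in this interval.\<close>

definition fan_rate :: "real \<Rightarrow> real \<Rightarrow> real \<Rightarrow> real" where
  "fan_rate k h \<xi> = min (max 0 (fan (\<xi> - h) - k)) (max 0 (fan \<xi> - k)) + min (max 0 (k - fan (\<xi> - h))) (max 0 (k - fan \<xi>))"

text \<open>The entropy inequality as an inequality for difference quotients. Minimality is tested with the neighbouring value of
the fan if both values lie on the same side of \<open>k\<close>, and with \<open>k\<close> itself if it lies between them.\<close>

lemma fan_flux_decrease:
  assumes h: "0 < h" shows "h * fan_rate k h \<xi> \<le> fan_flux k (\<xi> - h) - fan_flux k \<xi>"
proof -
  define a b where "a = fan (\<xi> - h)" and "b = fan \<xi>"
  have ab: "a \<in> states" "b \<in> states" by (simp_all only: a_def b_def fan(1))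
  have ord: "orient * a \<le> orient * b" unfolding a_def b_def by (rule fan_mono) (use h in simp)
  have ma: "orient * (f a - (\<xi> - h) * a) \<le> orient * (f v - (\<xi> - h) * v)" if "v \<in> states" for v
    unfolding a_def by (rule fan(2)[OF that])
  have mb: "orient * (f b - \<xi> * b) \<le> orient * (f v - \<xi> * v)" if "v \<in> states" for v
    unfolding b_def by (rule fan(2)[OF that])
  have e: "fan_flux k (\<xi> - h) = sgn (a - k) * ((f a - (\<xi> - h) * a) - (f k - (\<xi> - h) * k))"
    "fan_flux k \<xi> = sgn (b - k) * ((f b - \<xi> * b) - (f k - \<xi> * k))"
    by (auto simp: fan_flux_def fan_entropy_def kruzkov_flux_def a_def b_def sgn_if abs_if algebra_simps)
  have rate: "fan_rate k h \<xi> = min (max 0 (a - k)) (max 0 (b - k)) + min (max 0 (k - a)) (max 0 (k - b))"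
    by (simp add: fan_rate_def a_def b_def)
  consider "k < a" "k < b" | "a < k" "b < k" | "a \<le> k" "k \<le> b" | "b \<le> k" "k \<le> a" by linarith
  thus ?thesis
  proof cases
    case 1
    have "h * min (a - k) (b - k) \<le> f a - (\<xi> - h) * a - (f b - \<xi> * b) - h * k"
    proof (cases "orient = 1")
      case True
      hence "f b - \<xi> * b \<le> f a - \<xi> * a" using mb[OF ab(1)] by simp
      moreover have "h * min (a - k) (b - k) \<le> h * (a - k)" using h by (intro mult_left_mono) auto
      ultimately show ?thesis by (simp add: algebra_simps)
    next
      case False
      hence "f b - (\<xi> - h) * b \<le> f a - (\<xi> - h) * a" using ma[OF ab(2)] orient_cases by auto
      moreover have "h * min (a - k) (b - k) \<le> h * (b - k)" using h by (intro mult_left_mono) auto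
      ultimately show ?thesis by (simp add: algebra_simps)
    qed
    thus ?thesis using 1 unfolding e rate by (simp add: max_def algebra_simps)
  next
    case 2
    have "h * min (k - a) (k - b) \<le> (f b - \<xi> * b) - (f a - (\<xi> - h) * a) + h * k"
    proof (cases "orient = 1")
      case True
      hence "f a - (\<xi> - h) * a \<le> f b - (\<xi> - h) * b" using ma[OF ab(2)] by simp
      moreover have "h * min (k - a) (k - b) \<le> h * (k - b)" using h by (intro mult_left_mono) auto
      ultimately show ?thesis by (simp add: algebra_simps)
    next
      case False
      hence "f a - \<xi> * a \<le> f b - \<xi> * b" using mb[OF ab(1)] orient_cases by auto
      moreover have "h * min (k - a) (k - b) \<le> h * (k - a)" using h by (intro mult_left_mono) auto
      ultimately show ?thesis by (simp add: algebra_simps)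
    qed
    thus ?thesis using 2 unfolding e rate by (simp add: max_def algebra_simps)
  next
    case 3
    have rate0: "fan_rate k h \<xi> = 0" using 3 unfolding rate by auto
    have k: "k \<in> states" using ab 3 by auto
    show ?thesis
    proof (cases "a = k \<and> b = k")
      case True thus ?thesis unfolding e rate0 by simp
    next
      case False
      hence "a < b" using 3 by auto
      hence o: "orient = 1" using ord orient_cases by auto
      have "f a - (\<xi> - h) * a \<le> f k - (\<xi> - h) * k" "f b - \<xi> * b \<le> f k - \<xi> * k"
        using ma[OF k] mb[OF k] o by auto
      thus ?thesis using 3 unfolding e rate0 by (auto simp: sgn_if)
    qed
  next
    case 4
    have rate0: "fan_rate k h \<xi> = 0" using 4 unfolding rate by auto
    have k: "k \<in> states" using ab 4 by auto
    show ?thesis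
    proof (cases "a = k \<and> b = k")
      case True thus ?thesis unfolding e rate0 by simp
    next
      case False
      hence "b < a" using 4 by auto
      hence o: "orient = - 1" using ord orient_cases by auto
      have "f k - (\<xi> - h) * k \<le> f a - (\<xi> - h) * a" "f k - \<xi> * k \<le> f b - \<xi> * b"
        using ma[OF k] mb[OF k] o by auto
      thus ?thesis using 4 unfolding e rate0 by (auto simp: sgn_if)
    qed
  qed
qed

end

text \<open>From difference quotients to the weak derivative: shift the difference quotient to the test function, where it converges
by dominated convergence.\<close>

lemma one_sided_derivative_ineq:
  fixes H N \<psi> :: "real \<Rightarrow> real" and m :: "real \<Rightarrow> real \<Rightarrow> real"
  assumes [measurable]: "H \<in> borel_measurable borel" "N \<in> borel_measurable borel" "\<And>h. m h \<in> borel_measurable borel"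
    and H: "\<And>\<xi>. \<bar>H \<xi>\<bar> \<le> C * (1 + \<bar>\<xi>\<bar>)" and m: "\<And>h \<xi>. \<bar>m h \<xi>\<bar> \<le> D"
    and dec: "\<And>h \<xi>. 0 < h \<Longrightarrow> h * m h \<xi> \<le> H (\<xi> - h) - H \<xi>"
    and lim: "AE \<xi> in lborel. (\<lambda>n. m (1 / real (Suc n)) \<xi>) \<longlonglongrightarrow> N \<xi>"
    and \<psi>: "\<And>\<xi>. (\<psi> has_real_derivative \<psi>' \<xi>) (at \<xi>)" "\<And>\<xi>. 0 \<le> \<psi> \<xi>"
    and \<psi>': "continuous_on UNIV \<psi>'" and Y: "\<And>\<xi>. Y < \<bar>\<xi>\<bar> \<Longrightarrow> \<psi> \<xi> = 0 \<and> \<psi>' \<xi> = 0"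
  shows "(LINT \<xi>|lborel. N \<xi> * \<psi> \<xi>) \<le> (LINT \<xi>|lborel. H \<xi> * \<psi>' \<xi>)"
proof -
  have C: "0 \<le> C" using H[of 0] by simp
  have D: "0 \<le> D" using m[of 0 0] by simp
  have c\<psi>: "continuous_on UNIV \<psi>" using \<psi>(1) by (meson DERIV_isCont continuous_at_imp_continuous_on)
  have [measurable]: "\<psi> \<in> borel_measurable borel" "\<psi>' \<in> borel_measurable borel"
    using c\<psi> \<psi>' by (auto intro: borel_measurable_continuous_onI)
  have cs: "compactly_supported \<psi>" "compactly_supported \<psi>'"
    unfolding compactly_supported_def using c\<psi> \<psi>' Y
    by (auto intro!: exI[of _ "{-\<bar>Y\<bar>..\<bar>Y\<bar>}"])
  obtain P where P: "0 < P" "\<And>\<xi>. \<bar>\<psi> \<xi>\<bar> \<le> P" using bounded_borelE[OF compactly_supported_bounded_borel[OF cs(1)]] by blast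
  obtain P' where P': "0 < P'" "\<And>\<xi>. \<bar>\<psi>' \<xi>\<bar> \<le> P'" using bounded_borelE[OF compactly_supported_bounded_borel[OF cs(2)]] by blast
  define Z where "Z = \<bar>Y\<bar> + 2"
  define CH where "CH = C * (1 + Z)"
  have CH: "\<bar>H \<xi>\<bar> \<le> CH" if "\<bar>\<xi>\<bar> \<le> Z" for \<xi>
    using H[of \<xi>] mult_left_mono[OF _ C, of "1 + \<bar>\<xi>\<bar>" "1 + Z"] that unfolding CH_def by simp
  have CH0: "0 \<le> CH" using C unfolding CH_def Z_def by simp
  have lip: "\<bar>\<psi> (\<xi> + h) - \<psi> \<xi>\<bar> \<le> P' * h" if h: "0 < h" for \<xi> h
  proof -
    obtain z where "\<psi> (\<xi> + h) - \<psi> \<xi> = (\<xi> + h - \<xi>) * \<psi>' z"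
      using MVT2[of \<xi> "\<xi> + h" \<psi> \<psi>'] h \<psi>(1) by auto
    thus ?thesis using P'(2)[of z] h by (simp add: abs_mult mult.commute)
  qed
  define h where "h = (\<lambda>n. 1 / real (Suc n))"
  have h: "0 < h n" "h n \<le> 1" for n by (simp_all add: h_def)
  have h0: "h \<longlonglongrightarrow> 0" unfolding h_def using LIMSEQ_inverse_real_of_nat by (simp add: inverse_eq_divide)
  have A: "(\<lambda>n. LINT \<xi>|lborel. H \<xi> * ((\<psi> (\<xi> + h n) - \<psi> \<xi>) / h n)) \<longlonglongrightarrow> (LINT \<xi>|lborel. H \<xi> * \<psi>' \<xi>)"
  proof (rule integral_dominated_convergence[where w = "\<lambda>\<xi>. indicator {-Z..Z} \<xi> *\<^sub>R (CH * P')"])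
    show "integrable lborel (\<lambda>\<xi>. indicator {-Z..Z} \<xi> *\<^sub>R (CH * P'))" by (rule borel_integrable_compact) auto
    show "AE \<xi> in lborel. (\<lambda>n. H \<xi> * ((\<psi> (\<xi> + h n) - \<psi> \<xi>) / h n)) \<longlonglongrightarrow> H \<xi> * \<psi>' \<xi>"
    proof (rule AE_I2)
      fix \<xi>
      have 1: "((\<lambda>y. (\<psi> (\<xi> + y) - \<psi> \<xi>) / y) \<longlongrightarrow> \<psi>' \<xi>) (at 0)"
        using \<psi>(1)[of \<xi>] by (simp add: DERIV_def)
      have 2: "filterlim h (at 0) sequentially"
        unfolding filterlim_at using h0 h(1) by (auto intro!: always_eventually simp: less_imp_neq[symmetric])
      from filterlim_compose[OF 1 2]
      show "(\<lambda>n. H \<xi> * ((\<psi> (\<xi> + h n) - \<psi> \<xi>) / h n)) \<longlonglongrightarrow> H \<xi> * \<psi>' \<xi>" by (intro tendsto_intros)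
    qed
    show "AE \<xi> in lborel. norm (H \<xi> * ((\<psi> (\<xi> + h n) - \<psi> \<xi>) / h n)) \<le> indicator {-Z..Z} \<xi> *\<^sub>R (CH * P')" for n
    proof (rule AE_I2)
      fix \<xi>
      show "norm (H \<xi> * ((\<psi> (\<xi> + h n) - \<psi> \<xi>) / h n)) \<le> indicator {-Z..Z} \<xi> *\<^sub>R (CH * P')"
      proof (cases "\<xi> \<in> {-Z..Z}")
        case True
        have "\<bar>(\<psi> (\<xi> + h n) - \<psi> \<xi>) / h n\<bar> \<le> P'" using lip[OF h(1)[of n], of \<xi>] h(1)[of n]
          by (simp add: field_simps)
        hence "\<bar>H \<xi>\<bar> * \<bar>(\<psi> (\<xi> + h n) - \<psi> \<xi>) / h n\<bar> \<le> CH * P'"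
          using True CH0 by (intro mult_mono CH) auto
        thus ?thesis using True by (simp add: abs_mult)
      next
        case False
        hence "Z < \<bar>\<xi>\<bar>" by auto
        hence "Y < \<bar>\<xi>\<bar>" "Y < \<bar>\<xi> + h n\<bar>" using h[of n] unfolding Z_def by auto
        thus ?thesis using Y False by simp
      qed
    qed
  qed measurable
  have B: "(\<lambda>n. LINT \<xi>|lborel. m (h n) \<xi> * \<psi> \<xi>) \<longlonglongrightarrow> (LINT \<xi>|lborel. N \<xi> * \<psi> \<xi>)"
  proof (rule integral_dominated_convergence[where w = "\<lambda>\<xi>. D * \<psi> \<xi>"])
    show "integrable lborel (\<lambda>\<xi>. D * \<psi> \<xi>)" by (rule integrable_bounded_compact[OF bounded_borel_const cs(1)])
    show "AE \<xi> in lborel. (\<lambda>n. m (h n) \<xi> * \<psi> \<xi>) \<longlonglongrightarrow> N \<xi> * \<psi> \<xi>"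
      using lim by eventually_elim (auto simp: h_def intro!: tendsto_mult)
    show "AE \<xi> in lborel. norm (m (h n) \<xi> * \<psi> \<xi>) \<le> D * \<psi> \<xi>" for n
      using m \<psi>(2) by (intro AE_I2) (auto simp: abs_mult intro: mult_right_mono)
  qed measurable
  have "(LINT \<xi>|lborel. m (h n) \<xi> * \<psi> \<xi>) \<le> (LINT \<xi>|lborel. H \<xi> * ((\<psi> (\<xi> + h n) - \<psi> \<xi>) / h n))" for n
  proof -
    have supp: "integrable lborel (\<lambda>\<xi>. H (\<xi> - a) * \<psi> (\<xi> + b))" if "0 \<le> a" "a \<le> 1" "0 \<le> b" "b \<le> 1" for a b
    proof (rule integrable_bounded_support[where S = "{-\<bar>Y\<bar> - 1..\<bar>Y\<bar> + 1}" and C = "CH * P"])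
      fix \<xi>
      show z: "H (\<xi> - a) * \<psi> (\<xi> + b) = 0" if "\<xi> \<notin> {-\<bar>Y\<bar> - 1..\<bar>Y\<bar> + 1}"
      proof -
        have "Y < \<bar>\<xi> + b\<bar>" using that \<open>0 \<le> b\<close> \<open>b \<le> 1\<close> by auto
        thus ?thesis using Y by simp
      qed
      show "\<bar>H (\<xi> - a) * \<psi> (\<xi> + b)\<bar> \<le> CH * P"
      proof (cases "\<xi> \<in> {-\<bar>Y\<bar> - 1..\<bar>Y\<bar> + 1}")
        case True
        hence "\<bar>\<xi> - a\<bar> \<le> Z" using \<open>0 \<le> a\<close> \<open>a \<le> 1\<close> unfolding Z_def by auto
        thus ?thesis unfolding abs_mult using P CH0 by (intro mult_mono CH) auto
      next
        case False
        show ?thesis unfolding z[OF False] using CH0 P by simp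
      qed
    qed auto
    have i1: "integrable lborel (\<lambda>\<xi>. H \<xi> * \<psi> (\<xi> + h n))" using supp[of 0 "h n"] h[of n] by simp
    have i2: "integrable lborel (\<lambda>\<xi>. H \<xi> * \<psi> \<xi>)" using supp[of 0 0] by simp
    have i3: "integrable lborel (\<lambda>\<xi>. H (\<xi> - h n) * \<psi> \<xi>)" using supp[of "h n" 0] h[of n] by simp
    have im: "integrable lborel (\<lambda>\<xi>. m (h n) \<xi> * \<psi> \<xi>)"
      by (rule integrable_bounded_compact[OF _ cs(1)]) (use m in \<open>auto simp: bounded_borel_def\<close>)
    have "h n * (LINT \<xi>|lborel. m (h n) \<xi> * \<psi> \<xi>) = (LINT \<xi>|lborel. h n * (m (h n) \<xi> * \<psi> \<xi>))" by simp
    also have "\<dots> \<le> (LINT \<xi>|lborel. H (\<xi> - h n) * \<psi> \<xi> - H \<xi> * \<psi> \<xi>)"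
    proof (rule integral_mono)
      fix \<xi>
      have "h n * m (h n) \<xi> * \<psi> \<xi> \<le> (H (\<xi> - h n) - H \<xi>) * \<psi> \<xi>"
        using dec[OF h(1)] \<psi>(2) by (rule mult_right_mono)
      thus "h n * (m (h n) \<xi> * \<psi> \<xi>) \<le> H (\<xi> - h n) * \<psi> \<xi> - H \<xi> * \<psi> \<xi>" by (simp add: algebra_simps)
    qed (use im i2 i3 in auto)
    also have "\<dots> = (LINT \<xi>|lborel. H (\<xi> - h n) * \<psi> \<xi>) - (LINT \<xi>|lborel. H \<xi> * \<psi> \<xi>)"
      using i2 i3 by simp
    also have "(LINT \<xi>|lborel. H (\<xi> - h n) * \<psi> \<xi>) = (LINT \<xi>|lborel. H \<xi> * \<psi> (\<xi> + h n))"
      using lborel_integral_real_affine[of 1 "\<lambda>\<xi>. H (\<xi> - h n) * \<psi> \<xi>" "h n"] by (simp add: add.commute)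
    also have "(LINT \<xi>|lborel. H \<xi> * \<psi> (\<xi> + h n)) - (LINT \<xi>|lborel. H \<xi> * \<psi> \<xi>)
        = (LINT \<xi>|lborel. H \<xi> * \<psi> (\<xi> + h n) - H \<xi> * \<psi> \<xi>)" using i1 i2 by simp
    also have "\<dots> = (LINT \<xi>|lborel. h n * (H \<xi> * ((\<psi> (\<xi> + h n) - \<psi> \<xi>) / h n)))"
      using h(1)[of n] by (intro Bochner_Integration.integral_cong) (auto simp: field_simps)
    also have "\<dots> = h n * (LINT \<xi>|lborel. H \<xi> * ((\<psi> (\<xi> + h n) - \<psi> \<xi>) / h n))" by (rule Bochner_Integration.integral_mult_right_zero)
    finally show ?thesis by (simp only: mult_le_cancel_left_pos[OF h(1)[of n]])
  qed
  thus ?thesis by (intro LIMSEQ_le[OF B A]) blast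
qed

context riemann_problem begin

definition fan_solution :: "real \<Rightarrow> real \<Rightarrow> real" where
  "fan_solution t x = (if t \<le> 0 then riemann_data l r x else fan (x / t))"

lemma R_nonneg: "0 \<le> R" using l by auto

lemma fan_solution_range: "fan_solution t x \<in> {0..R}"
  unfolding fan_solution_def riemann_data_def using l r fan_range by auto

lemma fan_solution_borel: "(\<lambda>p. fan_solution (fst p) (snd p)) \<in> borel_measurable borel"
  unfolding fan_solution_def riemann_data_def by measurable

lemma fan_solution_borel_slice [measurable]: "fan_solution t \<in> borel_measurable borel"
  by (cases "t \<le> 0") (auto simp: fan_solution_def[abs_def] riemann_data_def[abs_def])

text \<open>For positive times, values converge on every ray where the fan is continuous. At time zero they are eventually constant by
finite speed of propagation.\<close>

lemma fan_solution_continuous_in_time: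
  assumes t0: "0 \<le> t0"
  shows "((\<lambda>t. LINT x:UNIV \<inter> {-L..L}|lborel. \<bar>fan_solution t x - fan_solution t0 x\<bar>) \<longlongrightarrow> 0) (at t0 within {0..})"
  unfolding tendsto_at_iff_sequentially
proof (intro allI impI)
  fix X :: "nat \<Rightarrow> real" assume X: "\<forall>i. X i \<in> {0..} - {t0}" "X \<longlonglongrightarrow> t0"
  have "(\<lambda>i. LINT x|lborel. indicator {-L..L} x *\<^sub>R \<bar>fan_solution (X i) x - fan_solution t0 x\<bar>) \<longlonglongrightarrow> (LINT x|(lborel :: real measure). 0)"
  proof (rule integral_dominated_convergence[where w = "\<lambda>x. indicator {-L..L} x *\<^sub>R R"])
    show "integrable lborel (\<lambda>x. indicator {-L..L} x *\<^sub>R R)" by (rule borel_integrable_compact) auto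
    show "AE x in lborel. norm (indicator {-L..L} x *\<^sub>R \<bar>fan_solution (X i) x - fan_solution t0 x\<bar>) \<le> indicator {-L..L} x *\<^sub>R R" for i
    proof (rule AE_I2)
      fix x
      have "\<bar>fan_solution (X i) x - fan_solution t0 x\<bar> \<le> R"
        using fan_solution_range[of "X i" x] fan_solution_range[of t0 x] by auto
      thus "norm (indicator {-L..L} x *\<^sub>R \<bar>fan_solution (X i) x - fan_solution t0 x\<bar>) \<le> indicator {-L..L} x *\<^sub>R R"
        by (auto simp: indicator_def)
    qed
    have "AE x in lborel. (\<lambda>i. fan_solution (X i) x) \<longlonglongrightarrow> fan_solution t0 x"
    proof (cases "t0 = 0")
      case True
      have "AE x in lborel. x \<noteq> (0::real)" by (rule AE_lborel_singleton)
      thus ?thesis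
      proof eventually_elim
        fix x :: real assume x: "x \<noteq> 0"
        have "(\<lambda>i. \<Lambda> * X i) \<longlonglongrightarrow> \<Lambda> * 0" using X(2) True by (intro tendsto_intros) simp
        hence "\<forall>\<^sub>F i in sequentially. \<Lambda> * X i < \<bar>x\<bar>"
          by (rule order_tendstoD(2)) (use x in simp)
        hence "\<forall>\<^sub>F i in sequentially. fan_solution (X i) x = fan_solution t0 x"
        proof eventually_elim
          fix i assume i: "\<Lambda> * X i < \<bar>x\<bar>"
          have Xi: "0 < X i" using X(1) True by (metis DiffE atLeast_iff insertCI order_le_less)
          show "fan_solution (X i) x = fan_solution t0 x"
          proof (cases "x < 0")
            case x0: True
            hence "x / X i < - \<Lambda>" using i Xi by (simp add: field_simps)
            thus ?thesis using fan_left Xi True x0 by (simp add: fan_solution_def riemann_data_def)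
          next
            case False
            hence "\<Lambda> < x / X i" using i Xi by (simp add: field_simps)
            thus ?thesis using fan_right Xi True False by (simp add: fan_solution_def riemann_data_def)
          qed
        qed
        thus "(\<lambda>i. fan_solution (X i) x) \<longlonglongrightarrow> fan_solution t0 x" by (rule tendsto_eventually)
      qed
    next
      case False
      hence pos: "0 < t0" using t0 by simp
      have "AE x in lborel. isCont fan (x / t0)" by (rule AE_fan_continuous) (use pos in simp)
      thus ?thesis
      proof eventually_elim
        fix x assume c: "isCont fan (x / t0)"
        have "(\<lambda>i. x / X i) \<longlonglongrightarrow> x / t0" using X(2) pos by (intro tendsto_intros) auto
        from isCont_tendsto_compose[OF c this] have lim: "(\<lambda>i. fan (x / X i)) \<longlonglongrightarrow> fan_solution t0 x"
          using pos by (simp add: fan_solution_def)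
        have "\<forall>\<^sub>F i in sequentially. 0 < X i" by (rule order_tendstoD(1)[OF X(2) pos])
        hence "\<forall>\<^sub>F i in sequentially. fan (x / X i) = fan_solution (X i) x"
          by eventually_elim (simp add: fan_solution_def)
        from Lim_transform_eventually[OF lim this]
        show "(\<lambda>i. fan_solution (X i) x) \<longlonglongrightarrow> fan_solution t0 x" .
      qed
    qed
    thus "AE x in lborel. (\<lambda>i. indicator {-L..L} x *\<^sub>R \<bar>fan_solution (X i) x - fan_solution t0 x\<bar>) \<longlonglongrightarrow> 0"
    proof eventually_elim
      fix x assume "(\<lambda>i. fan_solution (X i) x) \<longlonglongrightarrow> fan_solution t0 x"
      hence "(\<lambda>i. indicator {-L..L} x *\<^sub>R \<bar>fan_solution (X i) x - fan_solution t0 x\<bar>) \<longlonglongrightarrow>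
        indicator {-L..L} x *\<^sub>R \<bar>fan_solution t0 x - fan_solution t0 x\<bar>" by (intro tendsto_intros)
      thus "(\<lambda>i. indicator {-L..L} x *\<^sub>R \<bar>fan_solution (X i) x - fan_solution t0 x\<bar>) \<longlonglongrightarrow> 0" by simp
    qed
  qed measurable
  thus "((\<lambda>t. LINT x:UNIV \<inter> {-L..L}|lborel. \<bar>fan_solution t x - fan_solution t0 x\<bar>) \<circ> X) \<longlonglongrightarrow> 0"
    by (simp add: o_def set_lebesgue_integral_def)
qed

lemma fan_entropy_bounds: "k \<in> {0..R} \<Longrightarrow> \<bar>fan_entropy k \<xi>\<bar> \<le> R"
  using fan_range[of \<xi>] by (auto simp: fan_entropy_def)

text \<open>In the coordinates \<open>(t, \<xi>) = (t, x / t)\<close> the entropy inequality becomes the inequality in \<open>\<xi>\<close> alone, for each \<open>t\<close>,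
after an integration by parts in \<open>t\<close>.\<close>

lemma fan_kruzkov:
  assumes k: "k \<in> {0..R}" and \<phi>: "test_function UNIV \<phi> \<phi>t \<phi>x"
  shows "0 \<le> (LINT p:{0<..} \<times> UNIV|lborel. \<bar>fan_solution (fst p) (snd p) - k\<bar> * \<phi>t p
    + kruzkov_flux f k (fan_solution (fst p) (snd p)) * \<phi>x p)"
proof -
  note ck = continuous_kruzkov_flux[OF f_cont k]
  note c\<phi> = test_function_continuous[OF \<phi>]
  note cs\<phi> = test_function_compactly_supported[OF \<phi>]
  obtain K where K: "compact K" "K \<subseteq> {0<..} \<times> UNIV" "\<And>p. p \<notin> K \<Longrightarrow> \<phi> p = 0"
    "\<And>p. p \<notin> K \<Longrightarrow> \<phi>t p = 0" "\<And>p. p \<notin> K \<Longrightarrow> \<phi>x p = 0"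
    using test_function_support[OF \<phi>] by metis
  (* The support avoids t = 0, where the new coordinates are singular. *)
  obtain t0 where t0: "0 < t0" "\<And>p. p \<in> K \<Longrightarrow> t0 \<le> fst p"
  proof (cases "K = {}")
    case True thus thesis using that[of 1] by simp
  next
    case False
    have "\<exists>p\<in>K. \<forall>q\<in>K. fst p \<le> fst q"
      by (rule continuous_attains_inf[OF K(1) False]) (intro continuous_intros)
    then obtain p where "p \<in> K" "\<forall>q\<in>K. fst p \<le> fst q" by blast
    thus thesis using that[of "fst p"] K(2) by auto
  qed
  obtain X where X: "\<And>p. p \<in> K \<Longrightarrow> norm p \<le> X" using compact_imp_bounded[OF K(1)] unfolding bounded_iff by blast
  have XX: "\<bar>fst p\<bar> \<le> X" "\<bar>snd p\<bar> \<le> X" if "p \<in> K" for p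
    using X[OF that] norm_fst_le[of "fst p" "snd p"] norm_snd_le[of "snd p" "fst p"] by auto
  define Y where "Y = \<bar>X\<bar> / t0"
  define K2 where "K2 = {t0..\<bar>X\<bar>} \<times> {-Y..Y}"
  have K2: "compact K2" unfolding K2_def by (intro compact_Times) auto
  have scale: "(t, t * \<xi>) \<notin> K" if "(t, \<xi>) \<notin> K2" for t \<xi>
  proof
    assume p: "(t, t * \<xi>) \<in> K"
    have t: "t0 \<le> t" "t \<le> \<bar>X\<bar>" using t0(2)[OF p] XX(1)[OF p] by auto
    have "t0 * \<bar>\<xi>\<bar> \<le> \<bar>t * \<xi>\<bar>" using t t0(1) by (simp add: abs_mult mult_right_mono)
    also have "\<dots> \<le> \<bar>X\<bar>" using XX(2)[OF p] by simp
    finally have "\<bar>\<xi>\<bar> \<le> Y" unfolding Y_def using t0(1) by (simp add: field_simps)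
    thus False using that t unfolding K2_def by auto
  qed
  (* With \<psi> the test function in the new coordinates, \<psi> + A is the time derivative of t \<psi>, and B the \<xi>-derivative of \<psi>. *)
  define A where "A = (\<lambda>p. fst p * (\<phi>t (fst p, fst p * snd p) + snd p * \<phi>x (fst p, fst p * snd p)))"
  define B where "B = (\<lambda>p. fst p * \<phi>x (fst p, fst p * snd p))"
  define \<psi> where "\<psi> = (\<lambda>p. \<phi> (fst p, fst p * snd p))"
  have cc: "continuous_on UNIV (\<lambda>p::real\<times>real. g (fst p, fst p * snd p))" if "continuous_on UNIV g" for g :: "real \<times> real \<Rightarrow> real"
    by (rule continuous_on_compose2[OF that]) (auto intro!: continuous_intros)
  have cA: "continuous_on UNIV A" "continuous_on UNIV B" "continuous_on UNIV \<psi>"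
    unfolding A_def B_def \<psi>_def by (intro continuous_intros cc c\<phi>)+
  have zero: "A p = 0 \<and> B p = 0 \<and> \<psi> p = 0" if "p \<notin> K2" for p
  proof -
    have "(fst p, fst p * snd p) \<notin> K" using scale[of "fst p" "snd p"] that by simp
    thus ?thesis using K by (simp add: A_def B_def \<psi>_def)
  qed
  have csA: "compactly_supported A" "compactly_supported B" "compactly_supported \<psi>"
    unfolding compactly_supported_def using cA K2 zero by blast+
  have slices: "compactly_supported (\<lambda>t. g (t, x))" "compactly_supported (\<lambda>x. g (t, x))"
    if g: "compactly_supported g" "\<And>p. p \<notin> K2 \<Longrightarrow> g p = 0" for g :: "real \<times> real \<Rightarrow> real" and t x
  proof -
    have cg: "continuous_on UNIV g" using g(1) by (simp add: compactly_supported_def)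
    have "continuous_on UNIV (\<lambda>t. g (t, x))" "continuous_on UNIV (\<lambda>x. g (t, x))"
      by (rule continuous_on_compose2[OF cg], auto intro!: continuous_intros)+
    moreover have "g (t, x) = 0" if "t \<notin> {t0..\<bar>X\<bar>}" for t x using g(2)[of "(t, x)"] that by (auto simp: K2_def)
    moreover have "g (t, x) = 0" if "x \<notin> {-Y..Y}" for t x using g(2)[of "(t, x)"] that by (auto simp: K2_def)
    ultimately show "compactly_supported (\<lambda>t. g (t, x))" "compactly_supported (\<lambda>x. g (t, x))"
      unfolding compactly_supported_def using compact_Icc by blast+
  qed
  define N where "N = fan_entropy k"
  define H where "H = fan_flux k"
  have Nm [measurable]: "N \<in> borel_measurable borel" unfolding N_def fan_entropy_def[abs_def] by measurable
  have Jb: "bounded_borel (\<lambda>\<xi>. kruzkov_flux f k (fan \<xi>))" by (rule bounded_borel_compose[OF ck fan_borel fan_range])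
  hence [measurable]: "(\<lambda>\<xi>. kruzkov_flux f k (fan \<xi>)) \<in> borel_measurable borel" by (simp add: bounded_borel_def)
  have Hm [measurable]: "H \<in> borel_measurable borel" unfolding H_def fan_flux_def[abs_def] N_def[symmetric] by measurable
  obtain CJ where CJ: "0 < CJ" "\<And>\<xi>. \<bar>kruzkov_flux f k (fan \<xi>)\<bar> \<le> CJ" using bounded_borelE[OF Jb] by blast
  have Hb: "\<bar>H \<xi>\<bar> \<le> (CJ + R) * (1 + \<bar>\<xi>\<bar>)" for \<xi>
  proof -
    have "\<bar>H \<xi>\<bar> \<le> \<bar>kruzkov_flux f k (fan \<xi>)\<bar> + \<bar>\<xi>\<bar> * \<bar>fan_entropy k \<xi>\<bar>"
      unfolding H_def fan_flux_def by (metis abs_mult abs_triangle_ineq4)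
    also have "\<dots> \<le> CJ + \<bar>\<xi>\<bar> * R" by (intro add_mono CJ mult_left_mono fan_entropy_bounds k) auto
    also have "\<dots> \<le> (CJ + R) * (1 + \<bar>\<xi>\<bar>)" using CJ(1) R_nonneg by (simp add: algebra_simps)
    finally show ?thesis .
  qed
  (* The flux grows linearly in \<xi>; outside the support of the test function it may be replaced by zero. *)
  define Hc where "Hc = (\<lambda>\<xi>. indicator {-Y..Y} \<xi> * H \<xi>)"
  have bHc: "bounded_borel (\<lambda>p::real\<times>real. Hc (snd p))"
  proof -
    have Hcm: "Hc \<in> borel_measurable borel" unfolding Hc_def by measurable
    have "(\<lambda>p::real\<times>real. Hc (snd p)) \<in> borel_measurable borel"
      by (rule measurable_compose[OF _ Hcm]) (intro borel_measurable_continuous_onI continuous_intros)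
    moreover have "\<bar>Hc \<xi>\<bar> \<le> (CJ + R) * (1 + \<bar>Y\<bar>)" for \<xi>
    proof (cases "\<xi> \<in> {-Y..Y}")
      case True
      have "(CJ + R) * (1 + \<bar>\<xi>\<bar>) \<le> (CJ + R) * (1 + \<bar>Y\<bar>)"
        using True CJ(1) R_nonneg by (intro mult_left_mono) auto
      thus ?thesis using Hb[of \<xi>] True by (simp add: Hc_def)
    next
      case False
      have "0 \<le> (CJ + R) * (1 + \<bar>Y\<bar>)" using CJ(1) R_nonneg by simp
      thus ?thesis using False by (simp add: Hc_def)
    qed
    ultimately show ?thesis unfolding bounded_borel_def by blast
  qed
  have bN: "bounded_borel (\<lambda>p::real\<times>real. N (snd p))"
  proof -
    have "(\<lambda>p::real\<times>real. N (snd p)) \<in> borel_measurable borel"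
      by (rule measurable_compose[OF _ Nm]) (intro borel_measurable_continuous_onI continuous_intros)
    thus ?thesis unfolding bounded_borel_def N_def using fan_entropy_bounds[OF k] by blast
  qed
  have iNA: "integrable lborel (\<lambda>p. N (snd p) * A p)" and iHB: "integrable lborel (\<lambda>p. Hc (snd p) * B p)"
    and iN\<psi>: "integrable lborel (\<lambda>p. N (snd p) * \<psi> p)"
    by (intro integrable_bounded_compact bHc bN csA)+
  have HB: "Hc \<xi> * B (t, \<xi>) = H \<xi> * B (t, \<xi>)" for t \<xi>
    using zero[of "(t, \<xi>)"] by (cases "\<xi> \<in> {-Y..Y}") (auto simp: Hc_def K2_def)
  (* The substitution x = t \<xi> at fixed t. *)
  let ?F = "\<lambda>p. \<bar>fan_solution (fst p) (snd p) - k\<bar> * \<phi>t p + kruzkov_flux f k (fan_solution (fst p) (snd p)) * \<phi>x p"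
  have iF: "set_integrable lborel ({0<..} \<times> UNIV) ?F"
  proof (intro set_integral_add(1) set_integrable_half_plane cs\<phi>)
    show "bounded_borel (\<lambda>p. \<bar>fan_solution (fst p) (snd p) - k\<bar>)"
      by (rule bounded_borel_compose[OF _ fan_solution_borel fan_solution_range, of "\<lambda>v. \<bar>v - k\<bar>"]) (intro continuous_intros)
    show "bounded_borel (\<lambda>p. kruzkov_flux f k (fan_solution (fst p) (snd p)))"
      by (rule bounded_borel_compose[OF ck fan_solution_borel fan_solution_range])
  qed (auto simp: borel_prod[symmetric])
  have inner: "(LINT x|lborel. indicator ({0<..} \<times> UNIV) (t, x) *\<^sub>R ?F (t, x))
      = (LINT \<xi>|lborel. N \<xi> * A (t, \<xi>) + Hc \<xi> * B (t, \<xi>))" for t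
  proof (cases "0 < t")
    case True
    have "(LINT x|lborel. indicator ({0<..} \<times> UNIV) (t, x) *\<^sub>R ?F (t, x)) = (LINT x|lborel. ?F (t, x))"
      using True by simp
    also have "\<dots> = \<bar>t\<bar> *\<^sub>R (LINT \<xi>|lborel. ?F (t, 0 + t * \<xi>))"
      by (rule lborel_integral_real_affine) (use True in simp)
    also have "\<dots> = (LINT \<xi>|lborel. t * ?F (t, t * \<xi>))" using True by simp
    also have "\<dots> = (LINT \<xi>|lborel. N \<xi> * A (t, \<xi>) + Hc \<xi> * B (t, \<xi>))"
    proof (rule Bochner_Integration.integral_cong[OF refl])
      fix \<xi>
      show "t * ?F (t, t * \<xi>) = N \<xi> * A (t, \<xi>) + Hc \<xi> * B (t, \<xi>)"
        unfolding HB using True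
        by (simp add: fan_solution_def N_def H_def A_def B_def fan_entropy_def fan_flux_def algebra_simps)
    qed
    finally show ?thesis .
  next
    case False
    have "A (t, \<xi>) = 0" "B (t, \<xi>) = 0" for \<xi>
      using zero[of "(t, \<xi>)"] False t0(1) by (auto simp: K2_def)
    thus ?thesis using False by simp
  qed
  have dt: "((\<lambda>t. t * \<psi> (t, \<xi>)) has_real_derivative \<psi> (t, \<xi>) + A (t, \<xi>)) (at t)" for t \<xi>
  proof -
    have 1: "(\<phi> has_derivative (\<lambda>h. \<phi>t (t, t * \<xi>) * fst h + \<phi>x (t, t * \<xi>) * snd h)) (at (t, t * \<xi>))"
      using \<phi> unfolding test_function_def by blast
    have 2: "((\<lambda>t. (t, t * \<xi>)) has_derivative (\<lambda>h. (h, h * \<xi>))) (at t)"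
      by (auto intro!: derivative_eq_intros)
    have "((\<lambda>t. \<phi> (t, t * \<xi>)) has_real_derivative \<phi>t (t, t * \<xi>) + \<xi> * \<phi>x (t, t * \<xi>)) (at t)"
      unfolding has_field_derivative_def
      by (rule has_derivative_eq_rhs[OF has_derivative_compose[OF 2 1]]) (auto simp: algebra_simps)
    from DERIV_mult[OF DERIV_ident this] show ?thesis
      by (simp add: \<psi>_def A_def algebra_simps)
  qed
  have intA: "(LINT t|lborel. A (t, \<xi>)) = - (LINT t|lborel. \<psi> (t, \<xi>))" for \<xi>
  proof -
    have s1: "compactly_supported (\<lambda>t. A (t, \<xi>))" "compactly_supported (\<lambda>t. \<psi> (t, \<xi>))"
      by (rule slices; use csA zero in blast)+
    have cs1: "compactly_supported (\<lambda>t. t * \<psi> (t, \<xi>))" "compactly_supported (\<lambda>t. \<psi> (t, \<xi>) + A (t, \<xi>))"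
    proof -
      have "\<psi> (t, \<xi>) = 0 \<and> A (t, \<xi>) = 0" if "t \<notin> {t0..\<bar>X\<bar>}" for t
        using zero[of "(t, \<xi>)"] that by (auto simp: K2_def)
      thus "compactly_supported (\<lambda>t. t * \<psi> (t, \<xi>))" "compactly_supported (\<lambda>t. \<psi> (t, \<xi>) + A (t, \<xi>))"
        using s1 unfolding compactly_supported_def
        by (auto intro!: continuous_intros exI[of _ "{t0..\<bar>X\<bar>}"])
    qed
    have "(LINT t|lborel. \<psi> (t, \<xi>) + A (t, \<xi>)) = 0" by (rule half_line_FTC(2)[OF dt cs1])
    moreover have "integrable lborel (\<lambda>t. A (t, \<xi>))" "integrable lborel (\<lambda>t. \<psi> (t, \<xi>))"
      using integrable_bounded_compact[OF bounded_borel_const[of 1] s1(1)] integrable_bounded_compact[OF bounded_borel_const[of 1] s1(2)] by simp_all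
    ultimately show ?thesis by simp
  qed
  have "(LINT p|lborel. N (snd p) * A p) = (LINT \<xi>|lborel. N \<xi> * (LINT t|lborel. A (t, \<xi>)))"
    using plane_integral_iterated(2)[OF iNA] by simp
  also have "\<dots> = - (LINT \<xi>|lborel. N \<xi> * (LINT t|lborel. \<psi> (t, \<xi>)))" by (simp add: intA)
  also have "(LINT \<xi>|lborel. N \<xi> * (LINT t|lborel. \<psi> (t, \<xi>))) = (LINT p|lborel. N (snd p) * \<psi> p)"
    using plane_integral_iterated(2)[OF iN\<psi>] by simp
  finally have NA: "(LINT p|lborel. N (snd p) * A p) = - (LINT p|lborel. N (snd p) * \<psi> p)" .
  have slice_nonneg: "0 \<le> (LINT \<xi>|lborel. Hc \<xi> * B (t, \<xi>) - N \<xi> * \<psi> (t, \<xi>))" for t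
  proof -
    have s: "compactly_supported (\<lambda>\<xi>. B (t, \<xi>))" "compactly_supported (\<lambda>\<xi>. \<psi> (t, \<xi>))"
      by (rule slices; use csA zero in blast)+
    have i: "integrable lborel (\<lambda>\<xi>. Hc \<xi> * B (t, \<xi>))" "integrable lborel (\<lambda>\<xi>. N \<xi> * \<psi> (t, \<xi>))"
      using integrable_bounded_compact[OF bounded_borel_slice(1)[OF bHc, of t] s(1)]
        integrable_bounded_compact[OF bounded_borel_slice(1)[OF bN, of t] s(2)] by simp_all
    have d: "((\<lambda>\<xi>. \<psi> (t, \<xi>)) has_real_derivative B (t, \<xi>)) (at \<xi>)" for \<xi>
    proof -
      have 1: "(\<phi> has_derivative (\<lambda>h. \<phi>t (t, t * \<xi>) * fst h + \<phi>x (t, t * \<xi>) * snd h)) (at (t, t * \<xi>))"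
        using \<phi> unfolding test_function_def by blast
      have 2: "((\<lambda>\<xi>. (t, t * \<xi>)) has_derivative (\<lambda>h. (0, t * h))) (at \<xi>)"
        by (auto intro!: derivative_eq_intros)
      have "((\<lambda>\<xi>. \<phi> (t, t * \<xi>)) has_real_derivative t * \<phi>x (t, t * \<xi>)) (at \<xi>)"
        unfolding has_field_derivative_def
        by (rule has_derivative_eq_rhs[OF has_derivative_compose[OF 2 1]]) (auto simp: algebra_simps)
      thus ?thesis by (simp add: \<psi>_def B_def)
    qed
    have rate_bound: "\<bar>fan_rate k h \<xi>\<bar> \<le> R" for h \<xi>
      using fan_range[of \<xi>] fan_range[of "\<xi> - h"] k unfolding fan_rate_def by auto
    have rate_lim: "AE \<xi> in lborel. (\<lambda>n. fan_rate k (1 / real (Suc n)) \<xi>) \<longlonglongrightarrow> N \<xi>"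
    proof -
      have "AE \<xi> in lborel. isCont fan (\<xi> / 1)" by (rule AE_fan_continuous) simp
      thus ?thesis
      proof eventually_elim
        fix \<xi> assume "isCont fan (\<xi> / 1)"
        hence c: "isCont fan \<xi>" by simp
        have "(\<lambda>n. \<xi> - 1 / real (Suc n)) \<longlonglongrightarrow> \<xi> - 0"
          using LIMSEQ_inverse_real_of_nat by (intro tendsto_intros) (simp add: inverse_eq_divide)
        hence "(\<lambda>n. fan (\<xi> - 1 / real (Suc n))) \<longlonglongrightarrow> fan \<xi>"
          using isCont_tendsto_compose[OF c, of "\<lambda>n. \<xi> - 1 / real (Suc n)"] by simp
        hence "(\<lambda>n. fan_rate k (1 / real (Suc n)) \<xi>) \<longlonglongrightarrow>
          min (max 0 (fan \<xi> - k)) (max 0 (fan \<xi> - k)) + min (max 0 (k - fan \<xi>)) (max 0 (k - fan \<xi>))"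
          unfolding fan_rate_def by (intro tendsto_intros)
        also have "min (max 0 (fan \<xi> - k)) (max 0 (fan \<xi> - k)) + min (max 0 (k - fan \<xi>)) (max 0 (k - fan \<xi>)) = N \<xi>"
          by (auto simp: N_def fan_entropy_def)
        finally show "(\<lambda>n. fan_rate k (1 / real (Suc n)) \<xi>) \<longlonglongrightarrow> N \<xi>" .
      qed
    qed
    have rate_m: "fan_rate k h \<in> borel_measurable borel" for h
      unfolding fan_rate_def[abs_def] by measurable
    have Yz: "\<psi> (t, \<xi>) = 0 \<and> B (t, \<xi>) = 0" if "Y < \<bar>\<xi>\<bar>" for \<xi>
    proof -
      have "(t, \<xi>) \<notin> K2" using that by (auto simp: K2_def)
      from zero[OF this] show ?thesis by simp
    qed
    have nn: "0 \<le> \<psi> (t, \<xi>)" for \<xi> using \<phi> unfolding test_function_def \<psi>_def by blast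
    have cB: "continuous_on UNIV (\<lambda>\<xi>. B (t, \<xi>))" using s(1) by (simp add: compactly_supported_def)
    have "(LINT \<xi>|lborel. N \<xi> * \<psi> (t, \<xi>)) \<le> (LINT \<xi>|lborel. H \<xi> * B (t, \<xi>))"
      by (rule one_sided_derivative_ineq[OF Hm Nm rate_m Hb rate_bound fan_flux_decrease[where k = k, folded H_def] rate_lim d nn cB Yz])
    thus ?thesis using i by (simp add: HB)
  qed
  have "0 \<le> (LINT t|lborel. LINT \<xi>|lborel. Hc (snd (t, \<xi>)) * B (t, \<xi>) - N (snd (t, \<xi>)) * \<psi> (t, \<xi>))"
    by (rule Bochner_Integration.integral_nonneg) (use slice_nonneg in simp)
  also have "\<dots> = (LINT p|lborel. Hc (snd p) * B p - N (snd p) * \<psi> p)"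
    by (rule plane_integral_iterated(1)[symmetric]) (use iHB iN\<psi> in auto)
  also have "\<dots> = (LINT p|lborel. N (snd p) * A p + Hc (snd p) * B p)"
    using iHB iN\<psi> iNA NA by simp
  also have "\<dots> = (LINT t|lborel. LINT \<xi>|lborel. N (snd (t, \<xi>)) * A (t, \<xi>) + Hc (snd (t, \<xi>)) * B (t, \<xi>))"
    by (rule plane_integral_iterated(1)) (use iHB iNA in auto)
  also have "\<dots> = (LINT t|lborel. LINT x|lborel. indicator ({0<..} \<times> UNIV) (t, x) *\<^sub>R ?F (t, x))"
    unfolding inner by simp
  also have "\<dots> = (LINT p:{0<..} \<times> UNIV|lborel. ?F p)"
    unfolding set_lebesgue_integral_def
    by (rule plane_integral_iterated(1)[symmetric]) (use iF in \<open>simp only: set_integrable_def\<close>)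
  finally show ?thesis .
qed

lemma fan_solution: "entropy_solution f R UNIV (riemann_data l r) fan_solution"
  unfolding entropy_solution_def
proof (intro conjI)
  have "({0..} \<times> UNIV) \<in> sets (borel :: (real \<times> real) measure)" by (auto simp: borel_prod[symmetric])
  thus "set_borel_measurable lborel ({0..} \<times> UNIV) (\<lambda>p. fan_solution (fst p) (snd p))"
    unfolding set_borel_measurable_def using fan_solution_borel by simp
  show "\<forall>t\<ge>0. \<forall>x\<in>UNIV. fan_solution t x \<in> {0..R}" using fan_solution_range by blast
  show "\<forall>t0\<ge>0. \<forall>L. ((\<lambda>t. LINT x:UNIV \<inter> {-L..L}|lborel. \<bar>fan_solution t x - fan_solution t0 x\<bar>) \<longlongrightarrow> 0) (at t0 within {0..})"
    using fan_solution_continuous_in_time by blast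
  show "AE x in lborel. x \<in> UNIV \<longrightarrow> fan_solution 0 x = riemann_data l r x" by (simp add: fan_solution_def)
  show "\<forall>k\<in>{0..R}. \<forall>\<phi> \<phi>t \<phi>x. test_function UNIV \<phi> \<phi>t \<phi>x \<longrightarrow>
     0 \<le> (LINT p:{0<..} \<times> UNIV|lborel. \<bar>fan_solution (fst p) (snd p) - k\<bar> * \<phi>t p
       + sgn (fan_solution (fst p) (snd p) - k) * (f (fan_solution (fst p) (snd p)) - f k) * \<phi>x p)"
    using fan_kruzkov unfolding kruzkov_flux_def by blast
qed

end

section \<open>Incoming roads with prescribed boundary flux\<close>

context concave_road begin

lemma riemann_problem:
  assumes "l \<in> {0..R}" "r \<in> {0..R}"
  obtains \<Lambda> where "riemann_problem f R \<Lambda> l r"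
proof -
  obtain \<Lambda> where "0 < \<Lambda>" "\<And>u v. u \<in> {0..R} \<Longrightarrow> v \<in> {0..R} \<Longrightarrow> \<bar>f u - f v\<bar> \<le> \<Lambda> * \<bar>u - v\<bar>"
    using flux_lipschitz by blast
  hence "riemann_problem f R \<Lambda> l r"
    using assms continuous_flux by unfold_locales auto
  thus thesis by (rule that)
qed

text \<open>If the flux is not that of \<open>l\<close>, the right state is the congested one with flux \<open>F\<close>. It is the strict minimiser at
\<open>\<xi> = 0\<close>, hence the value of the fan for all \<open>\<xi> > 0\<close>: all waves have nonpositive speed. By compactness the fan tends to it as \<open>\<xi>\<close> increases to \<open>0\<close>, so it is
the trace.\<close>

lemma incoming_exists:
  assumes l: "l \<in> {0..R}" and F: "0 \<le> F" "F \<le> omega_in f R l"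
  obtains \<rho> \<beta> where "entropy_solution f R {..<0} (\<lambda>x. l) \<rho>" "lrs_profile_in f R l F \<rho>"
    "\<beta> \<in> {0..R}" "f \<beta> = F" "F = f l \<Longrightarrow> \<beta> = l" "F \<noteq> f l \<Longrightarrow> peak \<le> \<beta>"
    "\<And>t. 0 < t \<Longrightarrow> (\<rho> t \<longlongrightarrow> \<beta>) (at_left 0)"
proof (cases "F = f l")
  case True
  obtain \<Lambda> where rp: "riemann_problem f R \<Lambda> l l" using riemann_problem[OF l l] by blast
  interpret riemann_problem f R \<Lambda> l l by (rule rp)
  have "fan \<xi> = l" for \<xi> using fan(1)[of \<xi>] by simp
  hence e: "fan_solution t x = l" for t x by (simp add: fan_solution_def riemann_data_def)
  have "entropy_solution f R {..<0} (\<lambda>x. l) fan_solution"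
    by (rule entropy_solution_restrict[OF fan_solution _ _ f_cont R_nonneg]) (auto simp: riemann_data_def)
  moreover have "lrs_profile_in f R l F fan_solution" using True e by (simp add: lrs_profile_in_def)
  moreover have "(fan_solution t \<longlongrightarrow> l) (at_left 0)" for t
  proof -
    have "fan_solution t = (\<lambda>x. l)" using e by (simp add: fun_eq_iff)
    thus ?thesis by simp
  qed
  ultimately show thesis using that l True by blast
next
  case False
  have Fmax: "F \<le> f peak" using F omega_in_bounds(2)[OF l] by (simp add: flux_max_eq)
  have "\<exists>r. peak \<le> r \<and> r \<le> R \<and> f r = F"
    by (rule IVT2') (use Fmax F peak(1) flux_zero in \<open>auto intro: continuous_on_subset[OF continuous_flux]\<close>)
  then obtain r where rF: "peak \<le> r" "r \<le> R" "f r = F" by blast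
  have rR: "r \<in> {0..R}" using rF peak(1) by auto
  obtain \<Lambda> where rp: "riemann_problem f R \<Lambda> l r" using riemann_problem[OF l rR] by blast
  interpret riemann_problem f R \<Lambda> l r by (rule rp)
  (* For congested l by monotonicity of f; for free l because f r < f l, and f exceeds the smaller end value in between. *)
  have unique: "orient * f r < orient * f v" if v: "v \<in> states" "v \<noteq> r" for v
  proof (cases "l \<le> r")
    case True
    hence vr: "l \<le> v" "v < r" using v by auto
    have "f r < f v"
    proof (cases "peak \<le> l")
      case True thus ?thesis using flux_decreasing[of v r] vr rF by simp
    next
      case n: False
      hence "f r < f l" using F(2) rF(3) \<open>F \<noteq> f l\<close> by (simp add: omega_in_eq min_def)
      thus ?thesis using flux_strictly_quasiconcave[of l v r] vr rF l by (cases "v = l") auto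
    qed
    thus ?thesis using True by (simp add: orient_def)
  next
    case n: False
    hence "r < v" "v \<le> l" using v by auto
    thus ?thesis using flux_decreasing[of r v] rF l n by (simp add: orient_def)
  qed
  have dir: "orient * (v - r) \<le> 0" "orient * (v - r) = - \<bar>v - r\<bar>" if "v \<in> states" for v
    using that orient_cases by (auto simp: abs_if)
  (* Minimality of the fan at \<xi>, tested with r. *)
  have gap: "orient * (f (fan \<xi>) - f r) \<le> - \<xi> * \<bar>fan \<xi> - r\<bar>" for \<xi>
  proof -
    have "orient * (f (fan \<xi>) - \<xi> * fan \<xi>) \<le> orient * (f r - \<xi> * r)" by (rule fan(2)) auto
    hence "orient * (f (fan \<xi>) - f r) \<le> \<xi> * (orient * (fan \<xi> - r))" by (simp add: algebra_simps)
    thus ?thesis using dir(2)[OF fan(1)] by simp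
  qed
  have fan_pos: "fan \<xi> = r" if "0 < \<xi>" for \<xi>
  proof (rule ccontr)
    assume "fan \<xi> \<noteq> r"
    hence "0 < orient * (f (fan \<xi>) - f r)" using unique[OF fan(1)] by (simp add: algebra_simps)
    moreover have "- \<xi> * \<bar>fan \<xi> - r\<bar> \<le> 0" using that by (simp add: mult_nonneg_nonneg)
    ultimately show False using gap[of \<xi>] by linarith
  qed
  have fan_lim: "(fan \<longlongrightarrow> r) (at_left 0)"
  proof (rule tendstoI)
    fix \<epsilon> :: real assume \<epsilon>: "0 < \<epsilon>"
    (* Away from r, the strict minimality of r has a positive margin on the compact set of states. *)
    define S where "S = states \<inter> {v. \<epsilon> \<le> \<bar>v - r\<bar>}"
    have "closed {v. \<epsilon> \<le> \<bar>v - r\<bar>}" by (intro closed_Collect_le continuous_intros)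
    hence S: "compact S" unfolding S_def by (intro compact_Int_closed) auto
    obtain \<delta> where \<delta>: "0 < \<delta>" "\<And>v. v \<in> S \<Longrightarrow> \<delta> \<le> orient * (f v - f r)"
    proof (cases "S = {}")
      case True thus thesis using that[of 1] by simp
    next
      case ne: False
      have "continuous_on S (\<lambda>v. orient * (f v - f r))"
        by (intro continuous_intros continuous_on_subset[OF f_cont]) (use states_sub in \<open>auto simp: S_def\<close>)
      then obtain v where v: "v \<in> S" "\<forall>w\<in>S. orient * (f v - f r) \<le> orient * (f w - f r)"
        using continuous_attains_inf[OF S ne] by blast
      have "v \<in> states" "v \<noteq> r" using v(1) \<epsilon> by (auto simp: S_def)
      hence "0 < orient * (f v - f r)" using unique by (simp add: algebra_simps)
      thus thesis using that v(2) by blast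
    qed
    define d where "d = \<delta> / (R + 1)"
    have d: "0 < d" using \<delta>(1) R_nonneg by (simp add: d_def)
    show "\<forall>\<^sub>F \<xi> in at_left 0. dist (fan \<xi>) r < \<epsilon>"
    proof (rule eventually_at_leftI[of "- d"])
      fix \<xi> assume \<xi>: "\<xi> \<in> {- d<..<0}"
      show "dist (fan \<xi>) r < \<epsilon>"
      proof (rule ccontr)
        assume "\<not> ?thesis"
        hence "fan \<xi> \<in> S" using fan(1)[of \<xi>] by (simp add: S_def dist_real_def)
        hence "\<delta> \<le> - \<xi> * \<bar>fan \<xi> - r\<bar>" using \<delta>(2) gap[of \<xi>] by force
        also have "\<dots> \<le> - \<xi> * R" using fan_range[of \<xi>] rR \<xi> by (intro mult_left_mono) auto
        also have "\<dots> \<le> d * R" using \<xi> R_nonneg by (intro mult_right_mono) auto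
        also have "\<dots> < \<delta>" using \<delta>(1) R_nonneg by (simp add: d_def field_simps)
        finally show False by simp
      qed
    qed (use d in simp)
  qed
  have "entropy_solution f R {..<0} (\<lambda>x. l) fan_solution"
    by (rule entropy_solution_restrict[OF fan_solution _ _ f_cont R_nonneg]) (auto simp: riemann_data_def)
  moreover have "lrs_profile_in f R l F fan_solution"
  proof -
    have "fan_solution t x = r" if "0 < t" "0 < x" for t x using that fan_pos[of "x / t"] by (simp add: fan_solution_def)
    hence "\<forall>t>0. AE x in lborel. 0 < x \<longrightarrow> fan_solution t x = r" by simp
    thus ?thesis unfolding lrs_profile_in_def using False rR rF(3) fan_solution by auto
  qed
  moreover have "(fan_solution t \<longlongrightarrow> r) (at_left 0)" if t: "0 < t" for t
  proof (rule Lim_transform_eventually)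
    have "filterlim (\<lambda>x. x / t) (at_left 0) (at_left 0)"
      unfolding filterlim_at
    proof
      show "\<forall>\<^sub>F x in at_left 0. x / t \<in> {..<0} \<and> x / t \<noteq> 0"
        by (rule eventually_at_leftI[of "-1"]) (use t in \<open>auto simp: divide_neg_pos\<close>)
      have "((\<lambda>x. x / t) \<longlongrightarrow> 0 / t) (at_left 0)" by (intro tendsto_intros) (use t in auto)
      thus "((\<lambda>x. x / t) \<longlongrightarrow> 0) (at_left 0)" by simp
    qed
    from filterlim_compose[OF fan_lim this] show "((\<lambda>x. fan (x / t)) \<longlongrightarrow> r) (at_left 0)" .
    show "\<forall>\<^sub>F x in at_left 0. fan (x / t) = fan_solution t x"
      using t by (simp add: fan_solution_def)
  qed
  ultimately show thesis using rR rF False by (intro that[of fan_solution r]) simp_all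
qed

text \<open>The two properties of traces that the analysis of the junction needs.\<close>

lemma incoming_trace:
  assumes sol: "entropy_solution f R {..<0} (\<lambda>x. l) \<rho>" and l: "l \<in> {0..R}"
    and tr: "AE t in lborel. 0 < t \<longrightarrow> (\<exists>\<beta>. (\<rho> t \<longlongrightarrow> \<beta>) (at_left 0))"
  obtains b where "b \<in> borel_measurable borel" "\<And>t. b t \<in> {0..R}"
    "AE t in lborel. 0 < t \<longrightarrow> (\<rho> t \<longlongrightarrow> b t) (at_left 0)"
    "AE t in lborel. 0 < t \<longrightarrow> omega_in f R l \<le> omega_in f R (b t)"
    "\<And>T. l \<le> peak \<Longrightarrow> 0 \<le> T \<Longrightarrow> (LINT t:{0..T}|lborel. f (b t) - f l) \<le> 0"
proof -
  obtain b where ts: "trace_solution f R l (left_extension \<rho>) b"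
    and b: "AE t in lborel. 0 < t \<longrightarrow> (\<rho> t \<longlongrightarrow> b t) (at_left 0)"
    using entropy_trace_solution[OF sol _ continuous_flux tr] R_pos by (metis less_imp_le)
  have l0: "0 \<le> l" using l by simp
  show thesis
    by (rule that[OF trace_solutionD(3)[OF ts] trace_solutionD(4)[OF ts] b demand_not_reduced[OF ts l0]
          free_trace_flux[OF ts l0]])
qed

end

section \<open>Outgoing roads by reflection\<close>

text \<open>Lebesgue measure on the plane is a product of two measures that are invariant under reflection.\<close>

lemma plane_integral_reflect:
  fixes g :: "real \<times> real \<Rightarrow> real"
  shows "(LINT p|lborel. g p) = (LINT p|lborel. g (fst p, - snd p))"
proof -
  let ?T = "\<lambda>p::real \<times> real. (fst p, - snd p)"
  have T: "?T \<in> borel_measurable borel" by (intro borel_measurable_continuous_onI continuous_intros)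
  have "distr lborel lborel (\<lambda>x::real. x) \<Otimes>\<^sub>M distr lborel lborel (uminus :: real \<Rightarrow> real)
      = distr (lborel \<Otimes>\<^sub>M lborel) (lborel \<Otimes>\<^sub>M lborel) (\<lambda>(x, y). (x, - y))"
  proof (rule pair_measure_distr)
    have "distr lborel lborel (uminus :: real \<Rightarrow> real) = distr lborel borel uminus" by (rule distr_cong) auto
    thus "sigma_finite_measure (distr lborel lborel (uminus :: real \<Rightarrow> real))"
      by (simp add: lborel_distr_uminus lborel.sigma_finite_measure_axioms)
  qed auto
  moreover have "distr lborel lborel (\<lambda>x::real. x) = lborel" by (rule distr_id2) simp
  moreover have "distr lborel lborel (uminus :: real \<Rightarrow> real) = lborel"
    using lborel_distr_uminus distr_cong[of lborel lborel lborel borel "uminus :: real \<Rightarrow> real" uminus] by simp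
  ultimately have D: "lborel = distr lborel lborel ?T"
    by (simp add: lborel_prod case_prod_unfold)
  show ?thesis
  proof (cases "g \<in> borel_measurable borel")
    case True
    have "(LINT p|lborel. g p) = (LINT p|distr lborel lborel ?T. g p)" using D by simp
    also have "\<dots> = (LINT p|lborel. g (?T p))" by (rule integral_distr) (use T True in auto)
    finally show ?thesis .
  next
    case False
    have "(\<lambda>p. g (?T p)) \<notin> borel_measurable borel"
    proof
      assume "(\<lambda>p. g (?T p)) \<in> borel_measurable borel"
      from measurable_compose[OF T this] show False using False by simp
    qed
    hence "\<not> integrable lborel g" "\<not> integrable lborel (\<lambda>p. g (?T p))"
      using False borel_measurable_integrable by fastforce+
    thus ?thesis by (simp add: not_integrable_integral_eq)
  qed
qed

lemma AE_reflect:
  assumes "AE x in lborel. P x" shows "AE x in lborel. P (- x :: real)"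
proof -
  have "AE x in distr lborel borel uminus. P x" using assms unfolding lborel_distr_uminus .
  thus ?thesis by (rule AE_distrD[rotated]) simp
qed

text \<open>The map \<open>u(t, x) \<mapsto> R - u(t, - x)\<close> turns solutions for the flux \<open>f\<close> into solutions for \<open>v \<mapsto> f (R - v)\<close>. It exchanges left and right as
well as free and congested states, hence incoming and outgoing roads. The initial value at \<open>x = 0\<close> is exempt because
Riemann data are not symmetric there.\<close>

lemma entropy_solution_reflect:
  assumes sol: "entropy_solution f R D u0 u" and D: "D \<in> sets borel" "\<And>x. x \<in> D' \<longleftrightarrow> - x \<in> D"
    and R: "0 \<le> R" and u0: "\<And>x. x \<noteq> 0 \<Longrightarrow> x \<in> D' \<Longrightarrow> u0' x = R - u0 (- x)"
  shows "entropy_solution (\<lambda>v. f (R - v)) R D' u0' (\<lambda>t x. R - u t (- x))"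
proof -
  let ?T = "\<lambda>p::real \<times> real. (fst p, - snd p)"
  have T: "?T \<in> borel_measurable borel" by (intro borel_measurable_continuous_onI continuous_intros)
  have D': "D' \<in> sets borel"
  proof -
    have "uminus -` D \<inter> space borel \<in> sets (borel :: real measure)"
      by (rule measurable_sets[of uminus borel borel]) (use D in auto)
    moreover have "uminus -` D \<inter> space borel = D'" using D(2) by auto
    ultimately show ?thesis by simp
  qed
  have s: "{0::real..} \<times> D' \<in> sets borel"
    using D' unfolding borel_prod[symmetric] by (auto intro!: pair_measureI)
  have "(\<lambda>p. indicator ({0..} \<times> D) p *\<^sub>R u (fst p) (snd p)) \<in> borel_measurable borel"
    using sol unfolding entropy_solution_def set_borel_measurable_def by simp
  from measurable_compose[OF T this]
  have m: "(\<lambda>p. indicator ({0..} \<times> D) (?T p) *\<^sub>R u (fst p) (- snd p)) \<in> borel_measurable borel" by simp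
  have 1: "set_borel_measurable lborel ({0..} \<times> D') (\<lambda>p. R - u (fst p) (- snd p))"
  proof -
    have "(\<lambda>p. indicator ({0..} \<times> D') p * R - indicator ({0..} \<times> D) (?T p) *\<^sub>R u (fst p) (- snd p)) \<in> borel_measurable borel"
      by (intro borel_measurable_diff borel_measurable_times borel_measurable_indicator s m) auto
    also have "(\<lambda>p. indicator ({0..} \<times> D') p * R - indicator ({0..} \<times> D) (?T p) *\<^sub>R u (fst p) (- snd p))
        = (\<lambda>p. indicator ({0..} \<times> D') p *\<^sub>R (R - u (fst p) (- snd p)))"
      using D(2) by (auto simp: fun_eq_iff indicator_def)
    finally show ?thesis unfolding set_borel_measurable_def by simp
  qed
  have 2: "\<And>t x. 0 \<le> t \<Longrightarrow> x \<in> D' \<Longrightarrow> R - u t (- x) \<in> {0..R}"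
    using sol D(2) unfolding entropy_solution_def by auto
  have 3: "((\<lambda>t. LINT x:D' \<inter> {-L..L}|lborel. \<bar>(R - u t (- x)) - (R - u t0 (- x))\<bar>) \<longlongrightarrow> 0) (at t0 within {0..})"
    if "0 \<le> t0" for t0 L
  proof -
    have "(LINT x:D' \<inter> {-L..L}|lborel. \<bar>(R - u t (- x)) - (R - u t0 (- x))\<bar>)
        = (LINT x:D \<inter> {-L..L}|lborel. \<bar>u t x - u t0 x\<bar>)" for t
    proof -
      have "(LINT x:D \<inter> {-L..L}|lborel. \<bar>u t x - u t0 x\<bar>)
          = (LINT x|lborel. indicator (D \<inter> {-L..L}) (- x) *\<^sub>R \<bar>u t (- x) - u t0 (- x)\<bar>)"
        unfolding set_lebesgue_integral_def
        using lborel_integral_real_affine[of "-1" "\<lambda>x. indicator (D \<inter> {-L..L}) x *\<^sub>R \<bar>u t x - u t0 x\<bar>" 0] by simp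
      also have "\<dots> = (LINT x:D' \<inter> {-L..L}|lborel. \<bar>(R - u t (- x)) - (R - u t0 (- x))\<bar>)"
        unfolding set_lebesgue_integral_def
        by (intro Bochner_Integration.integral_cong) (use D(2) in \<open>auto simp: indicator_def\<close>)
      finally show ?thesis by simp
    qed
    moreover have "((\<lambda>t. LINT x:D \<inter> {-L..L}|lborel. \<bar>u t x - u t0 x\<bar>) \<longlongrightarrow> 0) (at t0 within {0..})"
      using sol that unfolding entropy_solution_def by blast
    ultimately show ?thesis by simp
  qed
  have 4: "AE x in lborel. x \<in> D' \<longrightarrow> R - u 0 (- x) = u0' x"
  proof -
    have "AE x in lborel. x \<in> D \<longrightarrow> u 0 x = u0 x" using sol unfolding entropy_solution_def by blast
    from AE_reflect[OF this] AE_lborel_singleton[of "0::real"]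
    show ?thesis by eventually_elim (use D(2) u0 in auto)
  qed
  have 5: "0 \<le> (LINT p:{0<..} \<times> D'|lborel. \<bar>(R - u (fst p) (- snd p)) - k\<bar> * \<phi>t p
      + sgn ((R - u (fst p) (- snd p)) - k) * (f (R - (R - u (fst p) (- snd p))) - f (R - k)) * \<phi>x p)"
    if k: "k \<in> {0..R}" and \<phi>: "test_function D' \<phi> \<phi>t \<phi>x" for k \<phi> \<phi>t \<phi>x
  proof -
    have k': "R - k \<in> {0..R}" using k by auto
    have \<phi>': "test_function D (\<lambda>p. \<phi> (?T p)) (\<lambda>p. \<phi>t (?T p)) (\<lambda>p. - \<phi>x (?T p))"
    proof -
      obtain K where K: "compact K" "K \<subseteq> {0<..} \<times> D'" "\<And>p. p \<notin> K \<Longrightarrow> \<phi> p = 0"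
        using \<phi> unfolding test_function_def by blast
      have "compact (?T ` K)" by (intro compact_continuous_image continuous_intros K(1))
      moreover have "?T ` K \<subseteq> {0<..} \<times> D" using K(2) D(2) by auto
      moreover have "\<phi> (?T p) = 0" if "p \<notin> ?T ` K" for p
      proof (rule K(3))
        show "?T p \<notin> K"
        proof
          assume "?T p \<in> K"
          hence "?T (?T p) \<in> ?T ` K" by (rule imageI)
          thus False using that by simp
        qed
      qed
      moreover have "((\<lambda>p. \<phi> (?T p)) has_derivative (\<lambda>h. \<phi>t (?T p) * fst h + - \<phi>x (?T p) * snd h)) (at p)" for p
      proof -
        have 1: "(\<phi> has_derivative (\<lambda>h. \<phi>t (?T p) * fst h + \<phi>x (?T p) * snd h)) (at (?T p))"
          using \<phi> unfolding test_function_def by blast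
        have 2: "(?T has_derivative ?T) (at p)" by (auto intro!: derivative_eq_intros)
        show ?thesis
          by (rule has_derivative_eq_rhs[OF has_derivative_compose[OF 2 1]]) (auto simp: algebra_simps)
      qed
      moreover have "continuous_on UNIV (\<lambda>p. g (?T p))" if "continuous_on UNIV g" for g :: "real \<times> real \<Rightarrow> real"
        by (rule continuous_on_compose2[OF that]) (auto intro!: continuous_intros)
      hence "continuous_on UNIV (\<lambda>p. \<phi>t (?T p))" "continuous_on UNIV (\<lambda>p. - \<phi>x (?T p))"
        using \<phi> unfolding test_function_def by (auto intro!: continuous_intros)
      moreover have "0 \<le> \<phi> (?T p)" for p using \<phi> unfolding test_function_def by blast
      ultimately show ?thesis unfolding test_function_def by blast
    qed
    have "0 \<le> (LINT p:{0<..} \<times> D|lborel. \<bar>u (fst p) (snd p) - (R - k)\<bar> * \<phi>t (?T p)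
        + sgn (u (fst p) (snd p) - (R - k)) * (f (u (fst p) (snd p)) - f (R - k)) * - \<phi>x (?T p))"
      using sol k' \<phi>' unfolding entropy_solution_def by blast
    also have "\<dots> = (LINT p:{0<..} \<times> D'|lborel. \<bar>(R - u (fst p) (- snd p)) - k\<bar> * \<phi>t p
      + sgn ((R - u (fst p) (- snd p)) - k) * (f (R - (R - u (fst p) (- snd p))) - f (R - k)) * \<phi>x p)"
      unfolding set_lebesgue_integral_def
    proof (subst plane_integral_reflect, rule Bochner_Integration.integral_cong[OF refl])
      fix p :: "real \<times> real"
      have i: "indicator ({0<..} \<times> D) (?T p) = (indicator ({0<..} \<times> D') p :: real)"
        using D(2) by (auto simp: indicator_def mem_Times_iff)
      have s: "sgn ((R - u (fst p) (- snd p)) - k) = - sgn (u (fst p) (- snd p) - (R - k))"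
        "\<bar>(R - u (fst p) (- snd p)) - k\<bar> = \<bar>u (fst p) (- snd p) - (R - k)\<bar>"
        by (auto simp: sgn_if)
      show "indicator ({0<..} \<times> D) (?T p) *\<^sub>R (\<bar>u (fst (?T p)) (snd (?T p)) - (R - k)\<bar> * \<phi>t (?T (?T p))
        + sgn (u (fst (?T p)) (snd (?T p)) - (R - k)) * (f (u (fst (?T p)) (snd (?T p))) - f (R - k)) * - \<phi>x (?T (?T p)))
        = indicator ({0<..} \<times> D') p *\<^sub>R (\<bar>(R - u (fst p) (- snd p)) - k\<bar> * \<phi>t p
      + sgn ((R - u (fst p) (- snd p)) - k) * (f (R - (R - u (fst p) (- snd p))) - f (R - k)) * \<phi>x p)"
        unfolding i s by simp
    qed
    finally show ?thesis .
  qed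
  show ?thesis
    unfolding entropy_solution_def
    by (intro conjI allI ballI impI) (rule 1 2 3 4 5; assumption)+
qed

lemma tendsto_reflect:
  fixes \<rho> :: "real \<Rightarrow> real"
  shows "((\<lambda>x. R - \<rho> (- x)) \<longlongrightarrow> \<beta>) (at_left 0) \<longleftrightarrow> (\<rho> \<longlongrightarrow> R - \<beta>) (at_right 0)"
    and "((\<lambda>x. R - \<rho> (- x)) \<longlongrightarrow> \<beta>) (at_right 0) \<longleftrightarrow> (\<rho> \<longlongrightarrow> R - \<beta>) (at_left 0)"
proof -
  have *: "((\<lambda>x. R - g x) \<longlongrightarrow> \<beta>) G \<longleftrightarrow> (g \<longlongrightarrow> R - \<beta>) G" for g :: "real \<Rightarrow> real" and G
    using tendsto_diff[OF tendsto_const, of "\<lambda>x. R - g x" \<beta> G R] tendsto_diff[OF tendsto_const, of g "R - \<beta>" G R] by auto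
  show "((\<lambda>x. R - \<rho> (- x)) \<longlongrightarrow> \<beta>) (at_left 0) \<longleftrightarrow> (\<rho> \<longlongrightarrow> R - \<beta>) (at_right 0)"
    using *[of "\<lambda>x. \<rho> (- x)" "at_left 0"] filterlim_at_left_to_right[of "\<lambda>x. \<rho> (- x)" "nhds (R - \<beta>)" 0] by simp
  show "((\<lambda>x. R - \<rho> (- x)) \<longlongrightarrow> \<beta>) (at_right 0) \<longleftrightarrow> (\<rho> \<longlongrightarrow> R - \<beta>) (at_left 0)"
    using *[of "\<lambda>x. \<rho> (- x)" "at_right 0"] filterlim_at_left_to_right[of \<rho> "nhds (R - \<beta>)" 0] by simp
qed

context concave_road begin

abbreviation mirror :: "real \<Rightarrow> real" where "mirror \<equiv> (\<lambda>v. f (R - v))"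

lemma concave_mirror: "concave_flux mirror R"
proof -
  obtain f' f'' where f': "\<And>r. r\<in>{0..R} \<Longrightarrow> (f has_real_derivative f' r) (at r within {0..R})"
    and f'': "\<And>r. r\<in>{0..R} \<Longrightarrow> (f' has_real_derivative f'' r) (at r within {0..R})"
    and neg: "\<And>r. r\<in>{0..R} \<Longrightarrow> f'' r < 0" and c: "continuous_on {0..R} f''"
    using concave unfolding concave_flux_def by blast
  have im: "(\<lambda>v. R - v) ` {0..R} = {0..R}" by (auto simp: image_iff intro!: bexI[of _ "R - _"])
  have d: "((\<lambda>v. g (R - v)) has_real_derivative - g' (R - r)) (at r within {0..R})"
    if "\<And>r. r\<in>{0..R} \<Longrightarrow> (g has_real_derivative g' r) (at r within {0..R})" "r \<in> {0..R}" for g g' r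
  proof -
    have 1: "((\<lambda>v. R - v) has_real_derivative - 1) (at r within {0..R})" by (auto intro!: derivative_eq_intros)
    have 2: "(g has_real_derivative g' (R - r)) (at (R - r) within (\<lambda>v. R - v) ` {0..R})"
      unfolding im using that by auto
    show ?thesis using DERIV_image_chain[OF 2 1] by (simp add: o_def)
  qed
  have "(mirror has_real_derivative - f' (R - r)) (at r within {0..R})" if "r \<in> {0..R}" for r
    by (rule d[OF f' that])
  moreover have "((\<lambda>v. - f' (R - v)) has_real_derivative f'' (R - r)) (at r within {0..R})" if "r \<in> {0..R}" for r
    using DERIV_minus[OF d[OF f'' that]] by simp
  moreover have "f'' (R - r) < 0" if "r \<in> {0..R}" for r using neg[of "R - r"] that by auto
  moreover have "continuous_on {0..R} (\<lambda>v. f'' (R - v))"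
    by (rule continuous_on_compose2[OF c]) (auto intro!: continuous_intros)
  ultimately show ?thesis
    unfolding concave_flux_def using R_pos flux_zero by (intro conjI exI[of _ "\<lambda>v. - f' (R - v)"] exI[of _ "\<lambda>v. f'' (R - v)"]) auto
qed

interpretation mirror: concave_road mirror R
  by unfold_locales (rule concave_mirror)

lemma mirror_peak: "density_max mirror R = R - peak"
proof (rule ccontr)
  assume n: "density_max mirror R \<noteq> R - peak"
  have "f (R - (R - peak)) \<le> f (R - density_max mirror R)" by (rule mirror.peak(2)) (use peak(1) in auto)
  moreover have "f (R - density_max mirror R) < f peak"
    by (rule flux_less_peak) (use n mirror.peak(1) in auto)
  ultimately show False by simp
qed

lemma mirror_flux_max: "flux_max mirror R = flux_max f R"
  using mirror.flux_max_eq flux_max_eq mirror_peak by simp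

lemma omega_out_mirror: "omega_out f R r = omega_in mirror R (R - r)"
  by (simp add: omega_out_def omega_in_def mirror_peak mirror_flux_max)

lemma profile_out_mirror:
  assumes "lrs_profile_out f R r F u"
  shows "lrs_profile_in mirror R (R - r) F (\<lambda>t x. R - u t (- x))"
proof (cases "F = f r")
  case True thus ?thesis using assms by (simp add: lrs_profile_out_def lrs_profile_in_def)
next
  case False
  then obtain l v where l: "l \<in> {0..R}" "f l = F" and v: "entropy_solution f R UNIV (riemann_data l r) v"
    and left: "\<And>t. 0 < t \<Longrightarrow> AE x in lborel. x < 0 \<longrightarrow> v t x = l"
    and u: "\<And>t x. 0 < t \<Longrightarrow> 0 < x \<Longrightarrow> u t x = v t x"
    using assms unfolding lrs_profile_out_def by auto
  have "entropy_solution mirror R UNIV (riemann_data (R - r) (R - l)) (\<lambda>t x. R - v t (- x))"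
    by (rule entropy_solution_reflect[OF v]) (use R_pos in \<open>auto simp: riemann_data_def\<close>)
  moreover have "AE x in lborel. 0 < x \<longrightarrow> R - v t (- x) = R - l" if "0 < t" for t
    using AE_reflect[OF left[OF that]] by eventually_elim auto
  moreover have "R - l \<in> {0..R}" using l by auto
  ultimately show ?thesis
    unfolding lrs_profile_in_def using False l u
    by (auto intro!: bexI[of _ "R - l"] exI[of _ "\<lambda>t x. R - v t (- x)"])
qed

lemma profile_in_mirror:
  assumes "lrs_profile_in mirror R (R - r) F u"
  shows "lrs_profile_out f R r F (\<lambda>t x. R - u t (- x))"
proof (cases "F = f r")
  case True thus ?thesis using assms by (simp add: lrs_profile_out_def lrs_profile_in_def)
next
  case False
  then obtain l v where l: "l \<in> {0..R}" "f (R - l) = F" and v: "entropy_solution mirror R UNIV (riemann_data (R - r) l) v"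
    and right: "\<And>t. 0 < t \<Longrightarrow> AE x in lborel. 0 < x \<longrightarrow> v t x = l"
    and u: "\<And>t x. 0 < t \<Longrightarrow> x < 0 \<Longrightarrow> u t x = v t x"
    using assms unfolding lrs_profile_in_def by auto
  have "entropy_solution (\<lambda>v. mirror (R - v)) R UNIV (riemann_data (R - l) r) (\<lambda>t x. R - v t (- x))"
    by (rule entropy_solution_reflect[OF v]) (use R_pos in \<open>auto simp: riemann_data_def\<close>)
  hence "entropy_solution f R UNIV (riemann_data (R - l) r) (\<lambda>t x. R - v t (- x))" by simp
  moreover have "AE x in lborel. x < 0 \<longrightarrow> R - v t (- x) = R - l" if "0 < t" for t
    using AE_reflect[OF right[OF that]] by eventually_elim auto
  moreover have "R - l \<in> {0..R}" using l by auto
  ultimately show ?thesis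
    unfolding lrs_profile_out_def using False l u
    by (auto intro!: bexI[of _ "R - l"] exI[of _ "\<lambda>t x. R - v t (- x)"])
qed

lemma mirror_outgoing:
  assumes "entropy_solution f R {0<..} (\<lambda>x. r) \<rho>"
  shows "entropy_solution mirror R {..<0} (\<lambda>x. R - r) (\<lambda>t x. R - \<rho> t (- x))"
  by (rule entropy_solution_reflect[OF assms]) (use R_pos in auto)

lemma outgoing_unique:
  assumes sol: "entropy_solution f R {0<..} (\<lambda>x. r) \<rho>" and r: "r \<in> {0..R}"
    and tr: "AE t in lborel. 0 < t \<longrightarrow> (\<exists>\<beta>. (\<rho> t \<longlongrightarrow> \<beta>) (at_right 0) \<and> f \<beta> = F)"
    and prof: "lrs_profile_out f R r F \<rho>h" and t: "0 < t"
  shows "AE x in lborel. 0 < x \<longrightarrow> \<rho> t x = \<rho>h t x"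
proof -
  have tr': "AE t in lborel. 0 < t \<longrightarrow> (\<exists>\<beta>. ((\<lambda>x. R - \<rho> t (- x)) \<longlongrightarrow> \<beta>) (at_left 0) \<and> mirror \<beta> = F)"
    using tr
  proof eventually_elim
    fix t assume *: "0 < t \<longrightarrow> (\<exists>\<beta>. (\<rho> t \<longlongrightarrow> \<beta>) (at_right 0) \<and> f \<beta> = F)"
    show "0 < t \<longrightarrow> (\<exists>\<beta>. ((\<lambda>x. R - \<rho> t (- x)) \<longlongrightarrow> \<beta>) (at_left 0) \<and> mirror \<beta> = F)"
    proof
      assume "0 < t"
      then obtain \<beta> where "(\<rho> t \<longlongrightarrow> \<beta>) (at_right 0)" "f \<beta> = F" using * by blast
      thus "\<exists>\<beta>. ((\<lambda>x. R - \<rho> t (- x)) \<longlongrightarrow> \<beta>) (at_left 0) \<and> mirror \<beta> = F"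
        by (intro exI[of _ "R - \<beta>"]) (simp add: tendsto_reflect)
    qed
  qed
  have rR: "R - r \<in> {0..R}" using r by auto
  have "AE x in lborel. x < 0 \<longrightarrow> R - \<rho> t (- x) = R - \<rho>h t (- x)"
    by (rule mirror.incoming_unique[OF mirror_outgoing[OF sol] rR tr' profile_out_mirror[OF prof] t])
  from AE_reflect[OF this] show ?thesis by eventually_elim auto
qed

lemma outgoing_exists:
  assumes r: "r \<in> {0..R}" and F: "0 \<le> F" "F \<le> omega_out f R r"
  obtains \<rho> \<beta> where "entropy_solution f R {0<..} (\<lambda>x. r) \<rho>" "lrs_profile_out f R r F \<rho>"
    "\<beta> \<in> {0..R}" "f \<beta> = F" "F = f r \<Longrightarrow> \<beta> = r" "F \<noteq> f r \<Longrightarrow> \<beta> \<le> peak"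
    "\<And>t. 0 < t \<Longrightarrow> (\<rho> t \<longlongrightarrow> \<beta>) (at_right 0)"
proof -
  have rR: "R - r \<in> {0..R}" using r by auto
  obtain \<rho> \<beta> where s: "entropy_solution mirror R {..<0} (\<lambda>x. R - r) \<rho>" "lrs_profile_in mirror R (R - r) F \<rho>"
    "\<beta> \<in> {0..R}" "mirror \<beta> = F" "F = mirror (R - r) \<Longrightarrow> \<beta> = R - r" "F \<noteq> mirror (R - r) \<Longrightarrow> density_max mirror R \<le> \<beta>"
    "\<And>t. 0 < t \<Longrightarrow> (\<rho> t \<longlongrightarrow> \<beta>) (at_left 0)"
    using mirror.incoming_exists[OF rR F(1) F(2)[unfolded omega_out_mirror]] by blast
  have "entropy_solution (\<lambda>v. mirror (R - v)) R {0<..} (\<lambda>x. r) (\<lambda>t x. R - \<rho> t (- x))"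
    by (rule entropy_solution_reflect[OF s(1)]) (use R_pos in auto)
  hence e: "entropy_solution f R {0<..} (\<lambda>x. r) (\<lambda>t x. R - \<rho> t (- x))" by simp
  show thesis
  proof (rule that[OF e profile_in_mirror[OF s(2)], of "R - \<beta>"])
    show "R - \<beta> \<in> {0..R}" using s(3) by auto
    show "f (R - \<beta>) = F" by (rule s(4))
    show "R - \<beta> = r" if "F = f r" using s(5) that by simp
    show "R - \<beta> \<le> peak" if "F \<noteq> f r" using s(6) that by (simp add: mirror_peak)
    show "((\<lambda>x. R - \<rho> t (- x)) \<longlongrightarrow> R - \<beta>) (at_right 0)" if "0 < t" for t
      using s(7)[OF that] by (simp add: tendsto_reflect)
  qed
qed

lemma outgoing_trace:
  assumes sol: "entropy_solution f R {0<..} (\<lambda>x. r) \<rho>" and r: "r \<in> {0..R}"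
    and tr: "AE t in lborel. 0 < t \<longrightarrow> (\<exists>\<beta>. (\<rho> t \<longlongrightarrow> \<beta>) (at_right 0))"
  obtains b where "b \<in> borel_measurable borel" "\<And>t. b t \<in> {0..R}"
    "AE t in lborel. 0 < t \<longrightarrow> (\<rho> t \<longlongrightarrow> b t) (at_right 0)"
    "AE t in lborel. 0 < t \<longrightarrow> omega_out f R r \<le> omega_out f R (b t)"
    "\<And>T. peak \<le> r \<Longrightarrow> 0 \<le> T \<Longrightarrow> (LINT t:{0..T}|lborel. f (b t) - f r) \<le> 0"
proof -
  have tr': "AE t in lborel. 0 < t \<longrightarrow> (\<exists>\<beta>. ((\<lambda>x. R - \<rho> t (- x)) \<longlongrightarrow> \<beta>) (at_left 0))"
    using tr
  proof eventually_elim
    fix t assume *: "0 < t \<longrightarrow> (\<exists>\<beta>. (\<rho> t \<longlongrightarrow> \<beta>) (at_right 0))"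
    show "0 < t \<longrightarrow> (\<exists>\<beta>. ((\<lambda>x. R - \<rho> t (- x)) \<longlongrightarrow> \<beta>) (at_left 0))"
    proof
      assume "0 < t"
      then obtain \<beta> where "(\<rho> t \<longlongrightarrow> \<beta>) (at_right 0)" using * by blast
      thus "\<exists>\<beta>. ((\<lambda>x. R - \<rho> t (- x)) \<longlongrightarrow> \<beta>) (at_left 0)"
        by (intro exI[of _ "R - \<beta>"]) (simp add: tendsto_reflect)
    qed
  qed
  have rR: "R - r \<in> {0..R}" using r by auto
  obtain b where b: "b \<in> borel_measurable borel" "\<And>t. b t \<in> {0..R}"
    "AE t in lborel. 0 < t \<longrightarrow> ((\<lambda>x. R - \<rho> t (- x)) \<longlongrightarrow> b t) (at_left 0)"
    "AE t in lborel. 0 < t \<longrightarrow> omega_in mirror R (R - r) \<le> omega_in mirror R (b t)"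
    "\<And>T. R - r \<le> density_max mirror R \<Longrightarrow> 0 \<le> T \<Longrightarrow> (LINT t:{0..T}|lborel. mirror (b t) - mirror (R - r)) \<le> 0"
    using mirror.incoming_trace[OF mirror_outgoing[OF sol] rR tr'] by blast
  show thesis
  proof (rule that[of "\<lambda>t. R - b t"])
    show "(\<lambda>t. R - b t) \<in> borel_measurable borel" using b(1) by simp
    show "R - b t \<in> {0..R}" for t using b(2)[of t] by auto
    show "AE t in lborel. 0 < t \<longrightarrow> (\<rho> t \<longlongrightarrow> R - b t) (at_right 0)"
      using b(3) by (simp add: tendsto_reflect)
    show "AE t in lborel. 0 < t \<longrightarrow> omega_out f R r \<le> omega_out f R (R - b t)"
      using b(4) by (simp add: omega_out_mirror)
    show "(LINT t:{0..T}|lborel. f (R - b t) - f r) \<le> 0" if "peak \<le> r" "0 \<le> T" for T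
      using b(5)[of T] that by (simp add: mirror_peak)
  qed
qed

end

section \<open>Lipschitz functions and integral inequalities\<close>

lemma antiderivative_exists:
  fixes g :: "real \<Rightarrow> real"
  assumes "continuous_on UNIV g"
  obtains P where "\<And>x. a < x \<Longrightarrow> x < b \<Longrightarrow> (P has_real_derivative g x) (at x)"
proof -
  obtain P where P: "\<And>x. x \<in> {a..b} \<Longrightarrow> (P has_vector_derivative g x) (at x within {a..b})"
    using antiderivative_continuous[of a b g] continuous_on_subset[OF assms] by auto
  have "(P has_real_derivative g x) (at x)" if "a < x" "x < b" for x
  proof -
    have "(P has_real_derivative g x) (at x within {a..b})"
      using P[of x] that by (simp add: has_real_derivative_iff_has_vector_derivative)
    moreover have "at x within {a..b} = at x" using that by (intro at_within_interior) auto
    ultimately show ?thesis by simp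
  qed
  thus thesis by (rule that)
qed

text \<open>Integrate the difference quotients of \<open>q\<close> instead: they are bounded by the Lipschitz constant, so they converge to the
derivative under the integral, and their integrals tend to the increment of \<open>q\<close>.\<close>

lemma lipschitz_FTC:
  fixes q :: "real \<Rightarrow> real"
  assumes lip: "C-lipschitz_on {0..} q" and d: "AE t in lborel. 0 < t \<longrightarrow> (q has_real_derivative q' t) (at t)"
    and q': "q' \<in> borel_measurable borel" and T: "0 \<le> T"
  shows "(LINT t:{0..T}|lborel. q' t) = q T - q 0"
proof -
  define Q where "Q = (\<lambda>t. q (max 0 t))"
  have "continuous_on {0..} q" using lip by (rule lipschitz_on_continuous_on)
  hence cQ: "continuous_on UNIV Q"
    unfolding Q_def by (rule continuous_on_compose2) (auto intro!: continuous_intros)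
  have [measurable]: "Q \<in> borel_measurable borel" "q' \<in> borel_measurable borel"
    using cQ q' by (auto intro: borel_measurable_continuous_onI)
  obtain P where P: "\<And>x. -1 < x \<Longrightarrow> x < T + 2 \<Longrightarrow> (P has_real_derivative Q x) (at x)"
    using antiderivative_exists[OF cQ] by blast
  define h where "h = (\<lambda>n. 1 / real (Suc n))"
  have h: "0 < h n" "h n \<le> 1" for n by (simp_all add: h_def)
  have h0: "filterlim h (at 0) sequentially"
    unfolding filterlim_at h_def using LIMSEQ_inverse_real_of_nat by (auto simp: inverse_eq_divide intro!: always_eventually)
  have C: "0 \<le> C" using lip by (rule lipschitz_on_nonneg)
  (* The integral of a shift minus the integral, computed with a primitive P of Q. *)
  have quot: "(LINT t|lborel. (Q (t + h n) - Q t) / h n * indicator {0..T} t)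
      = (P (T + h n) - P T) / h n - (P (0 + h n) - P 0) / h n" for n
  proof -
    have "(LINT t|lborel. (Q (t + h n) - Q t) / h n * indicator {0..T} t)
        = (P (T + h n) - P T) / h n - (P (0 + h n) - P 0) / h n"
    proof (rule integral_FTC_Icc_real[OF T])
      fix t assume t: "0 \<le> t" "t \<le> T"
      have 1: "((\<lambda>t. P (t + h n)) has_real_derivative Q (t + h n)) (at t)"
        using DERIV_shift[of P "Q (t + h n)" t "h n"] P[of "t + h n"] t h[of n] by simp
      have 2: "(P has_real_derivative Q t) (at t)" using P t by simp
      show "((\<lambda>t. (P (t + h n) - P t) / h n) has_real_derivative (Q (t + h n) - Q t) / h n) (at t)"
        by (intro DERIV_cdivide DERIV_diff 1 2)
      have "continuous_on UNIV (\<lambda>t. (Q (t + h n) - Q t) / h n)"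
        using h(1)[of n] by (intro continuous_intros continuous_on_compose2[OF cQ]) auto
      thus "isCont (\<lambda>t. (Q (t + h n) - Q t) / h n) t" by (simp add: continuous_on_eq_continuous_at)
    qed
    thus ?thesis .
  qed
  have "(\<lambda>n. LINT t|lborel. (Q (t + h n) - Q t) / h n * indicator {0..T} t)
      \<longlonglongrightarrow> (LINT t|lborel. indicator {0..T} t *\<^sub>R q' t)"
  proof (rule integral_dominated_convergence[where w = "\<lambda>t. indicator {0..T} t *\<^sub>R C"])
    show "integrable lborel (\<lambda>t. indicator {0..T} t *\<^sub>R C)" by (rule borel_integrable_compact) auto
    show "AE t in lborel. (\<lambda>n. (Q (t + h n) - Q t) / h n * indicator {0..T} t) \<longlonglongrightarrow> indicator {0..T} t *\<^sub>R q' t"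
      using d AE_lborel_singleton[of "0::real"]
    proof eventually_elim
      fix t assume dt: "0 < t \<longrightarrow> (q has_real_derivative q' t) (at t)" "t \<noteq> 0"
      show "(\<lambda>n. (Q (t + h n) - Q t) / h n * indicator {0..T} t) \<longlonglongrightarrow> indicator {0..T} t *\<^sub>R q' t"
      proof (cases "t \<in> {0..T}")
        case True
        hence t: "0 < t" using dt(2) by simp
        have "((\<lambda>y. (q (t + y) - q t) / y) \<longlongrightarrow> q' t) (at 0)" using dt(1) t by (simp add: DERIV_def)
        from filterlim_compose[OF this h0] have "(\<lambda>n. (q (t + h n) - q t) / h n) \<longlonglongrightarrow> q' t" .
        moreover have "Q (t + h n) = q (t + h n)" "Q t = q t" for n using t h(1)[of n] by (simp_all add: Q_def)
        ultimately show ?thesis using True by simp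
      qed simp
    qed
    show "AE t in lborel. norm ((Q (t + h n) - Q t) / h n * indicator {0..T} t) \<le> indicator {0..T} t *\<^sub>R C" for n
    proof (rule AE_I2)
      fix t
      have "dist (Q (t + h n)) (Q t) \<le> C * dist (max 0 (t + h n)) (max 0 t)"
        unfolding Q_def by (rule lipschitz_onD[OF lip]) auto
      also have "\<dots> \<le> C * h n" using h(1)[of n] C by (intro mult_left_mono) (auto simp: dist_real_def)
      finally have "\<bar>(Q (t + h n) - Q t) / h n\<bar> \<le> C" using h(1)[of n] by (simp add: dist_real_def field_simps)
      thus "norm ((Q (t + h n) - Q t) / h n * indicator {0..T} t) \<le> indicator {0..T} t *\<^sub>R C"
        by (cases "t \<in> {0..T}") auto
    qed
  qed measurable
  moreover have "(\<lambda>n. (P (T + h n) - P T) / h n - (P (0 + h n) - P 0) / h n) \<longlonglongrightarrow> Q T - Q 0"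
  proof -
    have "((\<lambda>y. (P (x + y) - P x) / y) \<longlongrightarrow> Q x) (at 0)" if "0 \<le> x" "x \<le> T" for x
      using P[of x] that by (simp add: DERIV_def)
    from filterlim_compose[OF this h0] have "(\<lambda>n. (P (x + h n) - P x) / h n) \<longlonglongrightarrow> Q x" if "0 \<le> x" "x \<le> T" for x
      using that by blast
    note this[of T] this[of 0]
    from tendsto_diff[OF this] show ?thesis using T by simp
  qed
  ultimately have "(LINT t|lborel. indicator {0..T} t *\<^sub>R q' t) = Q T - Q 0"
    unfolding quot by (rule LIMSEQ_unique)
  thus ?thesis using T by (simp add: set_lebesgue_integral_def Q_def)
qed

lemma gronwall_zero:
  fixes g :: "real \<Rightarrow> real"
  assumes c: "continuous_on {0..} g" and nn: "\<And>t. 0 \<le> t \<Longrightarrow> 0 \<le> g t" and K: "0 \<le> K"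
    and le: "\<And>T. 0 \<le> T \<Longrightarrow> g T \<le> K * (LINT t:{0..T}|lborel. g t)" and T: "0 \<le> T"
  shows "g T = 0"
proof -
  define Q where "Q = (\<lambda>t. g (max 0 t))"
  have cQ: "continuous_on UNIV Q"
    unfolding Q_def by (rule continuous_on_compose2[OF c]) (auto intro!: continuous_intros)
  hence iQ: "isCont Q t" for t by (simp add: continuous_on_eq_continuous_at)
  obtain P where P: "\<And>x. -1 < x \<Longrightarrow> x < T + 1 \<Longrightarrow> (P has_real_derivative Q x) (at x)"
    using antiderivative_exists[OF cQ] by blast
  have int: "(LINT t:{0..x}|lborel. g t) = P x - P 0" if "0 \<le> x" "x \<le> T" for x
  proof -
    have "(LINT t:{0..x}|lborel. g t) = (LINT t|lborel. Q t * indicator {0..x} t)"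
      unfolding set_lebesgue_integral_def
      by (intro Bochner_Integration.integral_cong) (auto simp: Q_def indicator_def)
    also have "\<dots> = P x - P 0"
      by (rule integral_FTC_Icc_real) (use that P iQ in auto)
    finally show ?thesis .
  qed
  have "exp (- K * T) * (P T - P 0) \<le> exp (- K * 0) * (P 0 - P 0)"
  proof (rule DERIV_nonpos_imp_nonincreasing[OF T])
    fix x assume x: "0 \<le> x" "x \<le> T"
    have "((\<lambda>x. exp (- K * x) * (P x - P 0)) has_real_derivative exp (- K * x) * (Q x - K * (P x - P 0))) (at x)"
      using P[of x] x by (auto intro!: derivative_eq_intros simp: algebra_simps)
    moreover have "exp (- K * x) * (Q x - K * (P x - P 0)) \<le> 0"
      using le[OF x(1)] int[OF x] x by (intro mult_nonneg_nonpos) (auto simp: Q_def)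
    ultimately show "\<exists>y. ((\<lambda>x. exp (- K * x) * (P x - P 0)) has_real_derivative y) (at x) \<and> y \<le> 0" by blast
  qed
  hence "P T - P 0 \<le> 0" by (simp add: mult_le_0_iff)
  hence "K * (P T - P 0) \<le> 0" using K by (rule mult_nonneg_nonpos[rotated])
  thus ?thesis using le[OF T] int[OF T order_refl] nn[OF T] by simp
qed

section \<open>The junction and balanced queues\<close>

locale junction =
  fixes Inc Out :: "nat set" and f :: "nat \<Rightarrow> real \<Rightarrow> real" and R :: "nat \<Rightarrow> real"
    and M :: real and c r0 :: "nat \<Rightarrow> real" and \<theta> :: "nat \<Rightarrow> nat \<Rightarrow> real"
  assumes fin: "finite Inc" "finite Out" and disj: "Inc \<inter> Out = {}"
    and flux: "k \<in> Inc \<union> Out \<Longrightarrow> concave_road (f k) (R k)"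
    and M: "0 < M" and c: "i \<in> Inc \<Longrightarrow> 0 < c i"
    and r0: "k \<in> Inc \<union> Out \<Longrightarrow> r0 k \<in> {0..R k}"
    and \<theta>: "i \<in> Inc \<Longrightarrow> j \<in> Out \<Longrightarrow> 0 \<le> \<theta> i j" "i \<in> Inc \<Longrightarrow> j \<in> Out \<Longrightarrow> \<theta> i j \<le> 1"
begin

abbreviation demand :: "nat \<Rightarrow> real" where "demand i \<equiv> omega_in (f i) (R i) (r0 i)"
abbreviation out_supply :: "nat \<Rightarrow> real" where "out_supply j \<equiv> omega_out (f j) (R j) (r0 j)"
abbreviation level :: real where "level \<equiv> lrs_level Inc Out f R M c \<theta> r0"
abbreviation F_in :: "nat \<Rightarrow> real" where "F_in \<equiv> lrs_flux_in Inc Out f R M c \<theta> r0"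
abbreviation F_out :: "nat \<Rightarrow> real" where "F_out \<equiv> lrs_flux_out Inc Out f R M c \<theta> r0"

lemma demand_nonneg: "i \<in> Inc \<Longrightarrow> 0 \<le> demand i"
  using concave_road.omega_in_bounds(1)[OF flux] r0 by blast

lemma omega_out_bounds:
  assumes "j \<in> Out" "u \<in> {0..R j}"
  shows "0 \<le> omega_out (f j) (R j) u" "f j u \<le> omega_out (f j) (R j) u" "omega_out (f j) (R j) u \<le> flux_max (f j) (R j)"
proof -
  interpret concave_road "f j" "R j" using assms by (intro flux) auto
  show "0 \<le> omega_out (f j) (R j) u" "f j u \<le> omega_out (f j) (R j) u" "omega_out (f j) (R j) u \<le> flux_max (f j) (R j)"
    using flux_nonneg[OF assms(2)] flux_nonneg[OF peak(1)] peak(2)[OF assms(2)]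
    by (auto simp: omega_out_def flux_max_eq)
qed

text \<open>The set whose maximum is the level of the limit Riemann solver.\<close>

definition feasible :: "real \<Rightarrow> bool" where
  "feasible s \<longleftrightarrow> s \<in> {0..M} \<and> (\<forall>j\<in>Out. (\<Sum>i\<in>Inc. lrs_gamma f R c r0 i s * \<theta> i j) \<le> out_supply j)"

lemma level: "feasible level" "feasible s \<Longrightarrow> s \<le> level"
proof -
  have cont: "continuous_on UNIV (\<lambda>s. \<Sum>i\<in>Inc. lrs_gamma f R c r0 i s * \<theta> i j)" for j
    unfolding lrs_gamma_def by (intro continuous_intros)
  have e: "Collect feasible = {0..M} \<inter> (\<Inter>j\<in>Out. {s. (\<Sum>i\<in>Inc. lrs_gamma f R c r0 i s * \<theta> i j) \<le> out_supply j})"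
    by (auto simp: feasible_def)
  have "compact (Collect feasible)"
    unfolding e by (intro compact_Int_closed closed_INT ballI closed_Collect_le cont continuous_intros) auto
  moreover have "feasible 0"
  proof -
    have "lrs_gamma f R c r0 i 0 = 0" if "i \<in> Inc" for i
      using demand_nonneg[OF that] by (simp add: lrs_gamma_def)
    thus ?thesis using M omega_out_bounds(1) r0 by (simp add: feasible_def)
  qed
  ultimately obtain s where s: "feasible s" "\<And>s'. feasible s' \<Longrightarrow> s' \<le> s"
    using compact_attains_sup[of "Collect feasible"] by auto
  have "level = s"
    unfolding lrs_level_def feasible_def[symmetric] by (rule Greatest_equality) (use s in auto)
  thus "feasible level" "feasible s \<Longrightarrow> s \<le> level" for s using s by auto
qed

lemma level_range: "0 \<le> level" "level \<le> M" using level(1) by (auto simp: feasible_def)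

lemma F_in_eq: "F_in i = min (c i * level) (demand i)"
  by (simp add: lrs_flux_in_def lrs_gamma_def)

lemma F_out_le: "j \<in> Out \<Longrightarrow> F_out j \<le> out_supply j"
  using level(1) by (simp add: feasible_def lrs_flux_out_def lrs_flux_in_def)

lemma F_in_nonneg: "i \<in> Inc \<Longrightarrow> 0 \<le> F_in i"
  using demand_nonneg c[of i] level_range by (simp add: F_in_eq)

lemma F_out_nonneg: "j \<in> Out \<Longrightarrow> 0 \<le> F_out j"
  unfolding lrs_flux_out_def by (intro sum_nonneg mult_nonneg_nonneg F_in_nonneg \<theta>)

text \<open>By continuity the level could otherwise be raised.\<close>

lemma some_supply_exhausted:
  assumes "level < M" obtains j where "j \<in> Out" "F_out j = out_supply j"
proof -
  have "\<exists>j\<in>Out. F_out j = out_supply j"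
  proof (rule ccontr)
    assume "\<not> ?thesis"
    hence less: "F_out j < out_supply j" if "j \<in> Out" for j using F_out_le[OF that] that by force
    have "\<forall>\<^sub>F s in at_right level. (\<Sum>i\<in>Inc. lrs_gamma f R c r0 i s * \<theta> i j) < out_supply j" if "j \<in> Out" for j
    proof (rule order_tendstoD(2))
      have "continuous_on UNIV (\<lambda>s. \<Sum>i\<in>Inc. lrs_gamma f R c r0 i s * \<theta> i j)"
        unfolding lrs_gamma_def by (intro continuous_intros)
      hence "isCont (\<lambda>s. \<Sum>i\<in>Inc. lrs_gamma f R c r0 i s * \<theta> i j) level" by (simp add: continuous_on_eq_continuous_at)
      thus "((\<lambda>s. \<Sum>i\<in>Inc. lrs_gamma f R c r0 i s * \<theta> i j) \<longlongrightarrow> F_out j) (at_right level)"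
        unfolding isCont_def lrs_flux_out_def lrs_flux_in_def by (rule tendsto_within_subset) auto
    qed (rule less[OF that])
    hence "\<forall>\<^sub>F s in at_right level. \<forall>j\<in>Out. (\<Sum>i\<in>Inc. lrs_gamma f R c r0 i s * \<theta> i j) < out_supply j"
      using fin by (intro eventually_ball_finite) auto
    moreover have "\<forall>\<^sub>F s in at_right level. level < s \<and> s < M"
      using assms by (intro eventually_at_rightI[of level M]) auto
    ultimately have "\<forall>\<^sub>F s in at_right level. level < s \<and> feasible s"
      by eventually_elim (use level_range in \<open>force simp: feasible_def\<close>)
    then obtain s where "level < s" "feasible s" using eventually_happens by force
    thus False using level(2)[of s] by simp
  qed
  thus thesis using that by blast
qed

text \<open>The queues leave exactly the free space \<open>level\<close> in the buffer, so that the inflows are those of the limit Riemann solver. A queue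
may be present only in front of a road whose supply is exhausted: there the queue demands the maximal outflow, which
then equals the inflow, and the queue does not move.\<close>

definition balancing_queues :: "(nat \<Rightarrow> real) \<Rightarrow> bool" where
  "balancing_queues q0 \<longleftrightarrow> (\<forall>j\<in>Out. 0 \<le> q0 j \<and> (0 < q0 j \<longrightarrow> F_out j = out_supply j)) \<and> (\<Sum>j\<in>Out. q0 j) = M - level"

text \<open>All waiting cars can be placed in front of one road whose supply is exhausted.\<close>

lemma balancing_queues_exist: obtains q0 where "balancing_queues q0"
proof (cases "level = M")
  case True
  hence "balancing_queues (\<lambda>_. 0)" by (simp add: balancing_queues_def)
  thus thesis by (rule that)
next
  case False
  hence less: "level < M" using level_range by simp
  then obtain j where j: "j \<in> Out" "F_out j = out_supply j" using some_supply_exhausted by blast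
  have "balancing_queues (\<lambda>k. if k = j then M - level else 0)"
    using j less fin by (auto simp: balancing_queues_def)
  thus thesis by (rule that)
qed

lemma balancing_admissible: "balancing_queues q0 \<Longrightarrow> admissible_queues Out M q0"
  using level_range by (auto simp: balancing_queues_def admissible_queues_def)

text \<open>With constant queues the laws at the junction decouple into prescribed boundary fluxes on the single roads.\<close>

lemma solutions_exist:
  assumes q0: "balancing_queues q0"
  obtains \<rho> where "buffer_solution Inc Out f R M c \<theta> r0 q0 \<rho> (\<lambda>j t. q0 j)" "lrs_solution Inc Out f R M c \<theta> r0 \<rho>"
proof -
  have "\<forall>i\<in>Inc. \<exists>\<rho> \<beta>. entropy_solution (f i) (R i) {..<0} (\<lambda>x. r0 i) \<rho> \<and> lrs_profile_in (f i) (R i) (r0 i) (F_in i) \<rho> \<and>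
    (\<forall>t>0. (\<rho> t \<longlongrightarrow> \<beta>) (at_left 0)) \<and> f i \<beta> = F_in i \<and> f i \<beta> = min (omega_in (f i) (R i) \<beta>) (c i * level)"
  proof
    fix i assume i: "i \<in> Inc"
    interpret concave_road "f i" "R i" using i by (intro flux) auto
    have ri: "r0 i \<in> {0..R i}" using r0 i by auto
    obtain \<rho> \<beta> where s: "entropy_solution (f i) (R i) {..<0} (\<lambda>x. r0 i) \<rho>" "lrs_profile_in (f i) (R i) (r0 i) (F_in i) \<rho>"
      "\<beta> \<in> {0..R i}" "f i \<beta> = F_in i" "F_in i = f i (r0 i) \<Longrightarrow> \<beta> = r0 i" "F_in i \<noteq> f i (r0 i) \<Longrightarrow> peak \<le> \<beta>"
      "\<And>t. 0 < t \<Longrightarrow> (\<rho> t \<longlongrightarrow> \<beta>) (at_left 0)"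
      using incoming_exists[OF ri F_in_nonneg[OF i]] by (auto simp: F_in_eq)
    have "F_in i = min (omega_in (f i) (R i) \<beta>) (c i * level)"
    proof (cases "F_in i = f i (r0 i)")
      case True
      thus ?thesis using s(5) by (simp add: F_in_eq min.commute)
    next
      case False
      (* A boundary state that differs from the initial one is congested, so that its demand is maximal. *)
      hence b: "omega_in (f i) (R i) \<beta> = f i peak" using s(6) by (simp add: omega_in_eq min_def)
      show ?thesis
      proof (cases "c i * level \<le> demand i")
        case True
        thus ?thesis using omega_in_bounds(2)[OF ri] by (simp add: F_in_eq b flux_max_eq)
      next
        case n: False
        hence "demand i \<noteq> f i (r0 i)" using False by (simp add: F_in_eq)
        hence "demand i = f i peak" by (auto simp: omega_in_eq min_def split: if_splits)
        thus ?thesis using n by (simp add: F_in_eq b)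
      qed
    qed
    thus "\<exists>\<rho> \<beta>. entropy_solution (f i) (R i) {..<0} (\<lambda>x. r0 i) \<rho> \<and> lrs_profile_in (f i) (R i) (r0 i) (F_in i) \<rho> \<and>
      (\<forall>t>0. (\<rho> t \<longlongrightarrow> \<beta>) (at_left 0)) \<and> f i \<beta> = F_in i \<and> f i \<beta> = min (omega_in (f i) (R i) \<beta>) (c i * level)"
      using s(1,2,4,7) by metis
  qed
  then obtain \<rho>i \<beta>i where i: "\<And>i. i \<in> Inc \<Longrightarrow> entropy_solution (f i) (R i) {..<0} (\<lambda>x. r0 i) (\<rho>i i)"
    "\<And>i. i \<in> Inc \<Longrightarrow> lrs_profile_in (f i) (R i) (r0 i) (F_in i) (\<rho>i i)"
    "\<And>i t. i \<in> Inc \<Longrightarrow> 0 < t \<Longrightarrow> (\<rho>i i t \<longlongrightarrow> \<beta>i i) (at_left 0)"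
    "\<And>i. i \<in> Inc \<Longrightarrow> f i (\<beta>i i) = F_in i"
    "\<And>i. i \<in> Inc \<Longrightarrow> f i (\<beta>i i) = min (omega_in (f i) (R i) (\<beta>i i)) (c i * level)" by metis
  define good where "good = (\<lambda>j \<rho> \<beta>. entropy_solution (f j) (R j) {0<..} (\<lambda>x. r0 j) \<rho> \<and> lrs_profile_out (f j) (R j) (r0 j) (F_out j) \<rho> \<and>
    (\<forall>t>0. (\<rho> t \<longlongrightarrow> \<beta>) (at_right 0)) \<and> f j \<beta> = F_out j \<and> F_out j \<le> omega_out (f j) (R j) \<beta> \<and>
    (F_out j = out_supply j \<longrightarrow> F_out j = omega_out (f j) (R j) \<beta>))"
  have "\<forall>j\<in>Out. \<exists>\<rho> \<beta>. good j \<rho> \<beta>"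
  proof
    fix j assume j: "j \<in> Out"
    interpret concave_road "f j" "R j" using j by (intro flux) auto
    have rj: "r0 j \<in> {0..R j}" using r0 j by auto
    obtain \<rho> \<beta> where s: "entropy_solution (f j) (R j) {0<..} (\<lambda>x. r0 j) \<rho>" "lrs_profile_out (f j) (R j) (r0 j) (F_out j) \<rho>"
      "\<beta> \<in> {0..R j}" "f j \<beta> = F_out j" "F_out j = f j (r0 j) \<Longrightarrow> \<beta> = r0 j" "F_out j \<noteq> f j (r0 j) \<Longrightarrow> \<beta> \<le> peak"
      "\<And>t. 0 < t \<Longrightarrow> (\<rho> t \<longlongrightarrow> \<beta>) (at_right 0)"
      using outgoing_exists[OF rj F_out_nonneg[OF j] F_out_le[OF j]] by blast
    have le: "F_out j \<le> omega_out (f j) (R j) \<beta>" using omega_out_bounds(2)[OF j s(3)] s(4) by simp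
    have "F_out j = omega_out (f j) (R j) \<beta>" if t: "F_out j = out_supply j"
    proof (cases "F_out j = f j (r0 j)")
      case True thus ?thesis using s(5) t by simp
    next
      case False
      (* A boundary state that differs from the initial one is free, so that its supply is maximal. *)
      hence "F_out j = flux_max (f j) (R j)" using t by (auto simp: omega_out_def split: if_splits)
      thus ?thesis using le omega_out_bounds(3)[OF j s(3)] by simp
    qed
    thus "\<exists>\<rho> \<beta>. good j \<rho> \<beta>"
      unfolding good_def using s(1,2,4,7) le by blast
  qed
  then obtain \<rho>j \<beta>j where "\<And>j. j \<in> Out \<Longrightarrow> good j (\<rho>j j) (\<beta>j j)" by metis
  hence j: "\<And>j. j \<in> Out \<Longrightarrow> entropy_solution (f j) (R j) {0<..} (\<lambda>x. r0 j) (\<rho>j j)"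
    "\<And>j. j \<in> Out \<Longrightarrow> lrs_profile_out (f j) (R j) (r0 j) (F_out j) (\<rho>j j)"
    "\<And>j t. j \<in> Out \<Longrightarrow> 0 < t \<Longrightarrow> (\<rho>j j t \<longlongrightarrow> \<beta>j j) (at_right 0)"
    "\<And>j. j \<in> Out \<Longrightarrow> f j (\<beta>j j) = F_out j" "\<And>j. j \<in> Out \<Longrightarrow> F_out j \<le> omega_out (f j) (R j) (\<beta>j j)"
    "\<And>j. j \<in> Out \<Longrightarrow> F_out j = out_supply j \<Longrightarrow> F_out j = omega_out (f j) (R j) (\<beta>j j)"
    unfolding good_def by blast+
  define \<rho> where "\<rho> = (\<lambda>k. if k \<in> Inc then \<rho>i k else \<rho>j k)"
  define \<beta> where "\<beta> = (\<lambda>k. if k \<in> Inc then \<beta>i k else \<beta>j k)"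
  have eq: "k \<in> Inc \<Longrightarrow> \<rho> k = \<rho>i k" "k \<in> Inc \<Longrightarrow> \<beta> k = \<beta>i k"
    "k \<in> Out \<Longrightarrow> \<rho> k = \<rho>j k" "k \<in> Out \<Longrightarrow> \<beta> k = \<beta>j k" for k
    using disj by (auto simp: \<rho>_def \<beta>_def)
  have sumF: "(\<Sum>i\<in>Inc. f i (\<beta> i) * \<theta> i k) = F_out k" for k
    unfolding lrs_flux_out_def by (intro sum.cong) (auto simp: eq i(4))
  have lev: "M - (\<Sum>j\<in>Out. q0 j) = level" using q0 by (simp add: balancing_queues_def)
  have "buffer_solution Inc Out f R M c \<theta> r0 q0 \<rho> (\<lambda>j t. q0 j)"
    unfolding buffer_solution_def
  proof (intro conjI)
    show "\<forall>i\<in>Inc. entropy_solution (f i) (R i) {..<0} (\<lambda>x. r0 i) (\<rho> i)" using i(1) eq(1) by simp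
    show "\<forall>j\<in>Out. entropy_solution (f j) (R j) {0<..} (\<lambda>x. r0 j) (\<rho> j)" using j(1) eq(3) by simp
    have "0-lipschitz_on {0..} (\<lambda>t::real. q0 j)" for j by (rule lipschitz_onI) auto
    thus "\<forall>j\<in>Out. (\<exists>C. C-lipschitz_on {0..} (\<lambda>t::real. q0 j)) \<and> q0 j = q0 j" by blast
    show "\<forall>t\<ge>0. admissible_queues Out M (\<lambda>j. q0 j)" using balancing_admissible[OF q0] by simp
    show "AE t in lborel. 0 < t \<longrightarrow> (\<exists>b.
        (\<forall>i\<in>Inc. (\<rho> i t \<longlongrightarrow> b i) (at_left 0)) \<and>
        (\<forall>j\<in>Out. (\<rho> j t \<longlongrightarrow> b j) (at_right 0)) \<and>
        (\<forall>j\<in>Out. ((\<lambda>t. q0 j) has_real_derivative (\<Sum>i\<in>Inc. f i (b i) * \<theta> i j) - f j (b j)) (at t)) \<and>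
        (\<forall>i\<in>Inc. f i (b i) = min (omega_in (f i) (R i) (b i)) (c i * (M - (\<Sum>j\<in>Out. q0 j)))) \<and>
        (\<forall>j\<in>Out. (0 < q0 j \<longrightarrow> f j (b j) = omega_out (f j) (R j) (b j)) \<and>
                 (q0 j = 0 \<longrightarrow> f j (b j) = min (omega_out (f j) (R j) (b j)) (\<Sum>i\<in>Inc. f i (b i) * \<theta> i j))))"
    proof (rule AE_I2, intro impI exI[of _ \<beta>] conjI ballI)
      fix t :: real and k assume "0 < t"
      show "(\<rho> k t \<longlongrightarrow> \<beta> k) (at_left 0)" if "k \<in> Inc" using i(3) eq that \<open>0 < t\<close> by simp
      show "(\<rho> k t \<longlongrightarrow> \<beta> k) (at_right 0)" if "k \<in> Out" using j(3) eq that \<open>0 < t\<close> by simp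
      show "((\<lambda>t. q0 k) has_real_derivative (\<Sum>i\<in>Inc. f i (\<beta> i) * \<theta> i k) - f k (\<beta> k)) (at t)" if "k \<in> Out"
        by (simp only: sumF eq(4)[OF that] j(4)[OF that] diff_self DERIV_const)
      show "f k (\<beta> k) = min (omega_in (f k) (R k) (\<beta> k)) (c k * (M - (\<Sum>j\<in>Out. q0 j)))" if "k \<in> Inc"
        using i(5)[OF that] that by (simp add: lev eq)
      show "f k (\<beta> k) = omega_out (f k) (R k) (\<beta> k)" if "k \<in> Out" "0 < q0 k"
        using that j(4,6) q0 by (simp add: eq balancing_queues_def)
      show "f k (\<beta> k) = min (omega_out (f k) (R k) (\<beta> k)) (\<Sum>i\<in>Inc. f i (\<beta> i) * \<theta> i k)" if "k \<in> Out" "q0 k = 0"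
        unfolding sumF eq(4)[OF that(1)] using j(4,5)[OF that(1)] by simp
    qed
  qed
  moreover have "lrs_solution Inc Out f R M c \<theta> r0 \<rho>"
    unfolding lrs_solution_def using i(2) j(2) eq by simp
  ultimately show thesis by (rule that)
qed

text \<open>The demand of a road never falls below its initial value, so its inflow can fall short only because of the free space \<open>s\<close>.\<close>

lemma inflow_at_least:
  assumes i: "i \<in> Inc" and d: "demand i \<le> w" and F: "F = min w (c i * s)"
  shows "F_in i - F \<le> c i * \<bar>s - level\<bar>"
proof -
  have "c i * level - c i * s \<le> c i * \<bar>s - level\<bar>"
    using mult_left_mono[of "level - s" "\<bar>s - level\<bar>" "c i"] c[OF i] by (simp add: algebra_simps)
  moreover have "0 \<le> c i * \<bar>s - level\<bar>" using c[OF i] by simp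
  ultimately show ?thesis unfolding F_in_eq F using d by (auto simp: min_def)
qed

text \<open>The inflow can exceed the expected one only because of the free space, if the demand was not the restricting quantity or is
already maximal. The remaining case of a free road restricted by its demand is left to an estimate of the average inflow.\<close>

lemma inflow_at_most:
  assumes i: "i \<in> Inc" and F: "F \<le> c i * s" "F \<le> flux_max (f i) (R i)"
    and nb: "c i * level \<le> demand i \<or> density_max (f i) (R i) \<le> r0 i"
  shows "F - F_in i \<le> c i * \<bar>s - level\<bar>"
proof -
  interpret concave_road "f i" "R i" using i by (intro flux) auto
  have "c i * s - c i * level \<le> c i * \<bar>s - level\<bar>"
    using mult_left_mono[of "s - level" "\<bar>s - level\<bar>" "c i"] c[OF i] by (simp add: algebra_simps)
  moreover have "0 \<le> c i * \<bar>s - level\<bar>" using c[OF i] by simp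
  moreover have "demand i = flux_max (f i) (R i)" if "density_max (f i) (R i) \<le> r0 i"
    using that by (simp add: omega_in_eq flux_max_eq min_def)
  ultimately show ?thesis unfolding F_in_eq using F nb by (auto simp: min_def)
qed

section \<open>Uniqueness of the boundary fluxes\<close>

definition deviation :: "(nat \<Rightarrow> real \<Rightarrow> real) \<Rightarrow> real \<Rightarrow> real" where
  "deviation q t = \<bar>M - (\<Sum>j\<in>Out. q j t) - level\<bar>"

text \<open>The deviation satisfies a Gronwall inequality. The inflows \<open>a\<close> are bounded by the deviation, from below at almost every time,
but from above only on average; hence \<open>D\<close>, a nonnegative majorant of the growth of each queue, is estimated after integration. A
queue grows at most at the rate \<open>D\<close>: where it is empty it has a minimum and hence zero derivative, and where it is not, its outflow is
at least the one prescribed. It shrinks no faster, because only queues in front of exhausted roads can shrink below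
their initial length, and on average such a road does not take more than its supply.\<close>

lemma queues_stay_balanced:
  assumes q0: "balancing_queues q0"
    and lip: "\<And>j. j \<in> Out \<Longrightarrow> \<exists>C. C-lipschitz_on {0..} (q j)" and init: "\<And>j. j \<in> Out \<Longrightarrow> q j 0 = q0 j"
    and q_nonneg: "\<And>j t. j \<in> Out \<Longrightarrow> 0 \<le> t \<Longrightarrow> 0 \<le> q j t"
    and a: "\<And>i. i \<in> Inc \<Longrightarrow> bounded_borel (a i)" and e: "\<And>j. j \<in> Out \<Longrightarrow> bounded_borel (e j)"
    and drift: "\<And>j. j \<in> Out \<Longrightarrow>
      AE t in lborel. 0 < t \<longrightarrow> (q j has_real_derivative (\<Sum>i\<in>Inc. a i t * \<theta> i j) - e j t) (at t)"
    and busy: "\<And>j. j \<in> Out \<Longrightarrow> AE t in lborel. 0 < t \<longrightarrow> 0 < q j t \<longrightarrow> out_supply j \<le> e j t"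
    and low: "\<And>i. i \<in> Inc \<Longrightarrow> AE t in lborel. 0 < t \<longrightarrow> F_in i - a i t \<le> c i * deviation q t"
    and high: "\<And>i T. i \<in> Inc \<Longrightarrow> 0 \<le> T \<Longrightarrow>
      (LINT t:{0..T}|lborel. a i t - F_in i) \<le> c i * (LINT t:{0..T}|lborel. deviation q t)"
    and out: "\<And>j T. j \<in> Out \<Longrightarrow> 0 \<le> T \<Longrightarrow> (LINT t:{0..T}|lborel. e j t - out_supply j) \<le> 0"
  shows "i \<in> Inc \<Longrightarrow> AE t in lborel. 0 < t \<longrightarrow> a i t = F_in i"
    and "j \<in> Out \<Longrightarrow> AE t in lborel. 0 < t \<longrightarrow> e j t = F_out j"
proof -
  define g where "g = deviation q"
  define G where "G = (\<lambda>T. LINT t:{0..T}|lborel. g t)"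
  define A where "A = (\<lambda>i t. a i t - F_in i)"
  define D where "D = (\<lambda>t. \<Sum>i\<in>Inc. A i t + c i * g t)"
  define K where "K = (\<Sum>i\<in>Inc. c i)"
  have K: "0 \<le> K" unfolding K_def using c by (simp add: sum_nonneg less_imp_le)
  have cg: "continuous_on {0..} g"
    unfolding g_def deviation_def[abs_def] using lip lipschitz_on_continuous_on by (intro continuous_intros) blast
  have g_nonneg: "0 \<le> g t" for t by (simp add: g_def deviation_def)
  have G_nonneg: "0 \<le> G T" for T
    unfolding G_def set_lebesgue_integral_def using g_nonneg by (intro Bochner_Integration.integral_nonneg) simp
  have ig: "set_integrable lborel {0..T} (\<lambda>t. k * g t)" for T k
    unfolding set_integrable_def
    by (rule borel_integrable_compact) (auto intro!: continuous_intros continuous_on_subset[OF cg])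
  have ib: "set_integrable lborel {0..T} h" if "bounded_borel h" for h :: "real \<Rightarrow> real" and T
    by (rule set_integrable_bounded[OF that]) auto
  have shift: "bounded_borel (\<lambda>t. h t - k)" if "bounded_borel h" for h :: "real \<Rightarrow> real" and k
    using bounded_borel_add[OF that bounded_borel_const[of "- k"]] by simp
  have bA: "bounded_borel (A i)" if "i \<in> Inc" for i unfolding A_def by (rule shift[OF a[OF that]])
  have low': "AE t in lborel. \<forall>i\<in>Inc. 0 < t \<longrightarrow> 0 \<le> A i t + c i * g t"
  proof (rule AE_finite_allI[OF fin(1)])
    show "AE t in lborel. 0 < t \<longrightarrow> 0 \<le> A i t + c i * g t" if "i \<in> Inc" for i
      using low[OF that] by eventually_elim (auto simp: A_def g_def)
  qed
  have iAg: "set_integrable lborel {0..T} (\<lambda>t. A i t + c i * g t)" if "i \<in> Inc" for T i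
    by (rule set_integral_add(1)[OF ib[OF bA[OF that]] ig])
  have iD: "set_integrable lborel {0..T} D" for T
    using iAg unfolding D_def set_integrable_def scaleR_sum_right by (intro Bochner_Integration.integrable_sum) blast
  have D_le: "(LINT t:{0..T}|lborel. D t) \<le> 2 * K * G T" if T: "0 \<le> T" for T
  proof -
    have "(LINT t:{0..T}|lborel. D t) = (\<Sum>i\<in>Inc. LINT t:{0..T}|lborel. A i t + c i * g t)"
      unfolding set_lebesgue_integral_def D_def scaleR_sum_right
      by (rule Bochner_Integration.integral_sum) (use iAg in \<open>simp only: set_integrable_def\<close>)
    also have "\<dots> \<le> (\<Sum>i\<in>Inc. 2 * c i * G T)"
    proof (rule sum_mono)
      fix i assume i: "i \<in> Inc"
      have "(LINT t:{0..T}|lborel. A i t + c i * g t) = (LINT t:{0..T}|lborel. A i t) + c i * G T"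
        by (simp add: set_integral_add(2)[OF ib[OF bA[OF i]] ig] G_def)
      thus "(LINT t:{0..T}|lborel. A i t + c i * g t) \<le> 2 * c i * G T"
        using high[OF i T] by (simp add: A_def G_def g_def)
    qed
    also have "\<dots> = 2 * K * G T" by (simp add: K_def sum_distrib_left sum_distrib_right)
    finally show ?thesis .
  qed
  have AE_mono: "(LINT t:{0..T}|lborel. h t) \<le> (LINT t:{0..T}|lborel. k t)"
    if "AE t in lborel. 0 < t \<longrightarrow> h t \<le> k t" "set_integrable lborel {0..T} h" "set_integrable lborel {0..T} k"
    for h k :: "real \<Rightarrow> real" and T
    unfolding set_lebesgue_integral_def
  proof (rule integral_mono_AE)
    show "AE t in lborel. indicator {0..T} t *\<^sub>R h t \<le> indicator {0..T} t *\<^sub>R k t"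
      using that(1) AE_lborel_singleton[of "0::real"] by eventually_elim (auto simp: indicator_def)
  qed (use that in \<open>auto simp: set_integrable_def\<close>)
  define d where "d = (\<lambda>j t. (\<Sum>i\<in>Inc. a i t * \<theta> i j) - e j t)"
  have d_eq: "d j t = (\<Sum>i\<in>Inc. A i t * \<theta> i j) + (F_out j - e j t)" for j t
    by (simp add: d_def A_def lrs_flux_out_def sum_subtractf left_diff_distrib)
  have bd: "bounded_borel (d j)" if j: "j \<in> Out" for j
  proof -
    have "bounded_borel (\<lambda>t. \<Sum>i\<in>S. a i t * \<theta> i j)" if "S \<subseteq> Inc" for S
      using finite_subset[OF that fin(1)] that
      by (induction S rule: finite_induct) (auto intro!: bounded_borel_add bounded_borel_mult a)
    from bounded_borel_add[OF this[OF order_refl] bounded_borel_mult[OF bounded_borel_const[of "-1"] e[OF j]]]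
    show ?thesis by (simp add: d_def)
  qed
  have FTC: "(LINT t:{0..T}|lborel. d j t) = q j T - q0 j" if j: "j \<in> Out" and T: "0 \<le> T" for j T
  proof -
    obtain C where C: "C-lipschitz_on {0..} (q j)" using lip[OF j] by blast
    show ?thesis
      using lipschitz_FTC[OF C drift[OF j] _ T] bd[OF j] by (simp add: bounded_borel_def d_def init[OF j])
  qed
  have upper: "q j T - q0 j \<le> 2 * K * G T" if j: "j \<in> Out" and T: "0 \<le> T" for j T
  proof -
    have "(LINT t:{0..T}|lborel. d j t) \<le> (LINT t:{0..T}|lborel. D t)"
    proof (rule AE_mono[OF _ ib[OF bd[OF j]] iD])
      show "AE t in lborel. 0 < t \<longrightarrow> d j t \<le> D t"
        using drift[OF j] busy[OF j] low'
      proof (eventually_elim, intro impI)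
        fix t assume t: "0 < t" and h: "0 < t \<longrightarrow> (q j has_real_derivative (\<Sum>i\<in>Inc. a i t * \<theta> i j) - e j t) (at t)"
          "0 < t \<longrightarrow> 0 < q j t \<longrightarrow> out_supply j \<le> e j t" "\<forall>i\<in>Inc. 0 < t \<longrightarrow> 0 \<le> A i t + c i * g t"
        show "d j t \<le> D t"
        proof (cases "q j t = 0")
          case True
          have "d j t = 0"
          proof (rule DERIV_local_min)
            show "(q j has_real_derivative d j t) (at t)" using h(1) t by (simp add: d_def)
            (* An empty queue is at its minimum. *)
            show "\<forall>y. \<bar>t - y\<bar> < t \<longrightarrow> q j t \<le> q j y" using True q_nonneg[OF j] by auto
          qed (rule t)
          also have "0 \<le> D t" unfolding D_def using h(3) t by (intro sum_nonneg) simp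
          finally show ?thesis .
        next
          case False
          hence "0 < q j t" using q_nonneg[OF j, of t] t by simp
          hence "F_out j \<le> e j t" using h(2) t F_out_le[OF j] by simp
          hence "d j t \<le> (\<Sum>i\<in>Inc. A i t * \<theta> i j)" by (simp add: d_eq)
          also have "\<dots> \<le> D t" unfolding D_def
          proof (rule sum_mono)
            fix i assume i: "i \<in> Inc"
            have "0 \<le> c i * g t" using c[OF i] g_nonneg[of t] by simp
            hence "A i t * \<theta> i j \<le> (A i t + c i * g t) * \<theta> i j" using \<theta>(1)[OF i j] by (intro mult_right_mono) auto
            also have "\<dots> \<le> (A i t + c i * g t) * 1" using h(3) i t \<theta>(2)[OF i j] by (intro mult_left_mono) auto
            finally show "A i t * \<theta> i j \<le> A i t + c i * g t" by simp
          qed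
          finally show ?thesis .
        qed
      qed
    qed
    thus ?thesis using FTC[OF j T] D_le[OF T] by simp
  qed
  have lower: "q0 j - q j T \<le> 2 * K * G T" if j: "j \<in> Out" and T: "0 \<le> T" for j T
  proof (cases "0 < q0 j")
    case False
    hence "q0 j \<le> 0" by simp
    thus ?thesis using q_nonneg[OF j T] mult_nonneg_nonneg[OF K G_nonneg[of T]] by linarith
  next
    case True
    hence full: "F_out j = out_supply j" using q0 j by (simp add: balancing_queues_def)
    have ie: "set_integrable lborel {0..T} (\<lambda>t. e j t - out_supply j)" by (intro ib shift e j)
    have "(LINT t:{0..T}|lborel. - 1 * d j t) \<le> (LINT t:{0..T}|lborel. (e j t - out_supply j) + K * g t)"
    proof (rule AE_mono[OF _ ib[OF bounded_borel_mult[OF bounded_borel_const bd[OF j]]] set_integral_add(1)[OF ie ig]])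
      show "AE t in lborel. 0 < t \<longrightarrow> - 1 * d j t \<le> (e j t - out_supply j) + K * g t"
        using low'
      proof (eventually_elim, intro impI)
        fix t assume t: "0 < t" and h: "\<forall>i\<in>Inc. 0 < t \<longrightarrow> 0 \<le> A i t + c i * g t"
        have "(\<Sum>i\<in>Inc. - (A i t * \<theta> i j)) \<le> (\<Sum>i\<in>Inc. c i * g t)"
        proof (rule sum_mono)
          fix i assume i: "i \<in> Inc"
          have "- A i t * \<theta> i j \<le> (c i * g t) * \<theta> i j" using h t i \<theta>(1)[OF i j] by (intro mult_right_mono) auto
          also have "\<dots> \<le> (c i * g t) * 1" using c[OF i] g_nonneg[of t] \<theta>(2)[OF i j] by (intro mult_left_mono) auto
          finally show "- (A i t * \<theta> i j) \<le> c i * g t" by simp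
        qed
        thus "- 1 * d j t \<le> (e j t - out_supply j) + K * g t"
          by (simp add: d_eq full K_def sum_negf sum_distrib_right)
      qed
    qed
    also have "\<dots> = (LINT t:{0..T}|lborel. e j t - out_supply j) + K * G T"
      using set_integral_add(2)[OF ie ig] by (simp add: G_def)
    finally have "(LINT t:{0..T}|lborel. - 1 * d j t) \<le> K * G T" using out[OF j T] by linarith
    hence "- (q j T - q0 j) \<le> K * G T" unfolding set_integral_mult_right FTC[OF j T] by simp
    thus ?thesis using mult_nonneg_nonneg[OF K G_nonneg[of T]] by simp
  qed
  have g_zero: "g T = 0" if T: "0 \<le> T" for T
  proof (rule gronwall_zero[OF cg g_nonneg _ _ T])
    show "0 \<le> real (card Out) * (2 * K)" using K by simp
    fix T :: real assume T: "0 \<le> T"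
    have "M - (\<Sum>j\<in>Out. q j T) - level = (\<Sum>j\<in>Out. q0 j - q j T)"
      using q0 by (simp add: balancing_queues_def sum_subtractf)
    hence "g T = \<bar>\<Sum>j\<in>Out. q0 j - q j T\<bar>" by (simp add: g_def deviation_def)
    also have "\<dots> \<le> (\<Sum>j\<in>Out. \<bar>q0 j - q j T\<bar>)" by (rule sum_abs)
    also have "\<dots> \<le> (\<Sum>j\<in>Out. 2 * K * G T)"
      by (rule sum_mono) (use upper[OF _ T] lower[OF _ T] in \<open>fastforce simp: abs_le_iff\<close>)
    finally show "g T \<le> real (card Out) * (2 * K) * (LINT t:{0..T}|lborel. g t)" by (simp add: G_def)
  qed
  have G_zero: "G T = 0" for T
  proof -
    have "G T = (LINT t:{0..T}|lborel. 0)" unfolding G_def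
      by (intro set_lebesgue_integral_cong) (use g_zero in auto)
    thus ?thesis by simp
  qed
  have in_eq: "AE t in lborel. 0 < t \<longrightarrow> A i t = 0" if i: "i \<in> Inc" for i
  proof (rule nonneg_zero_of_integrals[OF bA[OF i]])
    show "AE t in lborel. 0 < t \<longrightarrow> 0 \<le> A i t" using low' by eventually_elim (use i g_zero in force)
    show "(LINT t:{0..T}|lborel. A i t) \<le> 0" if "0 \<le> T" for T
      using high[OF i that] G_zero[of T] by (simp add: A_def G_def g_def)
  qed
  thus "AE t in lborel. 0 < t \<longrightarrow> a i t = F_in i" if "i \<in> Inc" for i using that by (simp add: A_def)
  have all_in: "AE t in lborel. \<forall>i\<in>Inc. 0 < t \<longrightarrow> A i t = 0" by (rule AE_finite_allI[OF fin(1) in_eq])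
  show "AE t in lborel. 0 < t \<longrightarrow> e j t = F_out j" if j: "j \<in> Out" for j
    using all_in drift[OF j]
  proof (eventually_elim, intro impI)
    fix t assume t: "0 < t" and h: "\<forall>i\<in>Inc. 0 < t \<longrightarrow> A i t = 0"
      "0 < t \<longrightarrow> (q j has_real_derivative (\<Sum>i\<in>Inc. a i t * \<theta> i j) - e j t) (at t)"
    have const: "q j T = q0 j" if "0 \<le> T" for T using upper[OF j that] lower[OF j that] G_zero[of T] by simp
    have "(q j has_real_derivative 0) (at t)"
      by (rule has_field_derivative_transform_within_open[of "\<lambda>_. q0 j" _ _ "{0<..}"]) (use t const in auto)
    moreover have "(q j has_real_derivative d j t) (at t)" using h(2) t by (simp add: d_def)
    ultimately have "d j t = 0" using DERIV_unique by blast
    thus "e j t = F_out j" using h(1) t by (simp add: d_eq)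
  qed
qed

text \<open>Traces exist and satisfy the laws of the junction at almost every time. On the outgoing roads the supply plays the role of
the demand: it does not fall below its initial value, and on average the outflow does not exceed it.\<close>

lemma boundary_fluxes_unique:
  assumes sol: "buffer_solution Inc Out f R M c \<theta> r0 q0 \<rho> q" and q0: "balancing_queues q0"
  shows "\<And>i. i \<in> Inc \<Longrightarrow> AE t in lborel. 0 < t \<longrightarrow> (\<exists>\<beta>. (\<rho> i t \<longlongrightarrow> \<beta>) (at_left 0) \<and> f i \<beta> = F_in i)"
    and "\<And>j. j \<in> Out \<Longrightarrow> AE t in lborel. 0 < t \<longrightarrow> (\<exists>\<beta>. (\<rho> j t \<longlongrightarrow> \<beta>) (at_right 0) \<and> f j \<beta> = F_out j)"
proof -
  have esol: "\<And>i. i \<in> Inc \<Longrightarrow> entropy_solution (f i) (R i) {..<0} (\<lambda>x. r0 i) (\<rho> i)"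
    "\<And>j. j \<in> Out \<Longrightarrow> entropy_solution (f j) (R j) {0<..} (\<lambda>x. r0 j) (\<rho> j)"
    and lip: "\<And>j. j \<in> Out \<Longrightarrow> \<exists>C. C-lipschitz_on {0..} (q j)" and init: "\<And>j. j \<in> Out \<Longrightarrow> q j 0 = q0 j"
    and adm: "\<And>t. 0 \<le> t \<Longrightarrow> admissible_queues Out M (\<lambda>j. q j t)"
    using sol unfolding buffer_solution_def by blast+
  define law where "law = (\<lambda>t b. (\<forall>i\<in>Inc. (\<rho> i t \<longlongrightarrow> b i) (at_left 0)) \<and>
        (\<forall>j\<in>Out. (\<rho> j t \<longlongrightarrow> b j) (at_right 0)) \<and>
        (\<forall>j\<in>Out. (q j has_real_derivative (\<Sum>i\<in>Inc. f i (b i) * \<theta> i j) - f j (b j)) (at t)) \<and>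
        (\<forall>i\<in>Inc. f i (b i) = min (omega_in (f i) (R i) (b i)) (c i * (M - (\<Sum>j\<in>Out. q j t)))) \<and>
        (\<forall>j\<in>Out. (0 < q j t \<longrightarrow> f j (b j) = omega_out (f j) (R j) (b j)) \<and>
                 (q j t = 0 \<longrightarrow> f j (b j) = min (omega_out (f j) (R j) (b j)) (\<Sum>i\<in>Inc. f i (b i) * \<theta> i j))))"
  have law: "AE t in lborel. 0 < t \<longrightarrow> (\<exists>b. law t b)"
    using sol unfolding buffer_solution_def law_def by blast
  define trace_in where "trace_in = (\<lambda>i b. b \<in> borel_measurable borel \<and> (\<forall>t. b t \<in> {0..R i}) \<and>
    (AE t in lborel. 0 < t \<longrightarrow> (\<rho> i t \<longlongrightarrow> b t) (at_left 0)) \<and>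
    (AE t in lborel. 0 < t \<longrightarrow> demand i \<le> omega_in (f i) (R i) (b t)) \<and>
    (\<forall>T\<ge>0. r0 i \<le> density_max (f i) (R i) \<longrightarrow> (LINT t:{0..T}|lborel. f i (b t) - f i (r0 i)) \<le> 0))"
  define trace_out where "trace_out = (\<lambda>j b. b \<in> borel_measurable borel \<and> (\<forall>t. b t \<in> {0..R j}) \<and>
    (AE t in lborel. 0 < t \<longrightarrow> (\<rho> j t \<longlongrightarrow> b t) (at_right 0)) \<and>
    (AE t in lborel. 0 < t \<longrightarrow> out_supply j \<le> omega_out (f j) (R j) (b t)) \<and>
    (\<forall>T\<ge>0. density_max (f j) (R j) \<le> r0 j \<longrightarrow> (LINT t:{0..T}|lborel. f j (b t) - f j (r0 j)) \<le> 0))"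
  have "\<exists>b. trace_in i b" if i: "i \<in> Inc" for i
  proof -
    interpret concave_road "f i" "R i" using i by (intro flux) auto
    have tr: "AE t in lborel. 0 < t \<longrightarrow> (\<exists>\<beta>. (\<rho> i t \<longlongrightarrow> \<beta>) (at_left 0))"
      using law by eventually_elim (use i in \<open>auto simp: law_def\<close>)
    have "r0 i \<in> {0..R i}" using r0 i by auto
    thus ?thesis unfolding trace_in_def by (rule incoming_trace[OF esol(1)[OF i] _ tr]) blast
  qed
  moreover have "\<exists>b. trace_out j b" if j: "j \<in> Out" for j
  proof -
    interpret concave_road "f j" "R j" using j by (intro flux) auto
    have tr: "AE t in lborel. 0 < t \<longrightarrow> (\<exists>\<beta>. (\<rho> j t \<longlongrightarrow> \<beta>) (at_right 0))"
      using law by eventually_elim (use j in \<open>auto simp: law_def\<close>)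
    have "r0 j \<in> {0..R j}" using r0 j by auto
    thus ?thesis unfolding trace_out_def by (rule outgoing_trace[OF esol(2)[OF j] _ tr]) blast
  qed
  ultimately have "\<forall>k. \<exists>b. (k \<in> Inc \<longrightarrow> trace_in k b) \<and> (k \<in> Out \<longrightarrow> trace_out k b)" using disj by blast
  then obtain b where b: "\<And>k. k \<in> Inc \<Longrightarrow> trace_in k (b k)" "\<And>k. k \<in> Out \<Longrightarrow> trace_out k (b k)" by metis
  have in_lim: "AE t in lborel. 0 < t \<longrightarrow> (\<rho> i t \<longlongrightarrow> b i t) (at_left 0)" if "i \<in> Inc" for i
    using b(1)[OF that] by (simp add: trace_in_def)
  have out_lim: "AE t in lborel. 0 < t \<longrightarrow> (\<rho> j t \<longlongrightarrow> b j t) (at_right 0)" if "j \<in> Out" for j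
    using b(2)[OF that] by (simp add: trace_out_def)
  have "AE t in lborel. \<forall>i\<in>Inc. 0 < t \<longrightarrow> (\<rho> i t \<longlongrightarrow> b i t) (at_left 0)"
    by (rule AE_finite_allI[OF fin(1)]) (rule in_lim)
  moreover have "AE t in lborel. \<forall>j\<in>Out. 0 < t \<longrightarrow> (\<rho> j t \<longlongrightarrow> b j t) (at_right 0)"
    by (rule AE_finite_allI[OF fin(2)]) (rule out_lim)
  ultimately have good: "AE t in lborel. 0 < t \<longrightarrow> law t (\<lambda>k. b k t)"
    using law
  proof (eventually_elim, intro impI)
    fix t assume t: "0 < t" and h: "\<forall>i\<in>Inc. 0 < t \<longrightarrow> (\<rho> i t \<longlongrightarrow> b i t) (at_left 0)"
      "\<forall>j\<in>Out. 0 < t \<longrightarrow> (\<rho> j t \<longlongrightarrow> b j t) (at_right 0)" "0 < t \<longrightarrow> (\<exists>b. law t b)"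
    obtain \<beta> where \<beta>: "law t \<beta>" using h(3) t by blast
    have eq: "\<beta> k = b k t" if "k \<in> Inc \<union> Out" for k
      using that
    proof
      assume "k \<in> Inc"
      thus ?thesis using \<beta> h(1) t tendsto_unique[of "at_left (0::real)" "\<rho> k t"] unfolding law_def by simp
    next
      assume "k \<in> Out"
      thus ?thesis using \<beta> h(2) t tendsto_unique[of "at_right (0::real)" "\<rho> k t"] unfolding law_def by simp
    qed
    have sums: "(\<Sum>i\<in>Inc. f i (\<beta> i) * \<theta> i j) = (\<Sum>i\<in>Inc. f i (b i t) * \<theta> i j)" for j
      by (intro sum.cong) (auto simp: eq)
    have "law t \<beta> \<longleftrightarrow> law t (\<lambda>k. b k t)"
      unfolding law_def sums by (simp only: eq Un_iff simp_thms cong: ball_cong)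
    with \<beta> show "law t (\<lambda>k. b k t)" by blast
  qed
  have bb: "bounded_borel (\<lambda>t. f k (b k t))" if "k \<in> Inc \<union> Out" for k
    using that b[of k] concave_road.continuous_flux[OF flux[OF that]] disj
    by (intro bounded_borel_compose) (auto simp: trace_in_def trace_out_def)
  have q_nonneg: "0 \<le> q j t" if "j \<in> Out" "0 \<le> t" for j t
    using adm[OF that(2)] that(1) by (simp add: admissible_queues_def)
  have drift: "AE t in lborel. 0 < t \<longrightarrow> (q j has_real_derivative (\<Sum>i\<in>Inc. f i (b i t) * \<theta> i j) - f j (b j t)) (at t)"
    if "j \<in> Out" for j
    using good by eventually_elim (use that in \<open>unfold law_def, blast\<close>)
  have busy: "AE t in lborel. 0 < t \<longrightarrow> 0 < q j t \<longrightarrow> out_supply j \<le> f j (b j t)" if j: "j \<in> Out" for j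
  proof -
    have "AE t in lborel. 0 < t \<longrightarrow> out_supply j \<le> omega_out (f j) (R j) (b j t)"
      using b(2)[OF j] by (simp add: trace_out_def)
    with good show ?thesis by eventually_elim (use j in \<open>simp add: law_def\<close>)
  qed
  have low: "AE t in lborel. 0 < t \<longrightarrow> F_in i - f i (b i t) \<le> c i * deviation q t" if i: "i \<in> Inc" for i
  proof -
    have "AE t in lborel. 0 < t \<longrightarrow> demand i \<le> omega_in (f i) (R i) (b i t)"
      using b(1)[OF i] by (simp add: trace_in_def)
    with good show ?thesis
    proof (eventually_elim, intro impI)
      fix t assume "0 < t" "0 < t \<longrightarrow> law t (\<lambda>k. b k t)" "0 < t \<longrightarrow> demand i \<le> omega_in (f i) (R i) (b i t)"
      thus "F_in i - f i (b i t) \<le> c i * deviation q t"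
        unfolding deviation_def law_def using i by (intro inflow_at_least[OF i]) auto
    qed
  qed
  have high: "(LINT t:{0..T}|lborel. f i (b i t) - F_in i) \<le> c i * (LINT t:{0..T}|lborel. deviation q t)"
    if i: "i \<in> Inc" and T: "0 \<le> T" for i T
  proof (cases "c i * level \<le> demand i \<or> density_max (f i) (R i) \<le> r0 i")
    case True
    interpret concave_road "f i" "R i" using i by (intro flux) auto
    have bR: "b i t \<in> {0..R i}" for t using b(1)[OF i] by (simp add: trace_in_def)
    have "continuous_on {0..} (deviation q)"
      unfolding deviation_def[abs_def] using lip lipschitz_on_continuous_on by (intro continuous_intros) blast
    hence int: "integrable lborel (\<lambda>t. indicator {0..T} t *\<^sub>R (c i * deviation q t))"
      by (intro borel_integrable_compact continuous_intros) (auto intro: continuous_on_subset)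
    have "(LINT t:{0..T}|lborel. f i (b i t) - F_in i) \<le> (LINT t:{0..T}|lborel. c i * deviation q t)"
      unfolding set_lebesgue_integral_def
    proof (rule integral_mono_AE[OF _ int])
      have "bounded_borel (\<lambda>t. f i (b i t) - F_in i)"
        using bounded_borel_add[OF bb bounded_borel_const[of "- F_in i"], of i] i by simp
      from set_integrable_bounded[OF this, of "{0..T}"]
      show "integrable lborel (\<lambda>t. indicator {0..T} t *\<^sub>R (f i (b i t) - F_in i))" by (simp add: set_integrable_def)
      show "AE t in lborel. indicator {0..T} t *\<^sub>R (f i (b i t) - F_in i) \<le> indicator {0..T} t *\<^sub>R (c i * deviation q t)"
        using good AE_lborel_singleton[of "0::real"]
      proof eventually_elim
        fix t assume h: "0 < t \<longrightarrow> law t (\<lambda>k. b k t)" "t \<noteq> 0"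
        show "indicator {0..T} t *\<^sub>R (f i (b i t) - F_in i) \<le> indicator {0..T} t *\<^sub>R (c i * deviation q t)"
        proof (cases "t \<in> {0..T}")
          case t: True
          hence "f i (b i t) = min (omega_in (f i) (R i) (b i t)) (c i * (M - (\<Sum>j\<in>Out. q j t)))"
            using h i by (auto simp: law_def)
          hence "f i (b i t) - F_in i \<le> c i * deviation q t" unfolding deviation_def
            by (intro inflow_at_most[OF i _ _ True]) (use omega_in_bounds(2)[OF bR[of t]] in linarith)+
          thus ?thesis using t by simp
        qed simp
      qed
    qed
    thus ?thesis by simp
  next
    case False
    have "demand i = f i (r0 i)" using False by (simp add: omega_in_def)
    hence "F_in i = f i (r0 i)" using False by (simp add: F_in_eq)
    hence "(LINT t:{0..T}|lborel. f i (b i t) - F_in i) \<le> 0"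
      using b(1)[OF i] False T by (simp add: trace_in_def)
    also have "\<dots> \<le> c i * (LINT t:{0..T}|lborel. deviation q t)"
      unfolding set_lebesgue_integral_def using c[OF i]
      by (intro mult_nonneg_nonneg Bochner_Integration.integral_nonneg) (auto simp: deviation_def)
    finally show ?thesis .
  qed
  have out: "(LINT t:{0..T}|lborel. f j (b j t) - out_supply j) \<le> 0" if j: "j \<in> Out" and T: "0 \<le> T" for j T
  proof (cases "density_max (f j) (R j) \<le> r0 j")
    case True
    hence "out_supply j = f j (r0 j)" by (simp add: omega_out_def)
    thus ?thesis using b(2)[OF j] True T by (simp add: trace_out_def)
  next
    case False
    interpret concave_road "f j" "R j" using j by (intro flux) auto
    have "out_supply j = f j peak" using False by (simp add: omega_out_def flux_max_eq)
    moreover have "f j (b j t) \<le> f j peak" for t using b(2)[OF j] by (intro peak(2)) (simp add: trace_out_def)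
    ultimately have "(LINT t:{0..T}|lborel. f j (b j t) - out_supply j) \<le> (LINT t|(lborel :: real measure). 0)"
      unfolding set_lebesgue_integral_def by (intro integral_mono') (auto simp: indicator_def)
    thus ?thesis by simp
  qed
  note fluxes = queues_stay_balanced[OF q0 lip init q_nonneg bb bb drift busy low high out]
  show "AE t in lborel. 0 < t \<longrightarrow> (\<exists>\<beta>. (\<rho> i t \<longlongrightarrow> \<beta>) (at_left 0) \<and> f i \<beta> = F_in i)" if i: "i \<in> Inc" for i
  proof -
    have "AE t in lborel. 0 < t \<longrightarrow> f i (b i t) = F_in i" by (rule fluxes(1)) (use i in auto)
    with in_lim[OF i] show ?thesis by eventually_elim blast
  qed
  show "AE t in lborel. 0 < t \<longrightarrow> (\<exists>\<beta>. (\<rho> j t \<longlongrightarrow> \<beta>) (at_right 0) \<and> f j \<beta> = F_out j)" if j: "j \<in> Out" for j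
  proof -
    have "AE t in lborel. 0 < t \<longrightarrow> f j (b j t) = F_out j" by (rule fluxes(2)) (use j in auto)
    with out_lim[OF j] show ?thesis by eventually_elim blast
  qed
qed

end

theorem theorem1:
  fixes m n :: nat and Inc Out :: "nat set"
    and f :: "nat \<Rightarrow> real \<Rightarrow> real" and R :: "nat \<Rightarrow> real"
    and M :: real and c :: "nat \<Rightarrow> real"
    and r0 :: "nat \<Rightarrow> real" and \<theta> :: "nat \<Rightarrow> nat \<Rightarrow> real"
  assumes "Inc = {1..m}" and "Out = {m+1..m+n}"
    and "\<And>k. k \<in> Inc \<union> Out \<Longrightarrow> concave_flux (f k) (R k)"
    and "M > 0"
    and "\<And>i. i \<in> Inc \<Longrightarrow> c i > 0"
    and "\<And>i. i \<in> Inc \<Longrightarrow> c i * M > flux_max (f i) (R i)"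
    and "\<And>k. k \<in> Inc \<union> Out \<Longrightarrow> r0 k \<in> {0..<R k}"
    and "\<And>i j. i \<in> Inc \<Longrightarrow> j \<in> Out \<Longrightarrow> \<theta> i j \<in> {0..1}"
    and "\<And>i. i \<in> Inc \<Longrightarrow> (\<Sum>j\<in>Out. \<theta> i j) = 1"
  shows "\<exists>q0. admissible_queues Out M q0 \<and>
     (\<exists>\<rho> q. buffer_solution Inc Out f R M c \<theta> r0 q0 \<rho> q) \<and>
     (\<exists>\<rho>h. lrs_solution Inc Out f R M c \<theta> r0 \<rho>h) \<and>
     (\<forall>\<rho> q \<rho>h. buffer_solution Inc Out f R M c \<theta> r0 q0 \<rho> q \<longrightarrow>
        lrs_solution Inc Out f R M c \<theta> r0 \<rho>h \<longrightarrow>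
        (\<forall>t>0. (\<forall>i\<in>Inc. AE x in lborel. x < 0 \<longrightarrow> \<rho> i t x = \<rho>h i t x) \<and>
               (\<forall>j\<in>Out. AE x in lborel. x > 0 \<longrightarrow> \<rho> j t x = \<rho>h j t x)))"
proof -
  interpret junction Inc Out f R M c r0 \<theta>
  proof unfold_locales
    show "finite Inc" "finite Out" "Inc \<inter> Out = {}" using assms(1,2) by auto
    show "concave_flux (f k) (R k)" "r0 k \<in> {0..R k}" if "k \<in> Inc \<union> Out" for k
      using assms(3)[OF that] assms(7)[OF that] by auto
    show "0 < M" by (rule assms(4))
    show "0 < c i" if "i \<in> Inc" for i by (rule assms(5)[OF that])
    show "0 \<le> \<theta> i j" "\<theta> i j \<le> 1" if "i \<in> Inc" "j \<in> Out" for i j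
      using assms(8)[OF that] by auto
  qed
  obtain q0 where q0: "balancing_queues q0" using balancing_queues_exist by blast
  obtain \<rho>0 where "buffer_solution Inc Out f R M c \<theta> r0 q0 \<rho>0 (\<lambda>j t. q0 j)" "lrs_solution Inc Out f R M c \<theta> r0 \<rho>0"
    using solutions_exist[OF q0] by blast
  moreover have "AE x in lborel. x < 0 \<longrightarrow> \<rho> i t x = \<rho>h i t x"
    if b: "buffer_solution Inc Out f R M c \<theta> r0 q0 \<rho> q" and h: "lrs_solution Inc Out f R M c \<theta> r0 \<rho>h"
      and t: "0 < t" and i: "i \<in> Inc" for \<rho> q \<rho>h t i
  proof (rule concave_road.incoming_unique[OF flux])
    show "entropy_solution (f i) (R i) {..<0} (\<lambda>x. r0 i) (\<rho> i)" using b i unfolding buffer_solution_def by blast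
    show "lrs_profile_in (f i) (R i) (r0 i) (F_in i) (\<rho>h i)" using h i unfolding lrs_solution_def by blast
  qed (use i t r0 boundary_fluxes_unique(1)[OF b q0 i] in auto)
  moreover have "AE x in lborel. x > 0 \<longrightarrow> \<rho> j t x = \<rho>h j t x"
    if b: "buffer_solution Inc Out f R M c \<theta> r0 q0 \<rho> q" and h: "lrs_solution Inc Out f R M c \<theta> r0 \<rho>h"
      and t: "0 < t" and j: "j \<in> Out" for \<rho> q \<rho>h t j
  proof (rule concave_road.outgoing_unique[OF flux])
    show "entropy_solution (f j) (R j) {0<..} (\<lambda>x. r0 j) (\<rho> j)" using b j unfolding buffer_solution_def by blast
    show "lrs_profile_out (f j) (R j) (r0 j) (F_out j) (\<rho>h j)" using h j unfolding lrs_solution_def by blast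
  qed (use j t r0 boundary_fluxes_unique(2)[OF b q0 j] in auto)
  ultimately show ?thesis using balancing_admissible[OF q0] by blast
qed

end
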